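(* Let $(X,\mu,S)$ be a finitely generated multiplicative system. Then for any $F\in L^2(X)$, $$\lim_{N\to\infty}\frac{1}{N}\sum_{n=1}^N S_nF=\prod_{p\in\mathbb{P}}\Big(1-\frac{1}{p}\Big)\Big(1-\frac{S_p}{p}\Big)^{-1}\mathbb{E}(F\mid\sigma(\mathcal{I}_{\mathrm{pr}}))\qquad\text{in } L^2(X).$$ Moreover, $(X,\mu,S)$ is pretentiously ergodic if and only if for any $F\in L^2(X)$, $$\lim_{N\to\infty}\frac{1}{N}\sum_{n=1}^N S_nF=\int_X F\,d\mu\qquad\text{in } L^2(X).$$
   Context: $\mathbb{N}=\{1,2,\dots\}$ and $\mathbb{P}$ is the set of primes. Every probability space $(X,\mu)$ is assumed regular: $X$ is a compact metric space with its Borel $\sigma$-algebra. A multiplicative system $(X,\mu,S)$ consists of a probability space $(X,\mu)$ and a sequence $S=(S_n)_{n\in\mathbb{N}}$ of commuting invertible measure-preserving transformations of $(X,\mu)$ with $S_{nm}=S_n\circ S_m$ for all $n,m\in\mathbb{N}$. It is finitely generated if $\{S_p:p\in\mathbb{P}\}$ is a finite set. For $F\in L^2(X)$ (complex valued) write $S_nF=F\circ S_n$. A measurable set $A\subseteq X$ pretends to be invariant if $\frac12\sum_{p\in\mathbb{P}}\frac{\|S_p\mathbf{1}_A-\mathbf{1}_A\|_2^2}{p}<\infty$. $\mathcal{I}_{\mathrm{pr}}$ denotes the collection of all such sets, $\sigma(\mathcal{I}_{\mathrm{pr}})$ the $\sigma$-algebra generated by it, and $\mathbb{E}(\cdot\mid\sigma(\mathcal{I}_{\mathrm{pr}}))$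 the conditional expectation. The system is pretentiously ergodic if $\mu(A)\in\{0,1\}$ for every $A\in\mathcal{I}_{\mathrm{pr}}$. For $p\in\mathbb{P}$, $\big(1-\frac{S_p}{p}\big)^{-1}:=\sum_{k\geq 0}\frac{S_{p^k}}{p^k}$, a bounded linear operator on $L^2(X)$. The infinite product of (commuting) operators applied to a function is the limit in $L^2(X)$, as $N\to\infty$, of the products over primes $p\leq N$ applied to that function. *)

theory Defs
  imports "HOL-Probability.Probability" "HOL-Computational_Algebra.Primes"
begin

definition invertible_mpt :: "'a measure \<Rightarrow> ('a \<Rightarrow> 'a) \<Rightarrow> bool" where
  "invertible_mpt M T \<longleftrightarrow>
     bij_betw T (space M) (space M) \<and>
     T \<in> measurable M M \<and>
     the_inv_into (space M) T \<in> measurable M M \<and>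
     distr M M T = M"

(* The underlying compact metric space is the carrier \<open>space M\<close>, a compact subset of the ambient
   metric type.  Only the maps S n with n \<ge> 1 matter; S 0 is unconstrained. *)
locale multiplicative_system = prob_space M
  for M :: "'a::metric_space measure" +
  fixes S :: "nat \<Rightarrow> 'a \<Rightarrow> 'a"
  assumes compact_space: "compact (space M)"
    and sets_eq_borel: "sets M = sets (restrict_space borel (space M))"
    and mpt: "n \<ge> 1 \<Longrightarrow> invertible_mpt M (S n)"
    and commuting: "n \<ge> 1 \<Longrightarrow> m \<ge> 1 \<Longrightarrow> x \<in> space M \<Longrightarrow> S n (S m x) = S m (S n x)"
    and mult: "n \<ge> 1 \<Longrightarrow> m \<ge> 1 \<Longrightarrow> x \<in> space M \<Longrightarrow> S (n * m) x = S n (S m x)"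

(* Maps are compared on \<open>space M\<close> only. *)
definition finitely_generated :: "'a measure \<Rightarrow> (nat \<Rightarrow> 'a \<Rightarrow> 'a) \<Rightarrow> bool" where
  "finitely_generated M S \<longleftrightarrow> finite {restrict (S p) (space M) | p. prime p}"

(* Elements of the complex space L^2 are represented by functions, identified up to null sets. *)
definition L2_space :: "'a measure \<Rightarrow> ('a \<Rightarrow> complex) set" where
  "L2_space M = {F \<in> borel_measurable M. integrable M (\<lambda>x. (cmod (F x))\<^sup>2)}"

definition L2_norm :: "'a measure \<Rightarrow> ('a \<Rightarrow> complex) \<Rightarrow> real" where
  "L2_norm M F = sqrt (LINT x|M. (cmod (F x))\<^sup>2)"

(* Membership in L^2 is required explicitly, because the integral of a non-integrable function
   is 0 by convention. *)
definition L2_tendsto :: "'a measure \<Rightarrow> (nat \<Rightarrow> 'a \<Rightarrow> complex) \<Rightarrow> ('a \<Rightarrow> complex) \<Rightarrow> bool" where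
  "L2_tendsto M f g \<longleftrightarrow>
     (\<forall>n. f n \<in> L2_space M) \<and> g \<in> L2_space M \<and>
     (\<lambda>n. L2_norm M (\<lambda>x. f n x - g x)) \<longlonglongrightarrow> 0"

(* A representative of the limit; it is determined up to a null set, and meaningful only for
   sequences that converge in L^2. *)
definition L2_lim :: "'a measure \<Rightarrow> (nat \<Rightarrow> 'a \<Rightarrow> complex) \<Rightarrow> ('a \<Rightarrow> complex)" where
  "L2_lim M f = (SOME g. L2_tendsto M f g)"

definition pretends_invariant :: "'a measure \<Rightarrow> (nat \<Rightarrow> 'a \<Rightarrow> 'a) \<Rightarrow> 'a set \<Rightarrow> bool" where
  "pretends_invariant M S A \<longleftrightarrow> A \<in> sets M \<and>
     (\<lambda>p. 1 / 2 * ((L2_norm M (\<lambda>x. indicator A (S p x) - indicator A x))\<^sup>2 / real p))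
        summable_on {p. prime p}"

definition pretentiously_ergodic :: "'a measure \<Rightarrow> (nat \<Rightarrow> 'a \<Rightarrow> 'a) \<Rightarrow> bool" where
  "pretentiously_ergodic M S \<longleftrightarrow> (\<forall>A. pretends_invariant M S A \<longrightarrow> measure M A \<in> {0, 1})"

definition sigma_pr :: "'a measure \<Rightarrow> (nat \<Rightarrow> 'a \<Rightarrow> 'a) \<Rightarrow> 'a measure" where
  "sigma_pr M S = sigma (space M) {A. pretends_invariant M S A}"

definition complex_cond_exp ::
    "'a measure \<Rightarrow> 'a measure \<Rightarrow> ('a \<Rightarrow> complex) \<Rightarrow> ('a \<Rightarrow> complex)" where
  "complex_cond_exp M N F =
     (\<lambda>x. Complex (real_cond_exp M N (\<lambda>y. Re (F y)) x) (real_cond_exp M N (\<lambda>y. Im (F y)) x))"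

(* The operator (1 - S_p / p)^{-1}, defined by its Neumann series.  For F in L^2 and S_p measure
   preserving, the norms of the terms are dominated by a geometric series, so the L^2 limit exists. *)
definition koopman_resolvent ::
    "'a measure \<Rightarrow> (nat \<Rightarrow> 'a \<Rightarrow> 'a) \<Rightarrow> nat \<Rightarrow> ('a \<Rightarrow> complex) \<Rightarrow> ('a \<Rightarrow> complex)" where
  "koopman_resolvent M S p F =
     L2_lim M (\<lambda>K x. \<Sum>k<K. F (S (p ^ k) x) / of_nat (p ^ k))"

definition euler_factor ::
    "'a measure \<Rightarrow> (nat \<Rightarrow> 'a \<Rightarrow> 'a) \<Rightarrow> nat \<Rightarrow> ('a \<Rightarrow> complex) \<Rightarrow> ('a \<Rightarrow> complex)" where
  "euler_factor M S p F = (\<lambda>x. (1 - 1 / of_nat p) * koopman_resolvent M S p F x)"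

definition euler_product ::
    "'a measure \<Rightarrow> (nat \<Rightarrow> 'a \<Rightarrow> 'a) \<Rightarrow> nat \<Rightarrow> ('a \<Rightarrow> complex) \<Rightarrow> ('a \<Rightarrow> complex)" where
  "euler_product M S N F = foldr (euler_factor M S) (filter prime [1..<Suc N]) F"

definition ergodic_average ::
    "(nat \<Rightarrow> 'a \<Rightarrow> 'a) \<Rightarrow> ('a \<Rightarrow> complex) \<Rightarrow> nat \<Rightarrow> ('a \<Rightarrow> complex)" where
  "ergodic_average S F N = (\<lambda>x. (\<Sum>n=1..N. F (S n x)) / of_nat N)"

end

theory Submission
  imports Defs "HOL-Number_Theory.Prime_Powers" "HOL-Computational_Algebra.Squarefree"
    "HOL-Library.Function_Algebras"
begin

text \<open>
  Call a prime \<open>p\<close> recurrent if the sum of \<open>1/q\<close> over the primes \<open>q\<close> with \<open>S\<^sub>q = S\<^sub>p\<close> diverges.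
  Only finitely many maps \<open>S\<^sub>p\<close> occur, so \<open>\<Sum> 1/p\<close> over the non-recurrent primes converges and a
  set pretends to be invariant iff it is invariant under \<open>S\<^sub>p\<close> for all recurrent \<open>p\<close>. Hence
  \<open>E(F | \<sigma>(I\<^sub>p\<^sub>r))\<close> is the projection of \<open>F\<close> to the functions fixed by these \<open>S\<^sub>p\<close>, and the remainder
  is a limit of linear combinations of coboundaries \<open>S\<^sub>p G - G\<close>.

  For invariant \<open>F\<close>, \<open>S\<^sub>n F\<close> only depends on the non-recurrent part of \<open>n\<close>; truncating that part to
  primes \<open>p \<le> y\<close> changes the averages by \<open>O(\<Sum> 1/p)\<close>, the sum being over non-recurrent \<open>p > y\<close>,
  and the truncated averages converge to the partial Euler product.

  For a coboundary \<open>F = S\<^sub>q G - G\<close> the averages \<open>g(x) = (1/x) \<Sum> S\<^sub>n F\<close>, \<open>n \<le> x\<close>, tend to \<open>0\<close>. Suppose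
  \<open>a = limsup \<parallel>g(x)\<parallel> > 0\<close>. With \<open>\<Lambda>\<^sub>2 = \<Lambda> ln + \<Lambda> * \<Lambda>\<close>, the identity \<open>ln\<^sup>2 n = \<Sum> \<Lambda>\<^sub>2(m)\<close>, \<open>m\<close> dividing \<open>n\<close>,
  makes \<open>g(x)\<close> a weighted mean of the vectors \<open>S\<^sub>m g(x/m)\<close> up to \<open>O(1/ln x)\<close>. If \<open>\<parallel>g(x)\<parallel>\<close> is close to \<open>a\<close>,
  then most of these are close to \<open>g(x)\<close>. Here \<open>m\<close> is essentially a prime or a product of two primes,
  so \<open>S\<^sub>m\<close> takes finitely many values, while by Selberg's formula such \<open>m\<close> are spread evenly on a
  logarithmic scale. So \<open>g\<close>, which is Lipschitz on that scale, stays close to a finite set on long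
  intervals and is therefore almost constant there. The Turan-Kubilius inequality for a finite set of
  primes \<open>p\<close> with \<open>S\<^sub>p = S\<^sub>q\<close> shows that the almost constant value \<open>w\<close> is almost fixed by \<open>S\<^sub>q\<close>; as \<open>w\<close> is
  itself a coboundary, it has small norm, a contradiction.
\<close>

section \<open>Arithmetic sums and Moebius inversion\<close>

text \<open>The obstacle is averages that rotate slowly instead of decaying, as for \<open>n\<close>
  raised to an imaginary power: there all vectors \<open>U m (g (x / m))\<close> agree with
  \<open>g x\<close> although \<open>g\<close> has no limit. Such a rotation forces the operators
  \<open>U m\<close> to take infinitely many values. Finite generation excludes it: a vector that
  moves continuously on the logarithmic scale while staying near a finite set cannot move far. This
  calls for numbers \<open>m\<close> that occur in every short logarithmic cell and have a bounded
  number of prime factors. For primes alone that is as deep as the prime number theorem. For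
  Selberg's weights Moebius inversion already gives an error O(x) against a main term of order x ln
  x; the price is products of two primes, which still yield finitely many operators. Numbers that
  are not squarefree are discarded: their total weight is O(ln x), while the whole weight has order
  (ln x)^2. The divergence of the sum of 1/p is what gives the Turan-Kubilius inequality its force:
  its error has size sqrt L, while the weights add up to L.\<close>

definition moeb :: "nat \<Rightarrow> real" where
  "moeb n = (if squarefree n then (-1) ^ card (prime_factors n) else 0)"

lemma abs_moeb_le: "\<bar>moeb n\<bar> \<le> 1"
  by (auto simp: moeb_def power_abs)

lemma moeb_prime_mult:
  assumes "prime p" "\<not> p dvd d"
  shows "moeb (p * d) = - moeb d"
proof -
  have cop: "coprime p d" using assms by (simp add: prime_imp_coprime)
  have d0: "d \<noteq> 0" using assms(2) by (intro notI) auto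
  have sq: "squarefree (p * d) \<longleftrightarrow> squarefree d"
    using squarefree_mult_coprime[OF cop] squarefree_prime[OF assms(1)]
    by (meson dvd_triv_right squarefree_mono)
  have "prime_factors (p * d) = insert p (prime_factors d)"
    using assms d0 by (subst prime_factors_product) (auto simp: prime_factorization_prime)
  moreover have "p \<notin> prime_factors d" using assms by auto
  ultimately show ?thesis by (simp add: moeb_def sq)
qed

text \<open>For a fixed prime \<open>p\<close> dividing \<open>n\<close>, the divisors
  \<open>d\<close> prime to \<open>p\<close> cancel against the divisors \<open>p * d\<close>; all
  others are divisible by \<open>p ^ 2\<close>.\<close>

lemma sum_moeb_dvd:
  assumes "n > 0"
  shows "(\<Sum>d | d dvd n. moeb d) = (if n = 1 then 1 else 0)"
proof (cases "n = 1")
  case True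
  then have "{d. d dvd n} = {1}" by auto
  then show ?thesis using True by (simp add: moeb_def)
next
  case False
  then obtain p where p: "prime p" "p dvd n" using prime_factor_nat by blast
  define A where "A = {d. d dvd n \<and> \<not> p dvd d}"
  have fin: "finite {d. d dvd n}" using assms by auto
  have finA: "finite A" unfolding A_def using fin by (rule rev_finite_subset) auto
  have inj: "inj_on ((*) p) A" using p(1) by (auto simp: inj_on_def prime_gt_0_nat)
  have sub: "A \<union> (*) p ` A \<subseteq> {d. d dvd n}"
  proof -
    have "p * d dvd n" if "d \<in> A" for d
      using that p by (auto simp: A_def intro!: divides_mult prime_imp_coprime)
    then show ?thesis by (auto simp: A_def)
  qed
  have "(\<Sum>d | d dvd n. moeb d) = (\<Sum>d\<in>A \<union> (*) p ` A. moeb d)"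
  proof (rule sum.mono_neutral_right[OF fin sub], rule ballI)
    fix d assume "d \<in> {d. d dvd n} - (A \<union> (*) p ` A)"
    then have d: "d dvd n" "d \<notin> A" "d \<notin> (*) p ` A" by auto
    then obtain e where e: "d = p * e" by (auto simp: A_def)
    have "e dvd n" using d(1) e by (meson dvd_mult_right)
    then have "p dvd e" using d(3) e by (auto simp: A_def)
    then have "p ^ 2 dvd d" using e by (auto simp: power2_eq_square)
    then have "\<not> squarefree d" using p(1) unfolding squarefree_def
      by (metis not_prime_unit)
    then show "moeb d = 0" by (simp add: moeb_def)
  qed
  also have "\<dots> = (\<Sum>d\<in>A. moeb d) + (\<Sum>d\<in>(*) p ` A. moeb d)"
    using finA by (intro sum.union_disjoint) (auto simp: A_def)
  also have "(\<Sum>d\<in>(*) p ` A. moeb d) = (\<Sum>d\<in>A. moeb (p * d))"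
    by (subst sum.reindex[OF inj]) auto
  also have "\<dots> = (\<Sum>d\<in>A. - moeb d)"
    using p(1) by (intro sum.cong) (auto simp: A_def moeb_prime_mult)
  finally show ?thesis using False by (simp add: sum_negf)
qed

text \<open>The bound is real, so that \<open>ints (x / d)\<close> can be nested without rounding;
  the set is empty for \<open>x < 1\<close>.\<close>

definition ints :: "real \<Rightarrow> nat set" where
  "ints x = {n. 0 < n \<and> real n \<le> x}"

lemma in_ints: "n \<in> ints x \<longleftrightarrow> 0 < n \<and> real n \<le> x"
  by (simp add: ints_def)

lemma finite_ints [simp, intro]: "finite (ints x)"
proof (rule finite_subset)
  show "ints x \<subseteq> {..nat \<lfloor>x\<rfloor>}" by (auto simp: in_ints le_nat_floor)
qed auto

lemma ints_eq: "ints x = {1..nat \<lfloor>x\<rfloor>}"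
  by (auto simp: in_ints le_nat_floor) (use of_nat_floor le_nat_iff in linarith)+

lemma ints_of_nat [simp]: "ints (real n) = {1..n}"
  by (auto simp: in_ints)

lemma card_ints: "card (ints x) = nat \<lfloor>x\<rfloor>"
  by (simp add: ints_eq)

lemma card_ints_le: "0 \<le> x \<Longrightarrow> real (card (ints x)) \<le> x"
  by (simp add: card_ints)

lemma card_ints_ge: "real (card (ints x)) \<ge> x - 1"
  by (simp add: card_ints) linarith

text \<open>Both sides run over the pairs \<open>(d, m)\<close> with
  \<open>d * m \<le> x\<close>.\<close>

lemma sum_ints_dvd_swap:
  fixes f :: "nat \<Rightarrow> nat \<Rightarrow> 'b::comm_monoid_add"
  shows "(\<Sum>n\<in>ints x. \<Sum>d | d dvd n. f d (n div d)) = (\<Sum>d\<in>ints x. \<Sum>m\<in>ints (x / d). f d m)"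
proof -
  have "(\<Sum>n\<in>ints x. \<Sum>d | d dvd n. f d (n div d))
      = (\<Sum>(n,d)\<in>(SIGMA n:ints x. {d. d dvd n}). f d (n div d))"
    by (intro sum.Sigma) (auto simp: in_ints)
  also have "\<dots> = (\<Sum>(d,m)\<in>(SIGMA d:ints x. ints (x / d)). f d m)"
  proof (rule sum.reindex_bij_witness[of _ "\<lambda>(d,m). (d*m, d)" "\<lambda>(n,d). (d, n div d)"])
    fix a assume a: "a \<in> (SIGMA n:ints x. {d. d dvd n})"
    then obtain d m where dm: "a = (d * m, d)" "0 < d" "0 < m" "real d * real m \<le> x"
      by (auto simp: in_ints elim!: dvdE)
    then have "real d \<le> real d * real m" by simp
    then have "real d \<le> x" using dm by linarith
    then show "(case a of (n, d) \<Rightarrow> (d, n div d)) \<in> (SIGMA d:ints x. ints (x / d))"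
      using dm by (auto simp: in_ints field_simps)
  qed (auto simp: in_ints field_simps)
  also have "\<dots> = (\<Sum>d\<in>ints x. \<Sum>m\<in>ints (x / d). f d m)"
    by (intro sum.Sigma[symmetric]) auto
  finally show ?thesis .
qed

section \<open>Moebius inversion with a power saving\<close>

lemma sum_ints_powr_le:
  "(\<Sum>d\<in>{1..N}. real d powr (-3/4)) \<le> 4 * real N powr (1/4)"
proof (induction N)
  case (Suc N)
  have "real (Suc N) powr (-3/4) \<le> 4 * real (Suc N) powr (1/4) - 4 * real N powr (1/4)"
  proof (cases "N = 0")
    case False
    have "\<exists>z. real N < z \<and> z < real (Suc N) \<and>
       4 * real (Suc N) powr (1/4) - 4 * real N powr (1/4) = (real (Suc N) - real N) * z powr (-3/4)"
      by (rule MVT2) (use False in \<open>auto intro!: derivative_eq_intros\<close>)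
    then obtain z where z: "real N < z" "z < real (Suc N)"
      "4 * real (Suc N) powr (1/4) - 4 * real N powr (1/4) = z powr (-3/4)" by auto
    have "real (Suc N) powr (-3/4) \<le> z powr (-3/4)"
      using z False by (intro powr_mono2') auto
    then show ?thesis using z by simp
  qed auto
  then show ?case using Suc by simp
qed auto

text \<open>An exponent below 1 keeps the sum at O(x), whereas exponent 1 would cost a factor ln x.
  The value 3/4 = 1 + 1/4 - 1/2 is what remains in Selberg's formula when ln x is bounded by
  \<open>4 * x powr (1/4)\<close> and the harmonic sums have error
  \<open>x powr (-1/2)\<close>.\<close>

lemma sum_ints_div_powr_le:
  assumes "x \<ge> 1"
  shows "(\<Sum>d\<in>ints x. (x / d) powr (3/4)) \<le> 4 * x"
proof -
  have "(\<Sum>d\<in>ints x. (x / d) powr (3/4)) = (\<Sum>d\<in>ints x. x powr (3/4) * real d powr (-3/4))"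
    using assms by (intro sum.cong) (auto simp: in_ints powr_divide powr_minus_divide)
  also have "\<dots> = x powr (3/4) * (\<Sum>d\<in>{1..nat \<lfloor>x\<rfloor>}. real d powr (-3/4))"
    by (simp add: sum_distrib_left ints_eq)
  also have "\<dots> \<le> x powr (3/4) * (4 * real (nat \<lfloor>x\<rfloor>) powr (1/4))"
    by (intro mult_left_mono sum_ints_powr_le) auto
  also have "\<dots> \<le> x powr (3/4) * (4 * x powr (1/4))"
    using assms by (intro mult_left_mono powr_mono2) auto
  also have "\<dots> = 4 * x" using assms by (simp add: powr_add[symmetric])
  finally show ?thesis .
qed

lemma moebius_inversion_ints:
  fixes T :: "real \<Rightarrow> real"
  assumes "x \<ge> 1"
  shows "(\<Sum>d\<in>ints x. moeb d * (\<Sum>n\<in>ints (x / d). T (x / d / n))) = T x"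
proof -
  have "(\<Sum>d\<in>ints x. moeb d * (\<Sum>n\<in>ints (x / d). T (x / d / n)))
      = (\<Sum>d\<in>ints x. \<Sum>n\<in>ints (x / d). moeb d * T (x / real (d * n)))"
    by (simp add: sum_distrib_left)
  also have "\<dots> = (\<Sum>n\<in>ints x. \<Sum>d | d dvd n. moeb d * T (x / real (d * (n div d))))"
    by (rule sum_ints_dvd_swap[symmetric])
  also have "\<dots> = (\<Sum>n\<in>ints x. (\<Sum>d | d dvd n. moeb d) * T (x / real n))"
    by (auto simp: sum_distrib_right intro!: sum.cong)
  also have "\<dots> = (\<Sum>n\<in>ints x. if n = 1 then T x else 0)"
    by (intro sum.cong) (auto simp: in_ints sum_moeb_dvd)
  also have "\<dots> = T x" using assms by (simp add: in_ints)
  finally show ?thesis .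
qed

text \<open>Inversion with the Moebius function bounded trivially by 1: the power saving assumed for
  the sums of \<open>T (x / n)\<close> is spent on the summation over \<open>d\<close>.\<close>

lemma moebius_inversion_bound:
  fixes T :: "real \<Rightarrow> real"
  assumes C: "\<And>x. x \<ge> 1 \<Longrightarrow> \<bar>\<Sum>n\<in>ints x. T (x / n)\<bar> \<le> C * x powr (3/4)" and "x \<ge> 1"
  shows "\<bar>T x\<bar> \<le> 4 * C * x"
proof -
  have C0: "C \<ge> 0" using C[of 1] by simp
  have "\<bar>T x\<bar> = \<bar>\<Sum>d\<in>ints x. moeb d * (\<Sum>n\<in>ints (x / d). T (x / d / n))\<bar>"
    using moebius_inversion_ints[OF assms(2)] by simp
  also have "\<dots> \<le> (\<Sum>d\<in>ints x. \<bar>moeb d\<bar> * \<bar>\<Sum>n\<in>ints (x / d). T (x / d / n)\<bar>)"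
    by (rule order_trans[OF sum_abs]) (simp add: abs_mult)
  also have "\<dots> \<le> (\<Sum>d\<in>ints x. 1 * (C * (x / d) powr (3/4)))"
    by (intro sum_mono mult_mono abs_moeb_le C) (auto simp: in_ints)
  also have "\<dots> = C * (\<Sum>d\<in>ints x. (x / d) powr (3/4))" by (simp add: sum_distrib_left)
  also have "\<dots> \<le> C * (4 * x)" using sum_ints_div_powr_le[OF assms(2)] C0 by (rule mult_left_mono)
  finally show ?thesis by simp
qed

text \<open>Comparison with the integral. \<open>t n\<close> is the defect on the interval from
  \<open>n + 1\<close> to \<open>n + 2\<close>; two mean value theorems bound it by a value of
  \<open>f'\<close>, so the defects are summable and \<open>c\<close> collects them. The error
  consists of their tail and of the fractional part of \<open>x\<close>.\<close>

lemma sum_ints_asymp: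
  fixes f F f' :: "real \<Rightarrow> real"
  assumes F: "\<And>x. x \<ge> 1 \<Longrightarrow> (F has_real_derivative f x) (at x)"
    and f: "\<And>x. x \<ge> 1 \<Longrightarrow> (f has_real_derivative f' x) (at x)"
    and f': "\<And>x. x \<ge> 1 \<Longrightarrow> \<bar>f' x\<bar> \<le> K * x powr (-3/2)"
    and fb: "\<And>x. x \<ge> 1 \<Longrightarrow> \<bar>f x\<bar> \<le> K * x powr (-1/2)"
  shows "\<exists>c K'. \<forall>x\<ge>1. \<bar>(\<Sum>n\<in>ints x. f n) - F x - c\<bar> \<le> K' * x powr (-1/2)"
proof -
  have K0: "K \<ge> 0" using fb[of 1] by simp
  define t where "t n = f (real n + 2) - (F (real n + 2) - F (real n + 1))" for n :: nat
  define b where "b n = (real n + 1) powr (-1/2)" for n :: nat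
  \<comment> \<open>The bound is put in telescoping form, so that the tails of \<open>t\<close> are
    bounded by \<open>b\<close> directly.\<close>
  have tb: "\<bar>t n\<bar> \<le> 6 * K * (b n - b (Suc n))" for n
  proof -
    have "\<exists>z. real n + 1 < z \<and> z < real n + 2 \<and> F (real n + 2) - F (real n + 1) = (real n + 2 - (real n + 1)) * f z"
      by (rule MVT2) (auto intro!: F)
    then obtain z where z: "real n + 1 < z" "z < real n + 2" "F (real n + 2) - F (real n + 1) = f z" by auto
    have "\<exists>y. z < y \<and> y < real n + 2 \<and> f (real n + 2) - f z = (real n + 2 - z) * f' y"
      by (rule MVT2) (use z in \<open>auto intro!: f\<close>)
    then obtain y where y: "z < y" "y < real n + 2" "f (real n + 2) - f z = (real n + 2 - z) * f' y" by auto
    have "\<bar>t n\<bar> = \<bar>real n + 2 - z\<bar> * \<bar>f' y\<bar>" using z y by (simp add: t_def abs_mult)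
    also have "\<dots> \<le> 1 * (K * y powr (-3/2))" using y z by (intro mult_mono f') auto
    also have "\<dots> \<le> K * (real n + 1) powr (-3/2)"
      using K0 y z by (auto intro!: mult_left_mono powr_mono2')
    finally have 1: "\<bar>t n\<bar> \<le> K * (real n + 1) powr (-3/2)" .
    have "\<exists>z. real n + 1 < z \<and> z < real n + 2 \<and> - ((real n + 2) powr (-1/2)) - (- ((real n + 1) powr (-1/2))) = (real n + 2 - (real n + 1)) * (1/2 * z powr (-3/2))"
      by (rule MVT2) (auto intro!: derivative_eq_intros)
    then obtain w where w: "real n + 1 < w" "w < real n + 2" "b n - b (Suc n) = 1/2 * w powr (-3/2)"
      by (auto simp: b_def add_ac)
    \<comment> \<open>Since \<open>w < n + 2 \<le> 2 * (n + 1)\<close>, passing from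
      \<open>n + 1\<close> to \<open>w\<close> costs at most the factor \<open>2 powr (3/2)\<close>,
      which is at most 3.\<close>
    have "(2::real) powr (-3/2) * 3 \<ge> 1"
    proof -
      have "(2::real) powr (3/2) = 2 * sqrt 2"
        using powr_add[of "2::real" 1 "1/2"] by (simp add: powr_half_sqrt)
      also have "\<dots> \<le> 3" using real_le_lsqrt[of "3/2" 2] by (simp add: power2_eq_square)
      finally show ?thesis by (simp add: powr_minus field_simps)
    qed
    then have "(real n + 1) powr (-3/2) * 1 \<le> (real n + 1) powr (-3/2) * (2 powr (-3/2) * 3)"
      by (intro mult_left_mono) auto
    also have "\<dots> = 3 * (2 * (real n + 1)) powr (-3/2)" by (subst powr_mult) auto
    also have "\<dots> \<le> 3 * w powr (-3/2)" using w by (auto intro!: powr_mono2')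
    also have "\<dots> = 6 * (b n - b (Suc n))" using w by simp
    finally have "K * (real n + 1) powr (-3/2) \<le> K * (6 * (b n - b (Suc n)))"
      using K0 by (intro mult_left_mono) auto
    also have "\<dots> = 6 * K * (b n - b (Suc n))" by (simp only: mult_ac)
    finally show ?thesis using 1 by (rule order_trans[rotated])
  qed
  have b0: "b \<longlonglongrightarrow> 0" unfolding b_def by real_asymp
  have sb: "(\<lambda>n. 6 * K * (b (n + k) - b (Suc (n + k)))) sums (6 * K * b k)" for k
  proof -
    have "(\<lambda>n. b (n + k)) \<longlonglongrightarrow> 0" using b0 by (rule LIMSEQ_ignore_initial_segment)
    from sums_mult[OF telescope_sums'[OF this], of "6 * K"] show ?thesis by (simp only: diff_zero add_0 add_Suc)
  qed
  have summ: "summable t"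
    by (rule summable_comparison_test'[OF sums_summable[OF sb[of 0]], of 0]) (use tb in simp)
  define c where "c = suminf t + f 1 - F 1"
  have part: "(\<Sum>j\<in>{1..Suc k}. f (real j)) - F (real (Suc k)) = f 1 - F 1 + (\<Sum>n<k. t n)" for k
    by (induction k) (auto simp: t_def add_ac)
  have tail: "\<bar>suminf t - (\<Sum>n<k. t n)\<bar> \<le> 6 * K * b k" for k
  proof -
    have s1: "summable (\<lambda>n. \<bar>t (n + k)\<bar>)"
      by (rule summable_comparison_test'[OF sums_summable[OF sb[of k]], of 0]) (use tb in simp)
    have "\<bar>suminf t - (\<Sum>n<k. t n)\<bar> = \<bar>\<Sum>n. t (n + k)\<bar>"
      using suminf_minus_initial_segment[OF summ, of k] by simp
    also have "\<dots> \<le> (\<Sum>n. \<bar>t (n + k)\<bar>)" by (rule summable_rabs[OF s1])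
    also have "\<dots> \<le> (\<Sum>n. 6 * K * (b (n + k) - b (Suc (n + k))))"
      by (rule suminf_le[OF tb s1 sums_summable[OF sb[of k]]])
    also have "\<dots> = 6 * K * b k" using sb[of k] by (rule sums_unique[symmetric])
    finally show ?thesis .
  qed
  have "\<bar>(\<Sum>n\<in>ints x. f n) - F x - c\<bar> \<le> (12 * K + 2 * K) * x powr (-1/2)" if x: "x \<ge> 1" for x
  proof -
    define N where "N = nat \<lfloor>x\<rfloor>"
    have N: "N \<ge> 1" "real N \<le> x" "x < real N + 1" using x by (auto simp: N_def le_nat_iff)
    obtain k where k: "N = Suc k" using N by (cases N) auto
    have Fd: "\<bar>F x - F N\<bar> \<le> K * real N powr (-1/2)"
    proof (cases "x = N")
      case False
      have "\<exists>z. real N < z \<and> z < x \<and> F x - F (real N) = (x - real N) * f z"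
        by (rule MVT2) (use False N in \<open>auto intro!: F\<close>)
      then obtain z where z: "real N < z" "z < x" "F x - F (real N) = (x - real N) * f z" by auto
      have "\<bar>F x - F N\<bar> = \<bar>x - real N\<bar> * \<bar>f z\<bar>" using z by (simp add: abs_mult)
      also have "\<dots> \<le> 1 * (K * z powr (-1/2))" using z N by (intro mult_mono fb) auto
      also have "\<dots> \<le> K * real N powr (-1/2)" using z N K0 by (auto intro!: mult_left_mono powr_mono2')
      finally show ?thesis .
    qed (use K0 in auto)
    have "(\<Sum>n\<in>ints x. f n) - F N - c = (\<Sum>n<k. t n) - suminf t"
      using part[of k] by (simp add: ints_eq N_def[symmetric] k c_def)
    then have "\<bar>(\<Sum>n\<in>ints x. f n) - F N - c\<bar> \<le> 6 * K * b k" using tail[of k] by simp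
    then have "\<bar>(\<Sum>n\<in>ints x. f n) - F x - c\<bar> \<le> 7 * K * real N powr (-1/2)"
      using Fd by (simp add: b_def k add_ac)
    moreover have "real N powr (-1/2) \<le> 2 * x powr (-1/2)"
    proof -
      have "1 \<le> real N" using N(1) by simp
      then have "x \<le> 2 * real N" using N by linarith
      then have "(2 * real N) powr (-1/2) \<le> x powr (-1/2)" using x by (intro powr_mono2') auto
      moreover have "(2 * real N) powr (-1/2) = 2 powr (-1/2) * real N powr (-1/2)" by (simp add: powr_mult)
      moreover have "(2::real) powr (-1/2) \<ge> 1/2"
        using powr_mono[of "-1" "-1/2" "2::real"] by simp
      ultimately have "1/2 * real N powr (-1/2) \<le> x powr (-1/2)"
        by (smt (verit) mult_right_mono powr_ge_zero)
      then show ?thesis by simp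
    qed
    then have "7 * K * real N powr (-1/2) \<le> 7 * K * (2 * x powr (-1/2))"
      using K0 by (intro mult_left_mono) auto
    ultimately show ?thesis by (simp add: algebra_simps)
  qed
  then show ?thesis by blast
qed

section \<open>Selberg's formula\<close>

lemma ln_le_quartic_root: "x \<ge> 1 \<Longrightarrow> ln x \<le> 4 * x powr (1/4)" for x :: real
  using ln_powr_bound[of x "1/4"] by simp

lemma harmonic_asymp:
  shows "\<exists>g K. \<forall>x\<ge>1. \<bar>(\<Sum>n\<in>ints x. 1 / real n) - ln x - g\<bar> \<le> K * x powr (-1/2)"
proof (rule sum_ints_asymp[of ln "\<lambda>x. 1 / x" "\<lambda>x. - (1 / x\<^sup>2)" 1])
  fix x :: real assume x: "x \<ge> 1"
  show "(ln has_real_derivative 1 / x) (at x)"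
    using x by (auto intro!: derivative_eq_intros)
  show "((\<lambda>x. 1 / x) has_real_derivative - (1 / x\<^sup>2)) (at x)"
    using x by (auto intro!: derivative_eq_intros simp: power2_eq_square)
  have "x powr (-2) \<le> x powr (-3/2)" using x by (intro powr_mono) auto
  then show "\<bar>- (1 / x\<^sup>2)\<bar> \<le> 1 * x powr (-3/2)" using x by (simp add: powr_minus_divide)
  have "x powr (-1) \<le> x powr (-1/2)" using x by (intro powr_mono) auto
  then show "\<bar>1 / x\<bar> \<le> 1 * x powr (-1/2)" using x by (simp add: powr_minus_divide)
qed

text \<open>Here \<open>c\<close> is the first Stieltjes constant, as \<open>g\<close> in
  \<open>harmonic_asymp\<close> is Euler's constant. Both are later absorbed into the coefficients
  of a comparison function.\<close>

lemma sum_ln_over_n_asymp: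
  shows "\<exists>c K. \<forall>x\<ge>1. \<bar>(\<Sum>n\<in>ints x. ln (real n) / real n) - (ln x)\<^sup>2 / 2 - c\<bar> \<le> K * x powr (-1/2)"
proof (rule sum_ints_asymp[of "\<lambda>x. (ln x)\<^sup>2 / 2" "\<lambda>x. ln x / x" "\<lambda>x. (1 - ln x) / x\<^sup>2" 3])
  fix x :: real assume x: "x \<ge> 1"
  show "((\<lambda>x. (ln x)\<^sup>2 / 2) has_real_derivative ln x / x) (at x)"
    using x by (auto intro!: derivative_eq_intros)
  show "((\<lambda>x. ln x / x) has_real_derivative (1 - ln x) / x\<^sup>2) (at x)"
    using x by (auto intro!: derivative_eq_intros simp: power2_eq_square)
  have l: "ln x \<le> 2 * x powr (1/2)" using ln_powr_bound[of x "1/2"] x by simp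
  have "1 \<le> x powr (1/2)" using x by (simp add: ge_one_powr_ge_zero)
  then have "\<bar>1 - ln x\<bar> \<le> 3 * x powr (1/2)" using l ln_ge_zero[OF x] by linarith
  then have "\<bar>1 - ln x\<bar> * x powr (-2) \<le> 3 * x powr (1/2) * x powr (-2)" by (rule mult_right_mono) simp
  also have "\<dots> = 3 * x powr (-3/2)" by (simp add: powr_add[symmetric])
  finally show "\<bar>(1 - ln x) / x\<^sup>2\<bar> \<le> 3 * x powr (-3/2)"
    using x by (simp add: powr_minus_divide abs_div)
  have "\<bar>ln x\<bar> \<le> 3 * x powr (1/2)" using l ln_ge_zero[OF x] powr_ge_zero[of x "1/2"] by linarith
  then have "\<bar>ln x\<bar> * x powr (-1) \<le> 3 * x powr (1/2) * x powr (-1)" by (intro mult_right_mono) auto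
  also have "\<dots> = 3 * x powr (-1/2)" unfolding mult.assoc powr_add[symmetric] by simp
  finally show "\<bar>ln x / x\<bar> \<le> 3 * x powr (-1/2)"
    using x by (simp add: powr_minus_divide abs_div)
qed

text \<open>For increasing \<open>f\<close> the excess of the sum over the integral stays between 0
  and the last term: each step adds the new last term and removes an intermediate value
  \<open>f z\<close>.\<close>

lemma sum_ints_mono_asymp:
  fixes f F :: "real \<Rightarrow> real"
  assumes F: "\<And>x. x \<ge> 1 \<Longrightarrow> (F has_real_derivative f x) (at x)"
    and mono: "\<And>x y. 1 \<le> x \<Longrightarrow> x \<le> y \<Longrightarrow> f x \<le> f y" and f1: "0 \<le> f 1" and x: "x \<ge> 1"
  shows "\<bar>(\<Sum>n\<in>ints x. f n) - F x + F 1\<bar> \<le> f x"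
proof -
  have ind: "0 \<le> (\<Sum>j\<in>{1..Suc k}. f (real j)) - F (real (Suc k)) + F 1 \<and>
      (\<Sum>j\<in>{1..Suc k}. f (real j)) - F (real (Suc k)) + F 1 \<le> f (real (Suc k))" for k
  proof (induction k)
    case (Suc k)
    have "\<exists>z. real (Suc k) < z \<and> z < real (Suc (Suc k)) \<and> F (real (Suc (Suc k))) - F (real (Suc k)) = (real (Suc (Suc k)) - real (Suc k)) * f z"
      by (rule MVT2) (auto intro!: F)
    then obtain z where z: "real (Suc k) < z" "z < real (Suc (Suc k))" "F (real (Suc (Suc k))) - F (real (Suc k)) = f z"
      by auto
    have "f (real (Suc k)) \<le> f z" "f z \<le> f (real (Suc (Suc k)))" using z by (auto intro!: mono)
    then show ?case using z Suc by simp
  qed (use f1 in auto)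
  define N where "N = nat \<lfloor>x\<rfloor>"
  have N: "N \<ge> 1" "real N \<le> x" "x < real N + 1" using x by (auto simp: N_def le_nat_iff)
  then obtain k where k: "N = Suc k" by (cases N) auto
  have Fd: "0 \<le> F x - F N \<and> F x - F N \<le> f x"
  proof (cases "x = N")
    case True
    then show ?thesis using f1 mono[of 1 x] x by simp
  next
    case False
    have "\<exists>z. real N < z \<and> z < x \<and> F x - F (real N) = (x - real N) * f z"
      by (rule MVT2) (use False N in \<open>auto intro!: F\<close>)
    then obtain z where z: "real N < z" "z < x" "F x - F (real N) = (x - real N) * f z" by auto
    have "0 \<le> f z" "f z \<le> f x" using mono[of 1 z] mono[of z x] z N f1 by auto
    moreover have "(x - real N) * f z \<le> 1 * f z" using z N \<open>0 \<le> f z\<close> by (intro mult_right_mono) auto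
    ultimately show ?thesis using z by simp
  qed
  have "f (real (Suc k)) \<le> f x" using N k by (auto intro!: mono)
  moreover have "(\<Sum>n\<in>ints x. f n) = (\<Sum>j\<in>{1..Suc k}. f (real j))"
    by (simp only: ints_eq N_def[symmetric] k)
  ultimately show ?thesis using ind[of k] Fd[unfolded k] by linarith
qed

lemma sum_ln_square_asymp:
  assumes "x \<ge> 1"
  shows "\<bar>(\<Sum>n\<in>ints x. (ln (real n))\<^sup>2) - (x * (ln x)\<^sup>2 - 2 * x * ln x + 2 * x)\<bar> \<le> 18 * x powr (3/4)"
proof -
  define F where "F x = x * (ln x)\<^sup>2 - 2 * x * ln x + 2 * x" for x :: real
  have "\<bar>(\<Sum>n\<in>ints x. (ln (real n))\<^sup>2) - F x + F 1\<bar> \<le> (ln x)\<^sup>2"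
    using assms by (intro sum_ints_mono_asymp)
     (auto simp: F_def algebra_simps power2_eq_square intro!: derivative_eq_intros mult_mono)
  \<comment> \<open>The constant 18 is 16 from the square of \<open>4 * x powr (1/4)\<close> plus 2
    from \<open>F 1\<close>.\<close>
  moreover have "F 1 = 2" by (simp add: F_def)
  moreover have "(ln x)\<^sup>2 \<le> (4 * x powr (1/4))\<^sup>2"
    using assms by (intro power_mono ln_le_quartic_root) auto
  moreover have "(4 * x powr (1/4))\<^sup>2 = 16 * x powr (1/2)"
    by (simp add: power2_eq_square powr_add[symmetric])
  moreover have "x powr (1/2) \<le> x powr (3/4)" "1 \<le> x powr (3/4)" using assms by (auto intro!: powr_mono simp: ge_one_powr_ge_zero)
  ultimately show ?thesis unfolding F_def by linarith
qed

text \<open>One half of Stirling's formula. Single terms reach ln x, but their mean is at most 1;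
  this allows \<open>(ln n)\<^sup>2\<close> to be replaced by \<open>(ln x)\<^sup>2\<close> in
  averages at a cost of only O(ln x).\<close>

lemma sum_ln_ratio_le:
  assumes "x \<ge> 1"
  shows "(\<Sum>n\<in>ints x. ln (x / real n)) \<le> x"
proof -
  define F where "F x = x * ln x - x" for x :: real
  have ind: "real (Suc k) * ln (real (Suc k)) - real (Suc k) + 1 \<le> (\<Sum>j\<in>{1..Suc k}. ln (real j))" for k
  proof (induction k)
    case (Suc k)
    have "ln (real (Suc k)) \<ge> ln (real (Suc (Suc k))) - 1 / real (Suc k)"
      using ln_diff_le[of "real (Suc (Suc k))" "real (Suc k)"] by simp
    then have "real (Suc k) * ln (real (Suc k)) \<ge> real (Suc k) * (ln (real (Suc (Suc k))) - 1 / real (Suc k))"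
      by (intro mult_left_mono) auto
    then have "real (Suc k) * ln (real (Suc k)) \<ge> real (Suc k) * ln (real (Suc (Suc k))) - 1"
      by (simp add: algebra_simps del: of_nat_Suc)
    then show ?case using Suc by (simp add: algebra_simps)
  qed auto
  define N where "N = nat \<lfloor>x\<rfloor>"
  have N: "N \<ge> 1" "real N \<le> x" "x < real N + 1" using assms by (auto simp: N_def le_nat_iff)
  then obtain k where k: "N = Suc k" by (cases N) auto
  have "(\<Sum>n\<in>ints x. ln (x / real n)) = (\<Sum>n\<in>ints x. ln x - ln (real n))"
    using assms by (intro sum.cong) (auto simp: in_ints ln_div)
  also have "\<dots> = N * ln x - (\<Sum>j\<in>{1..Suc k}. ln (real j))"
    by (simp add: sum_subtractf ints_eq N_def[symmetric] k)
  also have "\<dots> \<le> N * ln x - (N * ln N - N + 1)" using ind[of k] by (simp add: k)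
  also have "\<dots> = N * (ln x - ln N) + N - 1" by (simp add: algebra_simps)
  also have "\<dots> \<le> N * ((x - N) / N) + N - 1"
    using ln_diff_le[of x N] N by (intro add_right_mono diff_right_mono mult_left_mono) auto
  also have "\<dots> \<le> x" using N by simp
  finally show ?thesis .
qed

section \<open>Selberg's function and its summatory function\<close>

lemma sum_dvd_dvd_swap:
  fixes f :: "nat \<Rightarrow> nat \<Rightarrow> 'b::comm_monoid_add"
  assumes "n > 0"
  shows "(\<Sum>d | d dvd n. \<Sum>e | e dvd d. f e (d div e)) = (\<Sum>e | e dvd n. \<Sum>k | k dvd n div e. f e k)"
proof -
  have "(\<Sum>d | d dvd n. \<Sum>e | e dvd d. f e (d div e)) = (\<Sum>(d,e)\<in>(SIGMA d:{d. d dvd n}. {e. e dvd d}). f e (d div e))"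
    using assms by (intro sum.Sigma) (auto intro!: finite_divisors_nat dest: dvd_pos_nat)
  also have "\<dots> = (\<Sum>(e,k)\<in>(SIGMA e:{e. e dvd n}. {k. k dvd n div e}). f e k)"
    using assms
    by (intro sum.reindex_bij_witness[of _ "\<lambda>(e,k). (e*k, e)" "\<lambda>(d,e). (e, d div e)"])
       (auto elim!: dvdE)
  also have "\<dots> = (\<Sum>e | e dvd n. \<Sum>k | k dvd n div e. f e k)"
    using assms by (intro sum.Sigma[symmetric]) (auto intro!: finite_divisors_nat dest: dvd_pos_nat elim!: dvdE)
  finally show ?thesis .
qed

lemma sum_dvd_flip:
  fixes f :: "nat \<Rightarrow> 'b::comm_monoid_add"
  assumes "n > 0"
  shows "(\<Sum>d | d dvd n. f (n div d)) = (\<Sum>d | d dvd n. f d)"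
  using assms by (intro sum.reindex_bij_witness[of _ "\<lambda>d. n div d" "\<lambda>d. n div d"]) (auto elim!: dvdE)

definition selb :: "nat \<Rightarrow> real" where
  "selb n = mangoldt n * ln (real n) + (\<Sum>e | e dvd n. mangoldt e * mangoldt (n div e))"

lemma selb_nonneg: "selb n \<ge> 0"
  unfolding selb_def by (cases "n = 0") (auto intro!: add_nonneg_nonneg sum_nonneg mult_nonneg_nonneg mangoldt_nonneg)

text \<open>Summed over the cofactors, the convolution contributes
  \<open>mangoldt e * ln (n / e)\<close>, which together with \<open>mangoldt e * ln e\<close>
  completes to \<open>mangoldt e * ln n\<close>; the second summation over \<open>e\<close> gives
  another logarithm.\<close>

lemma sum_selb_dvd:
  assumes "n > 0"
  shows "(\<Sum>d | d dvd n. selb d) = (ln (real n))\<^sup>2"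
proof -
  have "(\<Sum>d | d dvd n. \<Sum>e | e dvd d. mangoldt e * mangoldt (d div e) :: real)
      = (\<Sum>e | e dvd n. \<Sum>k | k dvd n div e. mangoldt e * mangoldt k)"
    by (rule sum_dvd_dvd_swap[OF assms])
  also have "\<dots> = (\<Sum>e | e dvd n. mangoldt e * ln (real (n div e)))"
  proof (intro sum.cong refl)
    fix e assume "e \<in> {e. e dvd n}"
    then have "n div e > 0" using assms by (auto elim!: dvdE)
    then show "(\<Sum>k | k dvd n div e. mangoldt e * mangoldt k) = mangoldt e * ln (real (n div e))"
      by (simp add: sum_distrib_left[symmetric] mangoldt_sum)
  qed
  finally have "(\<Sum>d | d dvd n. selb d) = (\<Sum>e | e dvd n. mangoldt e * ln (real e) + mangoldt e * ln (real (n div e)))"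
    by (simp add: selb_def sum.distrib)
  also have "\<dots> = (\<Sum>e | e dvd n. mangoldt e * ln (real n))"
  proof (intro sum.cong refl)
    fix e assume "e \<in> {e. e dvd n}"
    then obtain k where k: "n = e * k" by auto
    with assms have "e > 0" "k > 0" by auto
    then show "mangoldt e * ln (real e) + mangoldt e * ln (real (n div e)) = mangoldt e * ln (real n)"
      by (simp add: k ln_mult algebra_simps)
  qed
  also have "\<dots> = (ln (real n))\<^sup>2"
    using assms by (simp add: sum_distrib_right[symmetric] mangoldt_sum power2_eq_square)
  finally show ?thesis .
qed

text \<open>The summatory function is compared with an explicit \<open>G\<close>: the sums of both
  over the arguments \<open>x / n\<close> agree up to \<open>x powr (3/4)\<close>, because one of
  them is the sum of the \<open>(ln n)\<^sup>2\<close>. Moebius inversion turns this into an error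
  O(x) for the functions themselves.\<close>

theorem selberg_formula:
  obtains C where "C \<ge> 0" "\<And>x. x \<ge> 1 \<Longrightarrow> \<bar>(\<Sum>m\<in>ints x. selb m) - 2 * x * ln x\<bar> \<le> C * x"
proof -
  obtain g K1 where h1: "\<And>x. x \<ge> 1 \<Longrightarrow> \<bar>(\<Sum>n\<in>ints x. 1 / real n) - ln x - g\<bar> \<le> K1 * x powr (-1/2)"
    using harmonic_asymp by blast
  obtain c K2 where h2: "\<And>x. x \<ge> 1 \<Longrightarrow> \<bar>(\<Sum>n\<in>ints x. ln (real n) / real n) - (ln x)\<^sup>2 / 2 - c\<bar> \<le> K2 * x powr (-1/2)"
    using sum_ln_over_n_asymp by blast
  have K0: "K1 \<ge> 0" "K2 \<ge> 0" using h1[of 1] h2[of 1] by auto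
  \<comment> \<open>\<open>\<alpha>\<close> and \<open>\<beta>\<close> make the main terms of \<open>\<Sum> G(x/n)\<close> and \<open>\<Sum> ln\<^sup>2 n\<close>, \<open>n \<le> x\<close>, agree.\<close>
  define \<alpha> where "\<alpha> = - 2 - 2 * g"
  define \<beta> where "\<beta> = 2 + 2 * c - \<alpha> * g"
  define G where "G y = 2 * y * ln y + \<alpha> * y + \<beta>" for y :: real
  define T where "T x = (\<Sum>m\<in>ints x. selb m) - G x" for x
  define C where "C = 18 + 8 * K1 + 2 * K2 + \<bar>\<alpha>\<bar> * K1 + \<bar>\<beta>\<bar>"
  have "\<bar>\<Sum>n\<in>ints x. T (x / n)\<bar> \<le> C * x powr (3/4)" if x: "x \<ge> 1" for x
  proof -
    define h where "h = (\<Sum>n\<in>ints x. 1 / real n)"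
    define l where "l = (\<Sum>n\<in>ints x. ln (real n) / real n)"
    define e1 where "e1 = h - ln x - g"
    define e2 where "e2 = l - (ln x)\<^sup>2 / 2 - c"
    define e3 where "e3 = x - real (card (ints x))"
    define e4 where "e4 = (\<Sum>n\<in>ints x. (ln (real n))\<^sup>2) - (x * (ln x)\<^sup>2 - 2 * x * ln x + 2 * x)"
    have "(\<Sum>n\<in>ints x. \<Sum>m\<in>ints (x / n). selb m) = (\<Sum>k\<in>ints x. \<Sum>d | d dvd k. selb (k div d))"
      by (rule sum_ints_dvd_swap[symmetric])
    also have "\<dots> = (\<Sum>k\<in>ints x. (ln (real k))\<^sup>2)"
      by (intro sum.cong) (auto simp: in_ints sum_dvd_flip sum_selb_dvd)
    finally have 1: "(\<Sum>n\<in>ints x. \<Sum>m\<in>ints (x / n). selb m) = (\<Sum>k\<in>ints x. (ln (real k))\<^sup>2)" .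
    have "(\<Sum>n\<in>ints x. G (x / n)) = (\<Sum>n\<in>ints x. 2 * x * ln x * (1 / real n) - 2 * x * (ln (real n) / real n) + \<alpha> * x * (1 / real n) + \<beta>)"
      using x by (intro sum.cong) (auto simp: G_def in_ints ln_div field_simps)
    also have "\<dots> = 2 * x * ln x * h - 2 * x * l + \<alpha> * x * h + \<beta> * card (ints x)"
      unfolding h_def l_def sum_distrib_left by (simp add: sum.distrib sum_subtractf)
    also have "\<dots> = 2 * x * ln x * (ln x + g + e1) - 2 * x * ((ln x)\<^sup>2 / 2 + c + e2) + \<alpha> * x * (ln x + g + e1) + \<beta> * (x - e3)"
      by (simp add: e1_def e2_def e3_def)
    also have "\<dots> = x * (ln x)\<^sup>2 - 2 * x * ln x + 2 * x + (2 * x * ln x * e1 - 2 * x * e2 + \<alpha> * x * e1 - \<beta> * e3)"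
      by (simp add: \<alpha>_def \<beta>_def algebra_simps power2_eq_square)
    finally have "(\<Sum>n\<in>ints x. T (x / n)) = e4 - (2 * x * ln x * e1 - 2 * x * e2 + \<alpha> * x * e1 - \<beta> * e3)"
      using 1 by (simp add: T_def sum_subtractf e4_def)
    then have "\<bar>\<Sum>n\<in>ints x. T (x / n)\<bar> \<le> \<bar>e4\<bar> + \<bar>2 * x * ln x * e1\<bar> + \<bar>2 * x * e2\<bar> + \<bar>\<alpha> * x * e1\<bar> + \<bar>\<beta> * e3\<bar>"
      by linarith
    also have "\<dots> \<le> 18 * x powr (3/4) + 8 * K1 * x powr (3/4) + 2 * K2 * x powr (3/4) + \<bar>\<alpha>\<bar> * K1 * x powr (3/4) + \<bar>\<beta>\<bar> * x powr (3/4)"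
    proof (intro add_mono)
      have p: "x * x powr (-1/2) \<le> x powr (3/4)" "x * x powr (1/4) * x powr (-1/2) = x powr (3/4)"
        using x powr_add[of x 1 "-1/2"] powr_add[of x 1 "1/4"] powr_add[of x "5/4" "-1/2"] powr_mono[of "1/2" "3/4" x] by auto
      have e1: "\<bar>e1\<bar> \<le> K1 * x powr (-1/2)" using h1[OF x] by (simp add: e1_def h_def)
      have e2: "\<bar>e2\<bar> \<le> K2 * x powr (-1/2)" using h2[OF x] by (simp add: e2_def l_def)
      show "\<bar>e4\<bar> \<le> 18 * x powr (3/4)" using sum_ln_square_asymp[OF x] by (simp add: e4_def)
      have "\<bar>2 * x * ln x * e1\<bar> = 2 * x * ln x * \<bar>e1\<bar>" using x by (simp add: abs_mult)
      also have "\<dots> \<le> 2 * x * (4 * x powr (1/4)) * (K1 * x powr (-1/2))"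
        using x e1 K0 by (intro mult_mono mult_left_mono ln_le_quartic_root) auto
      also have "\<dots> = 8 * K1 * (x * x powr (1/4) * x powr (-1/2))" by simp
      finally show "\<bar>2 * x * ln x * e1\<bar> \<le> 8 * K1 * x powr (3/4)" by (simp only: p)
      have "\<bar>2 * x * e2\<bar> = 2 * x * \<bar>e2\<bar>" using x by (simp add: abs_mult)
      also have "\<dots> \<le> 2 * x * (K2 * x powr (-1/2))" using e2 x by (intro mult_left_mono) auto
      also have "\<dots> = 2 * K2 * (x * x powr (-1/2))" by simp
      also have "\<dots> \<le> 2 * K2 * x powr (3/4)" using p K0 by (intro mult_left_mono) auto
      finally show "\<bar>2 * x * e2\<bar> \<le> 2 * K2 * x powr (3/4)" .
      have "\<bar>\<alpha> * x * e1\<bar> = \<bar>\<alpha>\<bar> * x * \<bar>e1\<bar>" using x by (simp add: abs_mult)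
      also have "\<dots> \<le> \<bar>\<alpha>\<bar> * x * (K1 * x powr (-1/2))" using e1 x by (intro mult_left_mono) auto
      also have "\<dots> = \<bar>\<alpha>\<bar> * K1 * (x * x powr (-1/2))" by simp
      also have "\<dots> \<le> \<bar>\<alpha>\<bar> * K1 * x powr (3/4)" using p K0 by (intro mult_left_mono) auto
      finally show "\<bar>\<alpha> * x * e1\<bar> \<le> \<bar>\<alpha>\<bar> * K1 * x powr (3/4)" .
      have "\<bar>e3\<bar> \<le> 1" using card_ints_le[of x] card_ints_ge[of x] x by (auto simp: e3_def)
      also have "1 \<le> x powr (3/4)" using x by (simp add: ge_one_powr_ge_zero)
      finally show "\<bar>\<beta> * e3\<bar> \<le> \<bar>\<beta>\<bar> * x powr (3/4)" by (simp add: abs_mult mult_left_mono)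
    qed
    also have "\<dots> = C * x powr (3/4)" by (simp add: C_def algebra_simps)
    finally show ?thesis .
  qed
  then have T: "\<bar>T x\<bar> \<le> 4 * C * x" if "x \<ge> 1" for x
    using moebius_inversion_bound[of T C x] that by blast
  show ?thesis
  proof
    show "0 \<le> 4 * C + \<bar>\<alpha>\<bar> + \<bar>\<beta>\<bar>" using K0 by (auto simp: C_def intro!: add_nonneg_nonneg)
    fix x :: real assume x: "x \<ge> 1"
    have "\<bar>(\<Sum>m\<in>ints x. selb m) - 2 * x * ln x\<bar> = \<bar>T x + \<alpha> * x + \<beta>\<bar>" by (simp add: T_def G_def)
    also have "\<dots> \<le> \<bar>T x\<bar> + \<bar>\<alpha> * x\<bar> + \<bar>\<beta>\<bar>" by linarith
    also have "\<bar>\<alpha> * x\<bar> = \<bar>\<alpha>\<bar> * x" using x by (simp add: abs_mult)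
    also have "\<bar>\<beta>\<bar> \<le> \<bar>\<beta>\<bar> * x" using x by (simp add: mult_le_cancel_left1)
    finally show "\<bar>(\<Sum>m\<in>ints x. selb m) - 2 * x * ln x\<bar> \<le> (4 * C + \<bar>\<alpha>\<bar> + \<bar>\<beta>\<bar>) * x"
      using T[OF x] by (simp add: algebra_simps)
  qed
qed

section \<open>Mass estimates for the Selberg weights\<close>

lemma sum_ints_swap_sum_dvd:
  fixes f :: "nat \<Rightarrow> real"
  shows "(\<Sum>n\<in>ints x. \<Sum>d | d dvd n. f d) = (\<Sum>d\<in>ints x. f d * card (ints (x / d)))"
  using sum_ints_dvd_swap[of "\<lambda>d m. f d" x] by (simp add: mult.commute)

text \<open>Up to rounding, \<open>x / m\<close> counts the multiples of \<open>m\<close>, so the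
  sum is the mean of \<open>(ln n)\<^sup>2\<close>, and Selberg's formula controls the rounding. The
  leading coefficient 1 matters: the weights must add up to the same \<open>(ln x)\<^sup>2\<close>
  that multiplies the average in the near-extremal argument.\<close>

lemma sum_selb_div_le:
  obtains C where "C \<ge> 0" "\<And>x. x \<ge> 1 \<Longrightarrow> (\<Sum>m\<in>ints x. selb m / m) \<le> (ln x)\<^sup>2 + C * (1 + ln x)"
proof -
  obtain C where C: "C \<ge> 0" "\<And>x. x \<ge> 1 \<Longrightarrow> \<bar>(\<Sum>m\<in>ints x. selb m) - 2 * x * ln x\<bar> \<le> C * x"
    using selberg_formula by blast
  have "(\<Sum>m\<in>ints x. selb m / m) \<le> (ln x)\<^sup>2 + (C + 2) * (1 + ln x)" if x: "x \<ge> 1" for x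
  proof -
    have "x * (\<Sum>m\<in>ints x. selb m / m) = (\<Sum>m\<in>ints x. selb m * (x / m))"
      by (simp add: sum_distrib_left field_simps)
    also have "\<dots> \<le> (\<Sum>m\<in>ints x. selb m * (real (card (ints (x / m))) + 1))"
      using card_ints_ge by (intro sum_mono mult_left_mono selb_nonneg) (smt (verit))
    also have "\<dots> = (\<Sum>m\<in>ints x. selb m * real (card (ints (x / m)))) + (\<Sum>m\<in>ints x. selb m)"
      by (simp add: algebra_simps sum.distrib)
    also have "(\<Sum>m\<in>ints x. selb m * real (card (ints (x / m)))) = (\<Sum>n\<in>ints x. \<Sum>d | d dvd n. selb d)"
      by (rule sum_ints_swap_sum_dvd[symmetric])
    also have "\<dots> = (\<Sum>n\<in>ints x. (ln (real n))\<^sup>2)"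
      by (intro sum.cong) (auto simp: in_ints sum_selb_dvd)
    also have "\<dots> \<le> (\<Sum>n\<in>ints x. (ln x)\<^sup>2)"
      by (intro sum_mono power_mono) (auto simp: in_ints)
    also have "\<dots> = card (ints x) * (ln x)\<^sup>2" by simp
    also have "\<dots> \<le> x * (ln x)\<^sup>2" using card_ints_le[of x] x by (intro mult_right_mono) auto
    also have "(\<Sum>m\<in>ints x. selb m) \<le> 2 * x * ln x + C * x" using C(2)[OF x] by linarith
    finally have "x * (\<Sum>m\<in>ints x. selb m / m) \<le> x * ((ln x)\<^sup>2 + 2 * ln x + C)"
      by (simp add: algebra_simps)
    then have "(\<Sum>m\<in>ints x. selb m / m) \<le> (ln x)\<^sup>2 + 2 * ln x + C" using x by simp
    also have "\<dots> \<le> (ln x)\<^sup>2 + (C + 2) * (1 + ln x)" using x C by (simp add: algebra_simps)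
    finally show ?thesis .
  qed
  with C(1) show ?thesis using that[of "C + 2"] by simp
qed

lemma sum_selb_le:
  obtains C where "C \<ge> 0" "\<And>x. x \<ge> 1 \<Longrightarrow> (\<Sum>m\<in>ints x. selb m) \<le> C * x * (1 + ln x)"
proof -
  obtain C where C: "C \<ge> 0" "\<And>x. x \<ge> 1 \<Longrightarrow> \<bar>(\<Sum>m\<in>ints x. selb m) - 2 * x * ln x\<bar> \<le> C * x"
    using selberg_formula by blast
  have "(\<Sum>m\<in>ints x. selb m) \<le> (C + 2) * x * (1 + ln x)" if x: "x \<ge> 1" for x
  proof -
    have "(\<Sum>m\<in>ints x. selb m) \<le> 2 * x * ln x + C * x" using C(2)[OF x] by linarith
    also have "\<dots> \<le> (C + 2) * x * (1 + ln x)" using x C(1) by (simp add: algebra_simps)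
    finally show ?thesis .
  qed
  with C(1) show ?thesis using that[of "C + 2"] by simp
qed

text \<open>Difference of Selberg's formula at \<open>z = exp \<delta> * y\<close> and at
  \<open>y\<close>, with all weights \<open>1 / m\<close> lowered to \<open>1 / z\<close>. The main
  terms leave at least \<open>2 * ln y * (1 - exp (- \<delta>))\<close>, the errors only a constant,
  and \<open>1 - exp (- \<delta>) \<ge> \<delta> / 2\<close> absorbs the factor 2.\<close>

lemma selb_cell_ge:
  obtains C where "C \<ge> 0" "\<And>y \<delta>. y \<ge> 1 \<Longrightarrow> 0 < \<delta> \<Longrightarrow> \<delta> \<le> 1 \<Longrightarrow>
    (\<Sum>m\<in>ints (exp \<delta> * y) - ints y. selb m / m) \<ge> \<delta> * ln y - C"
proof -
  obtain C where C: "C \<ge> 0" "\<And>x. x \<ge> 1 \<Longrightarrow> \<bar>(\<Sum>m\<in>ints x. selb m) - 2 * x * ln x\<bar> \<le> C * x"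
    using selberg_formula by blast
  have "(\<Sum>m\<in>ints (exp \<delta> * y) - ints y. selb m / m) \<ge> \<delta> * ln y - 2 * C"
    if y: "y \<ge> 1" and \<delta>: "0 < \<delta>" "\<delta> \<le> 1" for y \<delta>
  proof -
    define z where "z = exp \<delta> * y"
    have z: "z \<ge> y" "z \<ge> 1" "z > 0" and lz: "ln z = \<delta> + ln y" using y \<delta>
      by (auto simp: z_def ln_mult mult_le_cancel_right1 intro: order_trans[OF y])
    have sub: "ints y \<subseteq> ints z" using z by (auto simp: in_ints)
    have yz: "y / z = exp (- \<delta>)" using y by (simp add: z_def exp_minus field_simps)
    have e: "exp (- \<delta>) \<le> 1 - \<delta> / 2"
    proof -
      have "exp (- \<delta>) = inverse (exp \<delta>)" by (simp add: exp_minus)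
      also have "\<dots> \<le> inverse (1 + \<delta>)" using \<delta> exp_ge_add_one_self[of \<delta>] by (intro le_imp_inverse_le) auto
      also have "\<dots> \<le> 1 - \<delta> / 2" using \<delta> by (simp add: field_simps)
      finally show ?thesis .
    qed
    have "\<delta> * ln y - 2 * C \<le> 2 * ln y * (1 - exp (- \<delta>)) - 2 * C"
      using mult_left_mono[of "\<delta> / 2" "1 - exp (- \<delta>)" "2 * ln y"] e y by (simp add: algebra_simps)
    also have "\<dots> \<le> 2 * ln z - 2 * ln y * (y / z) - C - C * (y / z)"
      using \<delta> C(1) by (simp add: lz yz algebra_simps mult_le_cancel_left2) (smt (verit) mult_left_le exp_le_one_iff)
    also have "\<dots> = (2 * z * ln z - C * z - (2 * y * ln y + C * y)) / z"
      using z by (simp add: field_simps)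
    also have "\<dots> \<le> ((\<Sum>m\<in>ints z. selb m) - (\<Sum>m\<in>ints y. selb m)) / z"
      using C(2)[OF y] C(2)[OF z(2)] z by (intro divide_right_mono) (auto simp: abs_le_iff)
    also have "\<dots> = (\<Sum>m\<in>ints z - ints y. selb m / z)"
      by (simp add: sum_diff[OF finite_ints sub] sum_divide_distrib diff_divide_distrib)
    also have "\<dots> \<le> (\<Sum>m\<in>ints z - ints y. selb m / m)"
      using selb_nonneg z by (intro sum_mono divide_left_mono) (auto simp: in_ints)
    finally show ?thesis by (simp add: z_def)
  qed
  with C(1) show ?thesis using that[of "2 * C"] by simp
qed

text \<open>Mertens' estimate up to a constant: for \<open>d \<le> x\<close> the quotient
  \<open>x / d\<close> is at most twice the number of multiples of \<open>d\<close>, and these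
  counts, weighted by \<open>mangoldt\<close>, add up to the logarithm of a factorial.\<close>

lemma sum_mangoldt_div_le:
  assumes x: "x \<ge> 1"
  shows "(\<Sum>d\<in>ints x. mangoldt d / d) \<le> 2 * ln x"
proof -
  have "x * (\<Sum>d\<in>ints x. mangoldt d / d) = (\<Sum>d\<in>ints x. mangoldt d * (x / d))"
    by (simp add: sum_distrib_left field_simps)
  also have "\<dots> \<le> (\<Sum>d\<in>ints x. mangoldt d * (2 * card (ints (x / d))))"
  proof (intro sum_mono mult_left_mono mangoldt_nonneg)
    fix d assume d: "d \<in> ints x"
    then have "1 \<in> ints (x / d)" by (auto simp: in_ints)
    then have "card (ints (x / d)) \<ge> 1" by (metis card_gt_0_iff empty_iff finite_ints less_eq_Suc_le One_nat_def)
    then show "x / d \<le> real (2 * card (ints (x / d)))" using card_ints_ge[of "x / d"] by linarith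
  qed
  also have "\<dots> = 2 * (\<Sum>d\<in>ints x. mangoldt d * card (ints (x / d)))"
    by (simp add: sum_distrib_left mult_ac)
  also have "(\<Sum>d\<in>ints x. mangoldt d * card (ints (x / d))) = (\<Sum>n\<in>ints x. \<Sum>d | d dvd n. mangoldt d)"
    by (rule sum_ints_swap_sum_dvd[symmetric])
  also have "\<dots> = (\<Sum>n\<in>ints x. ln (real n))"
    by (intro sum.cong) (auto simp: in_ints mangoldt_sum)
  also have "\<dots> \<le> (\<Sum>n\<in>ints x. ln x)" by (intro sum_mono) (auto simp: in_ints)
  also have "\<dots> \<le> x * ln x" using card_ints_le[of x] x by (auto intro!: mult_right_mono)
  finally show ?thesis using x by simp
qed

text \<open>Von Mangoldt's function on the proper prime powers, that is, with exponent at least 2;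
  unlike the full function it is summable against \<open>1 / d\<close>.\<close>

definition mangoldt_pp :: "nat \<Rightarrow> real" where
  "mangoldt_pp d = (if prime d then 0 else mangoldt d)"

lemma mangoldt_pp_nonneg: "mangoldt_pp d \<ge> 0"
  by (simp add: mangoldt_pp_def mangoldt_nonneg)

lemma sum_mangoldt_pp_div_le:
  obtains C where "C \<ge> 0" "\<And>x. (\<Sum>d\<in>ints x. mangoldt_pp d / d) \<le> C"
proof -
  \<comment> \<open>The factor 4 is the product of the bound 2 for the geometric series in
    \<open>1 / p\<close> and the 2 in \<open>ln p \<le> 2 * p powr (1/2)\<close>.\<close>
  define g where "g p = 4 * real p powr (-3/2)" for p :: nat
  have sg: "summable g" unfolding g_def by (intro summable_mult) (simp add: summable_real_powr_iff)
  have "(\<Sum>d\<in>ints x. mangoldt_pp d / d) \<le> suminf g" for x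
  proof -
    define N where "N = nat \<lfloor>x\<rfloor>"
    have "(\<Sum>d\<in>ints x. mangoldt_pp d / d) = (\<Sum>d\<in>{d\<in>ints x. mangoldt_pp d \<noteq> 0}. mangoldt_pp d / d)"
      by (intro sum.mono_neutral_right) auto
    also have "\<dots> \<le> (\<Sum>(p,k)\<in>{2..N} \<times> {..<N}. ln (real p) / real (p ^ (k + 2)))"
    proof (rule sum_le_included[where i = "\<lambda>(p,k). p ^ (k + 2)"])
      show "\<forall>d\<in>{d \<in> ints x. mangoldt_pp d \<noteq> 0}. \<exists>s\<in>{2..N} \<times> {..<N}.
          (case s of (p, k) \<Rightarrow> p ^ (k + 2)) = d \<and>
          mangoldt_pp d / real d \<le> (case s of (p, k) \<Rightarrow> ln (real p) / real (p ^ (k + 2)))"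
      proof
        fix d assume "d \<in> {d \<in> ints x. mangoldt_pp d \<noteq> 0}"
        then have d: "d \<in> ints x" "\<not> prime d" "primepow d"
          by (auto simp: mangoldt_pp_def mangoldt_def split: if_splits)
        then obtain p k where pk: "prime p" "k > 0" "d = p ^ k" by (auto simp: primepow_def)
        with d have "k \<noteq> 1" by auto
        define j where "j = k - 2"
        have j: "k = j + 2" using pk(2) \<open>k \<noteq> 1\<close> by (simp add: j_def)
        have dN: "d \<le> N" using d(1) by (auto simp: in_ints N_def le_nat_floor)
        have p2: "p \<ge> 2" using pk(1) by (rule prime_ge_2_nat)
        have "p \<le> d" using pk by (simp add: self_le_power prime_gt_0_nat Suc_leI)
        moreover have "2 ^ k \<le> p ^ k" using p2 by (intro power_mono) auto
        then have "j < d" using less_exp[of k] unfolding pk(3) j by linarith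
        ultimately have "(p, j) \<in> {2..N} \<times> {..<N}" using dN p2 by auto
        moreover have "mangoldt_pp d = ln (real p)" using d pk by (simp add: mangoldt_pp_def)
        ultimately show "\<exists>s\<in>{2..N} \<times> {..<N}. (case s of (p, k) \<Rightarrow> p ^ (k + 2)) = d \<and>
          mangoldt_pp d / real d \<le> (case s of (p, k) \<Rightarrow> ln (real p) / real (p ^ (k + 2)))"
          using pk j by (intro bexI[of _ "(p, j)"]) auto
      qed
    qed auto
    also have "\<dots> = (\<Sum>p\<in>{2..N}. \<Sum>k<N. ln (real p) / real (p ^ (k + 2)))"
      by (rule sum.cartesian_product[symmetric])
    also have "\<dots> \<le> (\<Sum>p\<in>{2..N}. g p)"
    proof (rule sum_mono)
      fix p assume "p \<in> {2..N}"
      then have p: "real p \<ge> 2" by auto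
      have geo: "(\<Sum>k<N. (1 / real p) ^ k) \<le> 2"
      proof -
        have "(\<Sum>k<N. (1 / real p) ^ k) \<le> (\<Sum>k<N. (1 / 2) ^ k)"
          using p by (intro sum_mono power_mono) (auto simp: field_simps)
        also have "\<dots> \<le> 2" by (simp add: sum_gp_strict)
        finally show ?thesis .
      qed
      have "(\<Sum>k<N. ln (real p) / real (p ^ (k + 2))) = ln (real p) / (real p)\<^sup>2 * (\<Sum>k<N. (1 / real p) ^ k)"
        unfolding sum_distrib_left by (intro sum.cong) (simp_all add: power_add power_divide power2_eq_square)
      also have "\<dots> \<le> ln (real p) / (real p)\<^sup>2 * 2"
        using geo p by (intro mult_left_mono) auto
      also have "\<dots> \<le> (2 * real p powr (1/2)) / (real p)\<^sup>2 * 2"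
        using ln_powr_bound[of "real p" "1/2"] p by (intro mult_right_mono divide_right_mono) auto
      also have "\<dots> = 4 * (real p powr (1/2) * real p powr (-2))"
        using p by (simp add: powr_minus_divide)
      also have "\<dots> = g p" unfolding g_def powr_add[symmetric] by simp
      finally show "(\<Sum>k<N. ln (real p) / real (p ^ (k + 2))) \<le> g p" .
    qed
    also have "\<dots> \<le> suminf g" by (rule sum_le_suminf[OF sg]) (auto simp: g_def)
    finally show ?thesis .
  qed
  moreover have "0 \<le> suminf g" by (intro suminf_nonneg sg) (auto simp: g_def)
  ultimately show ?thesis using that by blast
qed

section \<open>Support of the weights and the numbers that are not squarefree\<close>

lemma primepow_squarefree_imp_prime: "primepow n \<Longrightarrow> squarefree n \<Longrightarrow> prime n" for n :: nat
  by (auto simp: primepow_def squarefree_power_iff)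

lemma selb_support:
  assumes "selb m \<noteq> 0" "squarefree m"
  shows "prime m \<or> (\<exists>p q. prime p \<and> prime q \<and> m = p * q)"
proof -
  from assms(1) consider "mangoldt m \<noteq> (0::real)" | e where "e dvd m" "mangoldt e \<noteq> (0::real)" "mangoldt (m div e) \<noteq> (0::real)"
    unfolding selb_def by (metis (mono_tags, lifting) add_0 mem_Collect_eq mult_eq_0_iff sum.neutral)
  then show ?thesis
  proof cases
    case 1
    then show ?thesis using primepow_squarefree_imp_prime assms(2) by (auto simp: mangoldt_def split: if_splits)
  next
    case 2
    define f where "f = m div e"
    have f: "m = e * f" "primepow e" "primepow f"
      using 2 by (auto simp: mangoldt_def f_def split: if_splits)
    then have "prime e" "prime f" using assms(2)
      by (metis primepow_squarefree_imp_prime squarefree_mono dvd_triv_left dvd_triv_right)+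
    then show ?thesis using f by auto
  qed
qed

text \<open>A nonzero term of the convolution splits \<open>m\<close> into two prime powers. If
  \<open>m\<close> is not squarefree, one of them is proper, unless \<open>m = e * e\<close> with
  \<open>e\<close> prime. That one term is charged to \<open>mangoldt_pp m * ln m\<close>, which
  occurs already as the first summand of \<open>selb m\<close>; hence the factor 2.\<close>

lemma selb_not_squarefree_le:
  assumes "\<not> squarefree m" "m > 0"
  shows "selb m \<le> 2 * (mangoldt_pp m * ln m) +
     (\<Sum>e | e dvd m. mangoldt_pp e * mangoldt (m div e) + mangoldt e * mangoldt_pp (m div e))"
proof -
  have np: "\<not> prime m" using assms squarefree_prime by blast
  have fin: "finite {e. e dvd m}" using assms by auto
  have nn: "0 \<le> mangoldt_pp m * ln m"
    using assms(2) by (intro mult_nonneg_nonneg mangoldt_pp_nonneg) auto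
  have "mangoldt e * mangoldt (m div e) \<le> (mangoldt_pp e * mangoldt (m div e) + mangoldt e * mangoldt_pp (m div e))
      + (if m = e * e then mangoldt_pp m * ln m else 0)" if e: "e dvd m" for e
  proof (cases "prime e \<and> prime (m div e)")
    case True
    obtain f where f: "m = e * f" "f = m div e" using e by auto
    have "e = f"
    proof (rule ccontr)
      assume "e \<noteq> f"
      then have "coprime e f" using True f(2) by (simp add: primes_coprime)
      then have "squarefree m" using True f squarefree_mult_coprime squarefree_prime by metis
      then show False using assms by simp
    qed
    then have m: "m = e * e" using f(1) by metis
    have "e > 0" using True by (simp add: prime_gt_0_nat)
    then have me: "m div e = e" using m by simp
    have "mangoldt m = ln (real e)"
      using mangoldt_primepow'[of e 2, where ?'a = real] True by (simp add: m power2_eq_square)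
    then have "mangoldt_pp m = ln (real e)" "ln (real e) \<le> ln (real m)"
      using np m True \<open>e > 0\<close> by (auto simp: mangoldt_pp_def ln_mult)
    then have "mangoldt e * mangoldt (m div e) \<le> mangoldt_pp m * ln m"
      using True \<open>e > 0\<close> unfolding me by (auto intro!: mult_left_mono)
    moreover have "0 \<le> mangoldt_pp e * mangoldt (m div e) + mangoldt e * mangoldt_pp (m div e)"
      by (intro add_nonneg_nonneg mult_nonneg_nonneg mangoldt_nonneg mangoldt_pp_nonneg)
    ultimately show ?thesis using m by simp
  next
    case False
    then have "mangoldt e * mangoldt (m div e) \<le> mangoldt_pp e * mangoldt (m div e) + mangoldt e * mangoldt_pp (m div e)"
      using mangoldt_nonneg[of e] mangoldt_nonneg[of "m div e"] by (auto simp: mangoldt_pp_def)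
    moreover have "0 \<le> (if m = e * e then mangoldt_pp m * ln m else 0)"
      using nn by (metis order_refl)
    ultimately show ?thesis by linarith
  qed
  then have "(\<Sum>e | e dvd m. mangoldt e * mangoldt (m div e)) \<le>
     (\<Sum>e | e dvd m. (mangoldt_pp e * mangoldt (m div e) + mangoldt e * mangoldt_pp (m div e))
      + (if m = e * e then mangoldt_pp m * ln m else 0))"
    by (intro sum_mono) auto
  also have "\<dots> = (\<Sum>e | e dvd m. mangoldt_pp e * mangoldt (m div e) + mangoldt e * mangoldt_pp (m div e))
      + (\<Sum>e | e dvd m. if m = e * e then mangoldt_pp m * ln m else 0)"
    by (rule sum.distrib)
  also have "(\<Sum>e | e dvd m. if m = e * e then mangoldt_pp m * ln m else 0) \<le> mangoldt_pp m * ln m"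
  proof -
    have "(\<Sum>e | e dvd m. if m = e * e then mangoldt_pp m * ln m else 0)
       = (\<Sum>e\<in>{e. e dvd m \<and> m = e * e}. mangoldt_pp m * ln m)"
      using fin by (simp add: sum.inter_filter[symmetric])
    also have "\<dots> = card {e. e dvd m \<and> m = e * e} * (mangoldt_pp m * ln m)" by (simp only: sum_constant)
    also have "\<dots> \<le> 1 * (mangoldt_pp m * ln m)"
    proof (intro mult_right_mono nn)
      have uniq: "e = f" if "m = e * e" "m = f * f" for e f
        using that power2_eq_iff_nonneg[of e f] by (metis power2_eq_square zero_le)
      have fin2: "finite {e. e dvd m \<and> m = e * e}" using fin by (rule rev_finite_subset) blast
      then have "card {e. e dvd m \<and> m = e * e} \<le> Suc 0"
        unfolding card_le_Suc0_iff_eq[OF fin2] using uniq by blast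
      then show "real (card {e. e dvd m \<and> m = e * e}) \<le> 1" by simp
    qed
    finally show ?thesis by simp
  qed
  finally show ?thesis using np by (simp add: selb_def mangoldt_pp_def)
qed

text \<open>Every term of the preceding bound has a factor \<open>mangoldt_pp\<close> with bounded
  sum, and the other factor contributes O(ln x). A full logarithm is gained over the total
  mass.\<close>

lemma sum_selb_not_squarefree_le:
  obtains C where "C \<ge> 0" "\<And>x. x \<ge> 1 \<Longrightarrow> (\<Sum>m\<in>{m\<in>ints x. \<not> squarefree m}. selb m / m) \<le> C * ln x"
proof -
  obtain C where C: "C \<ge> 0" "\<And>x. (\<Sum>d\<in>ints x. mangoldt_pp d / d) \<le> C"
    using sum_mangoldt_pp_div_le by blast
  have "(\<Sum>m\<in>{m\<in>ints x. \<not> squarefree m}. selb m / m) \<le> 6 * C * ln x" if x: "x \<ge> 1" for x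
  proof -
    define h where "h m = 2 * (mangoldt_pp m * ln m) +
       (\<Sum>e | e dvd m. mangoldt_pp e * mangoldt (m div e) + mangoldt e * mangoldt_pp (m div e))" for m
    have h0: "h m \<ge> 0" if "m > 0" for m unfolding h_def using that mangoldt_pp_nonneg mangoldt_nonneg
      by (intro add_nonneg_nonneg sum_nonneg mult_nonneg_nonneg) auto
    have split: "(\<Sum>m\<in>ints x. (\<Sum>e | e dvd m. a e * b (m div e)) / m) = (\<Sum>e\<in>ints x. a e / e * (\<Sum>k\<in>ints (x / e). b k / k))"
      for a b :: "nat \<Rightarrow> real"
    proof -
      have "(\<Sum>m\<in>ints x. (\<Sum>e | e dvd m. a e * b (m div e)) / m)
          = (\<Sum>m\<in>ints x. \<Sum>e | e dvd m. a e / e * (b (m div e) / (m div e)))"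
        by (intro sum.cong refl) (auto simp: sum_divide_distrib in_ints intro!: sum.cong elim!: dvdE)
      also have "\<dots> = (\<Sum>e\<in>ints x. \<Sum>k\<in>ints (x / e). a e / e * (b k / k))"
        by (rule sum_ints_dvd_swap)
      finally show ?thesis by (simp add: sum_distrib_left)
    qed
    have "(\<Sum>m\<in>{m\<in>ints x. \<not> squarefree m}. selb m / m) \<le> (\<Sum>m\<in>{m\<in>ints x. \<not> squarefree m}. h m / m)"
      unfolding h_def by (intro sum_mono divide_right_mono selb_not_squarefree_le) (auto simp: in_ints)
    also have "\<dots> \<le> (\<Sum>m\<in>ints x. h m / m)"
      using h0 by (intro sum_mono2) (auto simp: in_ints)
    also have "\<dots> = 2 * (\<Sum>m\<in>ints x. mangoldt_pp m / m * ln m)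
       + (\<Sum>m\<in>ints x. (\<Sum>e | e dvd m. mangoldt_pp e * mangoldt (m div e)) / m)
       + (\<Sum>m\<in>ints x. (\<Sum>e | e dvd m. mangoldt e * mangoldt_pp (m div e)) / m)"
      by (simp add: h_def add_divide_distrib sum.distrib sum_distrib_left)
    also have "\<dots> \<le> 2 * (C * ln x) + C * (2 * ln x) + (2 * ln x) * C"
    proof (intro add_mono mult_left_mono)
      have "(\<Sum>m\<in>ints x. mangoldt_pp m / m * ln m) \<le> (\<Sum>m\<in>ints x. mangoldt_pp m / m * ln x)"
        using mangoldt_pp_nonneg by (intro sum_mono mult_left_mono) (auto simp: in_ints)
      also have "\<dots> = (\<Sum>m\<in>ints x. mangoldt_pp m / m) * ln x" by (simp add: sum_distrib_right)
      also have "\<dots> \<le> C * ln x" using C x by (intro mult_right_mono) auto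
      finally show "(\<Sum>m\<in>ints x. mangoldt_pp m / m * ln m) \<le> C * ln x" .
      have "(\<Sum>m\<in>ints x. (\<Sum>e | e dvd m. mangoldt_pp e * mangoldt (m div e)) / m)
          = (\<Sum>e\<in>ints x. mangoldt_pp e / e * (\<Sum>k\<in>ints (x / e). mangoldt k / k))" by (rule split)
      also have "\<dots> \<le> (\<Sum>e\<in>ints x. mangoldt_pp e / e * (2 * ln x))"
      proof (intro sum_mono mult_left_mono)
        fix e assume e: "e \<in> ints x"
        then have "(\<Sum>k\<in>ints (x / e). mangoldt k / k) \<le> 2 * ln (x / e)"
          by (intro sum_mangoldt_div_le) (auto simp: in_ints)
        also have "\<dots> \<le> 2 * ln x" using e x by (auto simp: in_ints ln_div)
        finally show "(\<Sum>k\<in>ints (x / e). mangoldt k / k) \<le> 2 * ln x" .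
      qed (auto simp: mangoldt_pp_nonneg)
      also have "\<dots> = (\<Sum>m\<in>ints x. mangoldt_pp m / m) * (2 * ln x)" by (simp add: sum_distrib_right)
      also have "\<dots> \<le> C * (2 * ln x)" using C x by (intro mult_right_mono) auto
      finally show "(\<Sum>m\<in>ints x. (\<Sum>e | e dvd m. mangoldt_pp e * mangoldt (m div e)) / m) \<le> C * (2 * ln x)" .
      have "(\<Sum>m\<in>ints x. (\<Sum>e | e dvd m. mangoldt e * mangoldt_pp (m div e)) / m)
          = (\<Sum>e\<in>ints x. mangoldt e / e * (\<Sum>k\<in>ints (x / e). mangoldt_pp k / k))" by (rule split)
      also have "\<dots> \<le> (\<Sum>e\<in>ints x. mangoldt e / e * C)"
        using C mangoldt_nonneg by (intro sum_mono mult_left_mono) auto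
      also have "\<dots> = (\<Sum>m\<in>ints x. mangoldt m / m) * C" by (simp add: sum_distrib_right)
      also have "\<dots> \<le> (2 * ln x) * C" using C sum_mangoldt_div_le[OF x] by (intro mult_right_mono) auto
      finally show "(\<Sum>m\<in>ints x. (\<Sum>e | e dvd m. mangoldt e * mangoldt_pp (m div e)) / m) \<le> (2 * ln x) * C" .
    qed auto
    also have "\<dots> = 6 * C * ln x" by simp
    finally show ?thesis .
  qed
  with C(1) show ?thesis using that[of "6 * C"] by simp
qed

section \<open>Semi-inner product spaces and multiplicative families of isometries\<close>

text \<open>Vectors will be functions rather than classes modulo null sets, so the form is only
  semidefinite, and limits are determined up to vectors with \<open>nrm\<close> 0. A real form
  suffices for complex functions: norms are the same as for the Hermitian product.\<close>

locale semi_inner_space =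
  fixes V :: "'v::real_vector set" and ip :: "'v \<Rightarrow> 'v \<Rightarrow> real"
  assumes subspace_V: "subspace V"
    and ip_commute: "x \<in> V \<Longrightarrow> y \<in> V \<Longrightarrow> ip x y = ip y x"
    and ip_add_left: "x \<in> V \<Longrightarrow> y \<in> V \<Longrightarrow> z \<in> V \<Longrightarrow> ip (x + y) z = ip x z + ip y z"
    and ip_scale_left: "x \<in> V \<Longrightarrow> y \<in> V \<Longrightarrow> ip (c *\<^sub>R x) y = c * ip x y"
    and ip_nonneg: "x \<in> V \<Longrightarrow> 0 \<le> ip x x"
begin

definition nrm :: "'v \<Rightarrow> real" where "nrm x = sqrt (ip x x)"

lemma V_zero [simp, intro]: "0 \<in> V" by (rule subspace_0[OF subspace_V])
lemma V_add [simp, intro]: "x \<in> V \<Longrightarrow> y \<in> V \<Longrightarrow> x + y \<in> V" by (rule subspace_add[OF subspace_V])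
lemma V_diff [simp, intro]: "x \<in> V \<Longrightarrow> y \<in> V \<Longrightarrow> x - y \<in> V" by (rule subspace_diff[OF subspace_V])
lemma V_scale [simp, intro]: "x \<in> V \<Longrightarrow> c *\<^sub>R x \<in> V" by (rule subspace_scale[OF subspace_V])
lemma V_neg [simp, intro]: "x \<in> V \<Longrightarrow> - x \<in> V" by (rule subspace_neg[OF subspace_V])
lemma V_sum [intro]: "(\<And>i. i \<in> A \<Longrightarrow> f i \<in> V) \<Longrightarrow> sum f A \<in> V" by (rule subspace_sum[OF subspace_V])

lemma ip_add_right: "x \<in> V \<Longrightarrow> y \<in> V \<Longrightarrow> z \<in> V \<Longrightarrow> ip z (x + y) = ip z x + ip z y"
  using ip_add_left[of x y z] by (simp add: ip_commute)

lemma ip_scale_right: "x \<in> V \<Longrightarrow> y \<in> V \<Longrightarrow> ip y (c *\<^sub>R x) = c * ip y x"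
  using ip_scale_left[of x y c] by (simp add: ip_commute)

lemma ip_neg_left: "x \<in> V \<Longrightarrow> y \<in> V \<Longrightarrow> ip (- x) y = - ip x y"
  using ip_scale_left[of x y "-1"] by simp

lemma ip_diff_left: "x \<in> V \<Longrightarrow> y \<in> V \<Longrightarrow> z \<in> V \<Longrightarrow> ip (x - y) z = ip x z - ip y z"
  using ip_add_left[of x "- y" z] ip_neg_left[of y z] by simp

lemma ip_diff_right: "x \<in> V \<Longrightarrow> y \<in> V \<Longrightarrow> z \<in> V \<Longrightarrow> ip z (x - y) = ip z x - ip z y"
  using ip_diff_left[of x y z] by (simp add: ip_commute)

lemma ip_zero_left [simp]: "x \<in> V \<Longrightarrow> ip 0 x = 0"
  using ip_scale_left[of 0 x 0] by simp

lemma ip_sum_left: "(\<And>i. i \<in> A \<Longrightarrow> f i \<in> V) \<Longrightarrow> y \<in> V \<Longrightarrow> ip (sum f A) y = (\<Sum>i\<in>A. ip (f i) y)"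
proof (induction A rule: infinite_finite_induct)
  case (insert i A)
  then show ?case by (simp add: ip_add_left V_sum)
qed auto

lemma nrm_nonneg [simp]: "x \<in> V \<Longrightarrow> 0 \<le> nrm x"
  by (simp add: nrm_def ip_nonneg)

lemma nrm_square: "x \<in> V \<Longrightarrow> (nrm x)\<^sup>2 = ip x x"
  by (simp add: nrm_def ip_nonneg)

lemma nrm_zero [simp]: "nrm 0 = 0"
  by (simp add: nrm_def)

lemma nrm_scale: "x \<in> V \<Longrightarrow> nrm (c *\<^sub>R x) = \<bar>c\<bar> * nrm x"
  by (simp add: nrm_def ip_scale_left ip_scale_right real_sqrt_mult power2_eq_square[symmetric] mult.assoc[symmetric])

lemma nrm_square_add: "x \<in> V \<Longrightarrow> y \<in> V \<Longrightarrow> (nrm (x + y))\<^sup>2 = (nrm x)\<^sup>2 + 2 * ip x y + (nrm y)\<^sup>2"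
  by (simp add: nrm_square ip_add_left ip_add_right ip_commute)

lemma nrm_square_diff: "x \<in> V \<Longrightarrow> y \<in> V \<Longrightarrow> (nrm (x - y))\<^sup>2 = (nrm x)\<^sup>2 - 2 * ip x y + (nrm y)\<^sup>2"
  by (simp add: nrm_square ip_diff_left ip_diff_right ip_commute)

lemma Cauchy_Schwarz:
  assumes "x \<in> V" "y \<in> V"
  shows "\<bar>ip x y\<bar> \<le> nrm x * nrm y"
proof -
  have q: "0 \<le> ip x x + 2 * t * ip x y + t\<^sup>2 * ip y y" for t
  proof -
    have "ip (x + t *\<^sub>R y) (x + t *\<^sub>R y) = ip x x + t * ip x y + t * (ip y x + t * ip y y)"
      using assms by (simp only: ip_add_left ip_add_right ip_scale_left ip_scale_right V_add V_scale)
        (simp add: algebra_simps)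
    also have "\<dots> = ip x x + 2 * t * ip x y + t\<^sup>2 * ip y y"
      unfolding ip_commute[OF assms(2,1)] by (simp add: power2_eq_square algebra_simps)
    finally have "ip (x + t *\<^sub>R y) (x + t *\<^sub>R y) = ip x x + 2 * t * ip x y + t\<^sup>2 * ip y y" .
    then show ?thesis using ip_nonneg[of "x + t *\<^sub>R y"] assms by simp
  qed
  have "(ip x y)\<^sup>2 \<le> ip x x * ip y y"
  proof (cases "ip y y = 0")
    case True
    have "ip x y = 0"
    proof (rule ccontr)
      assume n: "ip x y \<noteq> 0"
      \<comment> \<open>With \<open>ip y y = 0\<close> the expression is linear in \<open>t\<close>;
        this choice of \<open>t\<close> makes it -1.\<close>
      have "0 \<le> ip x x + 2 * (- (ip x x + 1) / (2 * ip x y)) * ip x y"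
        using q[of "- (ip x x + 1) / (2 * ip x y)"] True by simp
      then show False using n by (simp add: field_simps)
    qed
    then show ?thesis using True by simp
  next
    case False
    then have p: "ip y y > 0" using ip_nonneg[OF assms(2)] by simp
    have "0 \<le> (ip x x + 2 * (- ip x y / ip y y) * ip x y + (- ip x y / ip y y)\<^sup>2 * ip y y) * ip y y"
      using q[of "- ip x y / ip y y"] p by simp
    also have "\<dots> = ip x x * ip y y - (ip x y)\<^sup>2"
      using p by (simp add: field_simps power2_eq_square)
    finally show ?thesis by simp
  qed
  also have "\<dots> = (nrm x * nrm y)\<^sup>2" using assms by (simp add: power_mult_distrib nrm_square)
  finally have "\<bar>ip x y\<bar>\<^sup>2 \<le> (nrm x * nrm y)\<^sup>2" by simp
  then show ?thesis by (rule power2_le_imp_le) (use assms in simp)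
qed

lemma nrm_triangle:
  assumes "x \<in> V" "y \<in> V"
  shows "nrm (x + y) \<le> nrm x + nrm y"
proof -
  have "(nrm (x + y))\<^sup>2 \<le> (nrm x + nrm y)\<^sup>2"
    using Cauchy_Schwarz[OF assms] assms by (simp add: nrm_square_add power2_sum)
  then show ?thesis using assms by (auto intro: power2_le_imp_le)
qed

lemma nrm_neg: "x \<in> V \<Longrightarrow> nrm (- x) = nrm x"
  using nrm_scale[of x "-1"] by simp

lemma nrm_minus_commute: "x \<in> V \<Longrightarrow> y \<in> V \<Longrightarrow> nrm (x - y) = nrm (y - x)"
  using nrm_neg[of "x - y"] by simp

lemma nrm_triangle_diff: "x \<in> V \<Longrightarrow> y \<in> V \<Longrightarrow> nrm (x - y) \<le> nrm x + nrm y"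
  using nrm_triangle[of x "- y"] by (simp add: nrm_neg)

lemma nrm_dist_triangle: "x \<in> V \<Longrightarrow> y \<in> V \<Longrightarrow> z \<in> V \<Longrightarrow> nrm (x - z) \<le> nrm (x - y) + nrm (y - z)"
  using nrm_triangle[of "x - y" "y - z"] by simp

lemma nrm_le_dist: "x \<in> V \<Longrightarrow> y \<in> V \<Longrightarrow> nrm x \<le> nrm y + nrm (x - y)"
  using nrm_triangle[of "y" "x - y"] by simp

lemma nrm_sum_le: "(\<And>i. i \<in> A \<Longrightarrow> f i \<in> V) \<Longrightarrow> nrm (sum f A) \<le> (\<Sum>i\<in>A. nrm (f i))"
proof (induction A rule: infinite_finite_induct)
  case (insert i A)
  then have "nrm (f i + sum f A) \<le> nrm (f i) + nrm (sum f A)" by (intro nrm_triangle V_sum) auto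
  then show ?case using insert by simp
qed auto

lemma nrm_sum_scale_le:
  assumes "\<And>i. i \<in> A \<Longrightarrow> f i \<in> V" "\<And>i. i \<in> A \<Longrightarrow> nrm (f i) \<le> B"
  shows "nrm (\<Sum>i\<in>A. c i *\<^sub>R f i) \<le> (\<Sum>i\<in>A. \<bar>c i\<bar>) * B"
proof -
  have "nrm (\<Sum>i\<in>A. c i *\<^sub>R f i) \<le> (\<Sum>i\<in>A. nrm (c i *\<^sub>R f i))" by (intro nrm_sum_le) (use assms in auto)
  also have "\<dots> \<le> (\<Sum>i\<in>A. \<bar>c i\<bar> * B)" using assms by (intro sum_mono) (auto simp: nrm_scale intro!: mult_left_mono)
  finally show ?thesis by (simp add: sum_distrib_right)
qed

text \<open>A path of small steps whose points are coloured with finitely many colours, such that points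
  of equal colour are close to each other, stays close to its starting point: jump to the last
  point with the colour of the first one and recurse on the remaining colours.\<close>

lemma nrm_chain:
  fixes a :: "nat \<Rightarrow> 'v" and col :: "nat \<Rightarrow> 'c" and r s :: real
  assumes "finite C" "\<And>i. i0 \<le> i \<Longrightarrow> i \<le> k \<Longrightarrow> col i \<in> C" "i0 \<le> k"
    and "\<And>i. i0 \<le> i \<Longrightarrow> i \<le> k \<Longrightarrow> a i \<in> V"
    and "\<And>i. i0 \<le> i \<Longrightarrow> i < k \<Longrightarrow> nrm (a i - a (Suc i)) \<le> s"
    and "\<And>i j. i0 \<le> i \<Longrightarrow> i \<le> k \<Longrightarrow> i0 \<le> j \<Longrightarrow> j \<le> k \<Longrightarrow> col i = col j \<Longrightarrow> nrm (a i - a j) \<le> r"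
    and "0 \<le> s" "0 \<le> r"
  shows "nrm (a i0 - a k) \<le> card C * (r + s)"
  using assms
proof (induction "card C" arbitrary: C i0)
  case 0
  then show ?case by (metis card_0_eq empty_iff order_refl)
next
  case (Suc n)
  define j where "j = Max {i. i0 \<le> i \<and> i \<le> k \<and> col i = col i0}"
  have fin: "finite {i. i0 \<le> i \<and> i \<le> k \<and> col i = col i0}" by (rule finite_subset[of _ "{..k}"]) auto
  have "j \<in> {i. i0 \<le> i \<and> i \<le> k \<and> col i = col i0}"
    unfolding j_def using fin Suc.prems(3) by (intro Max_in) auto
  then have j: "i0 \<le> j" "j \<le> k" "col j = col i0" by auto
  have last: "col i \<noteq> col i0" if "j < i" "i \<le> k" for i
    using Max_ge[OF fin, of i] that j by (fastforce simp: j_def[symmetric])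
  have d1: "nrm (a i0 - a j) \<le> r" using j Suc.prems by auto
  have rs: "0 \<le> real n * (r + s)" using Suc.prems by simp
  have cC: "real (card C) * (r + s) = (r + s) + real n * (r + s)"
    unfolding Suc.hyps(2)[symmetric] by (simp add: algebra_simps)
  show ?case
  proof (cases "j = k")
    case True
    then show ?thesis using d1 cC rs Suc.prems(7) unfolding True by linarith
  next
    case False
    then have jk: "j < k" using j by simp
    have i0C: "col i0 \<in> C" using Suc.prems by auto
    have "nrm (a (Suc j) - a k) \<le> card (C - {col i0}) * (r + s)"
    proof (rule Suc.hyps(1))
      show "n = card (C - {col i0})" using Suc.hyps(2) i0C Suc.prems(1) by simp
      fix i assume "Suc j \<le> i" "i \<le> k"
      then show "col i \<in> C - {col i0}" using last[of i] Suc.prems(2)[of i] j by auto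
    qed (use Suc.prems j jk in auto)
    also have "real (card (C - {col i0})) = real n" using Suc.hyps(2) i0C Suc.prems(1) by simp
    finally have d3: "nrm (a (Suc j) - a k) \<le> real n * (r + s)" .
    have d2: "nrm (a j - a (Suc j)) \<le> s" using j jk Suc.prems(5) by auto
    have "nrm (a i0 - a k) \<le> nrm (a i0 - a j) + nrm (a j - a k)"
      using j jk Suc.prems by (intro nrm_dist_triangle) auto
    moreover have "nrm (a j - a k) \<le> nrm (a j - a (Suc j)) + nrm (a (Suc j) - a k)"
      using j jk Suc.prems by (intro nrm_dist_triangle) auto
    ultimately show ?thesis using d1 d2 d3 cC by linarith
  qed
qed

end

locale mult_isometries = semi_inner_space +
  fixes U :: "nat \<Rightarrow> 'a \<Rightarrow> 'a"
  assumes U_in [intro]: "n > 0 \<Longrightarrow> v \<in> V \<Longrightarrow> U n v \<in> V"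
    and U_add: "n > 0 \<Longrightarrow> u \<in> V \<Longrightarrow> v \<in> V \<Longrightarrow> U n (u + v) = U n u + U n v"
    and U_scale: "n > 0 \<Longrightarrow> v \<in> V \<Longrightarrow> U n (c *\<^sub>R v) = c *\<^sub>R U n v"
    and U_ip: "n > 0 \<Longrightarrow> u \<in> V \<Longrightarrow> v \<in> V \<Longrightarrow> ip (U n u) (U n v) = ip u v"
    and U_mult: "m > 0 \<Longrightarrow> n > 0 \<Longrightarrow> v \<in> V \<Longrightarrow> U (m * n) v = U m (U n v)"
    and U_1: "v \<in> V \<Longrightarrow> U 1 v = v"
    and finite_U: "finite (U ` {p. prime p})"
begin

section \<open>Averages along a multiplicative family of isometries\<close>

lemma U_zero: "n > 0 \<Longrightarrow> U n 0 = 0"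
  using U_scale[of n 0 0] by simp

lemma U_diff: "n > 0 \<Longrightarrow> u \<in> V \<Longrightarrow> v \<in> V \<Longrightarrow> U n (u - v) = U n u - U n v"
  using U_add[of n u "- v"] U_scale[of n v "-1"] by simp

lemma U_sum: "n > 0 \<Longrightarrow> (\<And>i. i \<in> A \<Longrightarrow> f i \<in> V) \<Longrightarrow> U n (sum f A) = (\<Sum>i\<in>A. U n (f i))"
proof (induction A rule: infinite_finite_induct)
  case (insert i A)
  then show ?case by (simp add: U_add V_sum)
qed (auto simp: U_zero)

lemma nrm_U [simp]: "n > 0 \<Longrightarrow> v \<in> V \<Longrightarrow> nrm (U n v) = nrm v"
  by (simp add: nrm_def U_ip)

lemma nrm_U_diff: "n > 0 \<Longrightarrow> u \<in> V \<Longrightarrow> v \<in> V \<Longrightarrow> nrm (U n u - U n v) = nrm (u - v)"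
  by (simp add: U_diff[symmetric])

lemma U_commute: "m > 0 \<Longrightarrow> n > 0 \<Longrightarrow> v \<in> V \<Longrightarrow> U m (U n v) = U n (U m v)"
  by (metis U_mult mult.commute)

definition psum :: "'a \<Rightarrow> real \<Rightarrow> 'a" where
  "psum F x = (\<Sum>n\<in>ints x. U n F)"

text \<open>Division is by the real \<open>x\<close>, not by the number of terms, so that averages
  at \<open>x\<close> and at \<open>x / m\<close> are related without rounding.\<close>

definition avg :: "'a \<Rightarrow> real \<Rightarrow> 'a" where
  "avg F x = (1 / x) *\<^sub>R psum F x"

lemma psum_in [intro, simp]: "F \<in> V \<Longrightarrow> psum F x \<in> V"
  unfolding psum_def by (rule V_sum) (auto simp: in_ints)

lemma avg_in [intro, simp]: "F \<in> V \<Longrightarrow> avg F x \<in> V"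
  unfolding avg_def by auto

lemma nrm_psum_le: "F \<in> V \<Longrightarrow> 0 \<le> x \<Longrightarrow> nrm (psum F x) \<le> x * nrm F"
proof -
  assume F: "F \<in> V" and x: "0 \<le> x"
  have "nrm (psum F x) \<le> (\<Sum>n\<in>ints x. nrm (U n F))"
    unfolding psum_def using F by (intro nrm_sum_le) (auto simp: in_ints)
  also have "\<dots> = card (ints x) * nrm F" using F by (simp add: in_ints)
  also have "\<dots> \<le> x * nrm F" using card_ints_le[OF x] F by (intro mult_right_mono) auto
  finally show ?thesis .
qed

lemma nrm_avg_le: "F \<in> V \<Longrightarrow> 0 < x \<Longrightarrow> nrm (avg F x) \<le> nrm F"
  using nrm_psum_le[of F x] by (simp add: avg_def nrm_scale field_simps)

lemma psum_add: "F \<in> V \<Longrightarrow> G \<in> V \<Longrightarrow> psum (F + G) x = psum F x + psum G x"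
  by (auto simp: psum_def sum.distrib[symmetric] U_add in_ints intro!: sum.cong)

lemma psum_diff: "F \<in> V \<Longrightarrow> G \<in> V \<Longrightarrow> psum (F - G) x = psum F x - psum G x"
  by (auto simp: psum_def sum_subtractf[symmetric] U_diff in_ints intro!: sum.cong)

lemma U_psum: "m > 0 \<Longrightarrow> F \<in> V \<Longrightarrow> U m (psum F x) = (\<Sum>n\<in>ints x. U (m * n) F)"
  unfolding psum_def by (subst U_sum) (auto simp: in_ints U_mult)

lemma U_psum_commute: "m > 0 \<Longrightarrow> F \<in> V \<Longrightarrow> U m (psum F x) = psum (U m F) x"
  unfolding psum_def by (subst U_sum) (auto simp: in_ints U_commute intro!: sum.cong)

lemma avg_diff: "F \<in> V \<Longrightarrow> G \<in> V \<Longrightarrow> avg (F - G) x = avg F x - avg G x"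
  by (simp add: avg_def psum_diff scaleR_diff_right)

lemma avg_add: "F \<in> V \<Longrightarrow> G \<in> V \<Longrightarrow> avg (F + G) x = avg F x + avg G x"
  by (simp add: avg_def psum_add scaleR_add_right)

lemma avg_U: "m > 0 \<Longrightarrow> F \<in> V \<Longrightarrow> avg (U m F) x = U m (avg F x)"
  by (simp add: avg_def U_scale U_psum_commute)

text \<open>The terms added between \<open>y\<close> and \<open>z\<close> and the change of the
  normalising factor each contribute about \<open>1 - y / z \<le> \<delta>\<close>; the summand
  \<open>1 / y\<close> covers the rounding when integers are counted.\<close>

lemma avg_lipschitz:
  assumes F: "F \<in> V" and y: "0 < y" "y \<le> z" "z \<le> exp \<delta> * y"
  shows "nrm (avg F z - avg F y) \<le> (2 * \<delta> + 1 / y) * nrm F"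
proof -
  have z: "0 < z" using y by simp
  have sub: "ints y \<subseteq> ints z" using y by (auto simp: in_ints)
  have "avg F z - avg F y = (1 / z) *\<^sub>R (psum F z - psum F y) - (1 / y - 1 / z) *\<^sub>R psum F y"
    by (simp add: avg_def algebra_simps)
  also have "nrm \<dots> \<le> nrm ((1 / z) *\<^sub>R (psum F z - psum F y)) + nrm ((1 / y - 1 / z) *\<^sub>R psum F y)"
    using F by (intro nrm_triangle_diff) auto
  also have "\<dots> \<le> (z - y + 1) / z * nrm F + (1 / y - 1 / z) * (y * nrm F)"
  proof (intro add_mono)
    have "psum F z - psum F y = (\<Sum>n\<in>ints z - ints y. U n F)"
      by (simp add: psum_def sum_diff[OF finite_ints sub])
    also have "nrm \<dots> \<le> (\<Sum>n\<in>ints z - ints y. nrm (U n F))"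
      using F by (intro nrm_sum_le) (auto simp: in_ints)
    also have "\<dots> = card (ints z - ints y) * nrm F" using F by (simp add: in_ints)
    also have "\<dots> \<le> (z - y + 1) * nrm F"
      using card_ints_le[of z] card_ints_ge[of y] z F sub
      by (intro mult_right_mono) (auto simp: card_Diff_subset of_nat_diff card_mono)
    finally have "nrm (psum F z - psum F y) / z \<le> (z - y + 1) * nrm F / z"
      using z by (intro divide_right_mono) auto
    then show "nrm ((1 / z) *\<^sub>R (psum F z - psum F y)) \<le> (z - y + 1) / z * nrm F"
      using F z by (simp add: nrm_scale)
    have "1 / z \<le> 1 / y" using y by (simp add: frac_le)
    then show "nrm ((1 / y - 1 / z) *\<^sub>R psum F y) \<le> (1 / y - 1 / z) * (y * nrm F)"
      using F y nrm_psum_le[OF F, of y] by (auto simp: nrm_scale intro!: mult_left_mono)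
  qed
  also have "\<dots> = (2 * (1 - y / z) + 1 / z) * nrm F"
    using y z by (simp add: field_simps)
  also have "\<dots> \<le> (2 * \<delta> + 1 / y) * nrm F"
  proof (intro mult_right_mono add_mono mult_left_mono)
    have "1 - \<delta> \<le> exp (- \<delta>)" using exp_ge_add_one_self[of "- \<delta>"] by simp
    also have "exp (- \<delta>) \<le> y / z" using y z by (simp add: exp_minus field_simps)
    finally show "1 - y / z \<le> \<delta>" by simp
  qed (use y F in \<open>auto simp: frac_le\<close>)
  finally show ?thesis .
qed

lemma sum_selb_psum:
  assumes F: "F \<in> V"
  shows "(\<Sum>m\<in>ints x. selb m *\<^sub>R U m (psum F (x / m))) = (\<Sum>n\<in>ints x. (ln (real n))\<^sup>2 *\<^sub>R U n F)"
proof -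
  have "(\<Sum>m\<in>ints x. selb m *\<^sub>R U m (psum F (x / m)))
      = (\<Sum>m\<in>ints x. \<Sum>k\<in>ints (x / m). selb m *\<^sub>R U (m * k) F)"
    using F by (intro sum.cong) (auto simp: U_psum in_ints scaleR_right.sum)
  also have "\<dots> = (\<Sum>n\<in>ints x. \<Sum>d | d dvd n. selb d *\<^sub>R U (d * (n div d)) F)"
    by (rule sum_ints_dvd_swap[symmetric])
  also have "\<dots> = (\<Sum>n\<in>ints x. (\<Sum>d | d dvd n. selb d) *\<^sub>R U n F)"
    unfolding scaleR_left.sum by (intro sum.cong refl) auto
  also have "\<dots> = (\<Sum>n\<in>ints x. (ln (real n))\<^sup>2 *\<^sub>R U n F)"
    by (intro sum.cong) (auto simp: in_ints sum_selb_dvd)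
  finally show ?thesis .
qed

text \<open>\<open>w n\<close> counts the prime divisors of \<open>n\<close> in \<open>B\<close>.
  Its mean over \<open>n \<le> x\<close> is about \<open>L\<close> and its variance is at most about
  \<open>L\<close>, so replacing \<open>w n\<close> by \<open>L\<close> costs sqrt L on average. The
  term with \<open>card B / x\<close> is the rounding error of the mean.\<close>

lemma turan_kubilius:
  assumes F: "F \<in> V" and B: "finite B" "\<And>p. p \<in> B \<Longrightarrow> prime p" and x: "x \<ge> 1"
  defines "L \<equiv> (\<Sum>p\<in>B. 1 / real p)"
  shows "nrm (L *\<^sub>R avg F x - (\<Sum>p\<in>B. (1 / real p) *\<^sub>R U p (avg F (x / p)))) \<le> sqrt (L + 2 * L * card B / x) * nrm F"
proof -
  define w where "w n = (\<Sum>p\<in>B. if p dvd n then 1 else 0 :: real)" for n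
  have p0: "p > 0" if "p \<in> B" for p using B(2)[OF that] by (rule prime_gt_0_nat)
  have L0: "L \<ge> 0" unfolding L_def by (intro sum_nonneg) auto
  have Up: "U p (psum F (x / p)) = (\<Sum>n\<in>ints x. (if p dvd n then 1 else 0 :: real) *\<^sub>R U n F)" if p: "p \<in> B" for p
  proof -
    have "U p (psum F (x / p)) = (\<Sum>k\<in>ints (x / p). U (p * k) F)" using F p0[OF p] by (rule U_psum[rotated])
    also have "\<dots> = (\<Sum>n\<in>{n\<in>ints x. p dvd n}. U n F)"
      by (intro sum.reindex_bij_witness[of _ "\<lambda>n. n div p" "\<lambda>k. p * k"])
         (use p0[OF p] in \<open>auto simp: in_ints field_simps elim!: dvdE\<close>)
    also have "\<dots> = (\<Sum>n\<in>ints x. if p dvd n then U n F else 0)" by (simp add: sum.inter_filter)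
    also have "\<dots> = (\<Sum>n\<in>ints x. (if p dvd n then 1 else 0 :: real) *\<^sub>R U n F)" by (intro sum.cong) auto
    finally show ?thesis .
  qed
  have "(\<Sum>p\<in>B. (1 / real p) *\<^sub>R U p (avg F (x / p))) = (\<Sum>p\<in>B. (1 / x) *\<^sub>R U p (psum F (x / p)))"
    using p0 F x by (intro sum.cong refl) (auto simp: avg_def U_scale)
  also have "\<dots> = (1 / x) *\<^sub>R (\<Sum>p\<in>B. \<Sum>n\<in>ints x. (if p dvd n then 1 else 0 :: real) *\<^sub>R U n F)"
    by (simp add: scaleR_right.sum Up)
  also have "(\<Sum>p\<in>B. \<Sum>n\<in>ints x. (if p dvd n then 1 else 0 :: real) *\<^sub>R U n F) = (\<Sum>n\<in>ints x. w n *\<^sub>R U n F)"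
    unfolding w_def scaleR_left.sum by (rule sum.swap)
  finally have "L *\<^sub>R avg F x - (\<Sum>p\<in>B. (1 / real p) *\<^sub>R U p (avg F (x / p)))
      = (1 / x) *\<^sub>R (L *\<^sub>R psum F x - (\<Sum>n\<in>ints x. w n *\<^sub>R U n F))"
    by (simp add: avg_def algebra_simps)
  also have "L *\<^sub>R psum F x - (\<Sum>n\<in>ints x. w n *\<^sub>R U n F) = (\<Sum>n\<in>ints x. (L - w n) *\<^sub>R U n F)"
    by (simp add: psum_def scaleR_right.sum sum_subtractf scaleR_diff_left)
  finally have 0: "L *\<^sub>R avg F x - (\<Sum>p\<in>B. (1 / real p) *\<^sub>R U p (avg F (x / p)))
      = (1 / x) *\<^sub>R (\<Sum>n\<in>ints x. (L - w n) *\<^sub>R U n F)" .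
  have "(\<Sum>n\<in>ints x. (L - w n) *\<^sub>R U n F) \<in> V" using F by (intro V_sum) (auto simp: in_ints)
  then have 1: "nrm (L *\<^sub>R avg F x - (\<Sum>p\<in>B. (1 / real p) *\<^sub>R U p (avg F (x / p))))
      = nrm (\<Sum>n\<in>ints x. (L - w n) *\<^sub>R U n F) / x"
    unfolding 0 using x by (simp add: nrm_scale)
  also have "\<dots> \<le> (\<Sum>n\<in>ints x. \<bar>L - w n\<bar>) * nrm F / x"
    using F x by (intro divide_right_mono nrm_sum_scale_le) (auto simp: in_ints)
  finally have 2: "nrm (L *\<^sub>R avg F x - (\<Sum>p\<in>B. (1 / real p) *\<^sub>R U p (avg F (x / p))))
      \<le> (\<Sum>n\<in>ints x. \<bar>L - w n\<bar>) * nrm F / x" .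
  have "(\<Sum>n\<in>ints x. \<bar>L - w n\<bar>) \<le> x * sqrt (L + 2 * L * card B / x)"
  proof -
    have sw: "(\<Sum>n\<in>ints x. w n) \<ge> x * L - card B"
    proof -
      have "x * L - card B = (\<Sum>p\<in>B. x / p - 1)"
        by (simp add: L_def sum_subtractf sum_distrib_left)
      also have "\<dots> \<le> (\<Sum>p\<in>B. real (card (ints (x / p))))" by (intro sum_mono card_ints_ge)
      also have "\<dots> = (\<Sum>p\<in>B. \<Sum>n\<in>ints x. if p dvd n then 1 else 0)"
      proof (intro sum.cong refl)
        fix p assume p: "p \<in> B"
        have "card (ints (x / p)) = card {n\<in>ints x. p dvd n}"
          by (intro bij_betw_same_card[of "\<lambda>k. p * k"] bij_betw_byWitness[where f' = "\<lambda>n. n div p"])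
             (use p0[OF p] in \<open>auto simp: in_ints field_simps elim!: dvdE\<close>)
        then show "real (card (ints (x / p))) = (\<Sum>n\<in>ints x. if p dvd n then 1 else 0)"
          by (simp add: sum.inter_filter[symmetric])
      qed
      also have "\<dots> = (\<Sum>n\<in>ints x. w n)" unfolding w_def by (rule sum.swap)
      finally show ?thesis .
    qed
    have sw2: "(\<Sum>n\<in>ints x. (w n)\<^sup>2) \<le> x * (L\<^sup>2 + L)"
    proof -
      have "(\<Sum>n\<in>ints x. (w n)\<^sup>2) = (\<Sum>n\<in>ints x. \<Sum>p\<in>B. \<Sum>q\<in>B. if p dvd n \<and> q dvd n then 1 else 0)"
        unfolding w_def power2_eq_square sum_product by (intro sum.cong refl) auto
      also have "\<dots> = (\<Sum>p\<in>B. \<Sum>n\<in>ints x. \<Sum>q\<in>B. if p dvd n \<and> q dvd n then 1 else 0)" by (rule sum.swap)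
      also have "\<dots> = (\<Sum>p\<in>B. \<Sum>q\<in>B. \<Sum>n\<in>ints x. if p dvd n \<and> q dvd n then 1 else 0)" by (intro sum.cong refl sum.swap)
      also have "\<dots> \<le> (\<Sum>p\<in>B. \<Sum>q\<in>B. x * (1 / p * (1 / q)) + (if p = q then x / p else 0))"
      proof (intro sum_mono)
        fix p q assume pq: "p \<in> B" "q \<in> B"
        \<comment> \<open>The least common multiple of \<open>p\<close> and \<open>q\<close>. The
          diagonal pairs are what produces the summand \<open>L\<close> beyond
          \<open>L\<^sup>2\<close> in the second moment.\<close>
        define d where "d = (if p = q then p else p * q)"
        have d: "d > 0" using p0 pq by (auto simp: d_def)
        have cop: "coprime p q" if "p \<noteq> q" using pq B(2) that by (auto intro: primes_coprime)
        have "p dvd n \<and> q dvd n \<longleftrightarrow> d dvd n" for n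
          by (auto simp: d_def intro: divides_mult cop dvd_mult_left dvd_mult_right)
        then have "(\<Sum>n\<in>ints x. if p dvd n \<and> q dvd n then 1 else 0 :: real) = card {n\<in>ints x. d dvd n}"
          by (simp add: sum.inter_filter[symmetric])
        also have "card {n\<in>ints x. d dvd n} = card (ints (x / d))"
          by (intro bij_betw_same_card[of "\<lambda>n. n div d"] bij_betw_byWitness[where f' = "\<lambda>k. d * k"])
             (use d in \<open>auto simp: in_ints field_simps elim!: dvdE\<close>)
        also have "real \<dots> \<le> x / d" using x by (intro card_ints_le) auto
        also have "\<dots> \<le> x * (1 / p * (1 / q)) + (if p = q then x / p else 0)"
          using x by (auto simp: d_def)
        finally show "(\<Sum>n\<in>ints x. if p dvd n \<and> q dvd n then 1 else 0)
           \<le> x * (1 / p * (1 / q)) + (if p = q then x / p else 0)" .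
      qed
      also have "\<dots> = (\<Sum>p\<in>B. \<Sum>q\<in>B. x * (1 / p * (1 / q))) + (\<Sum>p\<in>B. \<Sum>q\<in>B. if p = q then x / p else 0)"
        by (simp add: sum.distrib)
      also have "(\<Sum>p\<in>B. \<Sum>q\<in>B. if p = q then x / p else 0) = (\<Sum>p\<in>B. x / p)"
        using B(1) by (intro sum.cong refl) (simp add: sum.delta')
      also have "\<dots> = x * L" by (simp add: L_def sum_distrib_left)
      also have "(\<Sum>p\<in>B. \<Sum>q\<in>B. x * (1 / p * (1 / q))) = x * (L * L)"
        unfolding L_def sum_product by (simp add: sum_distrib_left)
      finally show ?thesis by (simp add: algebra_simps power2_eq_square)
    qed
    have "(\<Sum>n\<in>ints x. (L - w n)\<^sup>2) = L\<^sup>2 * card (ints x) - 2 * L * (\<Sum>n\<in>ints x. w n) + (\<Sum>n\<in>ints x. (w n)\<^sup>2)"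
      by (simp add: power2_diff sum.distrib sum_subtractf sum_distrib_left mult_ac)
    also have "\<dots> \<le> L\<^sup>2 * x - 2 * L * (x * L - card B) + x * (L\<^sup>2 + L)"
      using sw sw2 L0 card_ints_le[of x] x by (intro add_mono diff_mono mult_left_mono) auto
    also have "\<dots> = x * (L + 2 * L * card B / x)" using x by (simp add: field_simps power2_eq_square)
    finally have v: "(\<Sum>n\<in>ints x. (L - w n)\<^sup>2) \<le> x * (L + 2 * L * card B / x)" .
    have "(\<Sum>n\<in>ints x. \<bar>L - w n\<bar>)\<^sup>2 \<le> (\<Sum>n\<in>ints x. \<bar>L - w n\<bar>\<^sup>2) * (\<Sum>n\<in>ints x. 1\<^sup>2)"
      using Cauchy_Schwarz_ineq_sum[of "\<lambda>n. \<bar>L - w n\<bar>" "\<lambda>_. 1" "ints x"] by simp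
    also have "\<dots> = (\<Sum>n\<in>ints x. (L - w n)\<^sup>2) * card (ints x)" by simp
    also have "\<dots> \<le> (x * (L + 2 * L * card B / x)) * x"
      using v card_ints_le[of x] x L0 by (intro mult_mono) auto
    also have "\<dots> = (x * sqrt (L + 2 * L * card B / x))\<^sup>2"
      using x L0 by (simp add: power_mult_distrib power2_eq_square)
    finally have sq: "(\<Sum>n\<in>ints x. \<bar>L - w n\<bar>)\<^sup>2 \<le> (x * sqrt (L + 2 * L * card B / x))\<^sup>2" .
    show ?thesis by (rule power2_le_imp_le[OF sq]) (use x L0 in simp)
  qed
  then have "(\<Sum>n\<in>ints x. \<bar>L - w n\<bar>) * nrm F / x \<le> x * sqrt (L + 2 * L * card B / x) * nrm F / x"
    using x F by (intro divide_right_mono mult_right_mono) auto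
  also have "\<dots> = sqrt (L + 2 * L * card B / x) * nrm F" using x by simp
  finally show ?thesis using 2 by linarith
qed

end

section \<open>Near-extremal averages\<close>

context mult_isometries
begin

text \<open>The identity \<open>L\<^sup>2 g(x) \<approx> \<Sum> c\<^sub>m u\<^sub>m\<close> exhibits \<open>g(x)\<close> as a weighted mean of the vectors
  \<open>u\<^sub>m = U\<^sub>m g(x/m)\<close>, almost all of which have norm at most \<open>a + \<epsilon>\<close>; if \<open>g(x)\<close> itself has norm at
  least \<open>a - \<epsilon>\<close>, then by strict convexity most of them are close to \<open>g(x)\<close>.\<close>

lemma near_extremal_selb:
  fixes a \<theta> X :: real
  assumes F: "F \<in> V" and a: "a \<ge> 0" and \<theta>: "\<theta> > 0"
    and up: "\<And>\<epsilon>. \<epsilon> > 0 \<Longrightarrow> \<exists>Y. \<forall>y\<ge>Y. nrm (avg F y) \<le> a + \<epsilon>"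
    and lo: "\<And>\<epsilon> Y. \<epsilon> > 0 \<Longrightarrow> \<exists>y\<ge>Y. nrm (avg F y) \<ge> a - \<epsilon>"
  shows "\<exists>x\<ge>X. nrm (avg F x) \<ge> a - \<theta> \<and>
    (\<Sum>m\<in>ints x. selb m / m * (nrm (U m (avg F (x / m)) - avg F x))\<^sup>2) \<le> \<theta> * (ln x)\<^sup>2"
proof -
  define f0 where "f0 = nrm F"
  have f0: "f0 \<ge> 0" using F by (simp add: f0_def)
  obtain K where K: "K \<ge> 0" "\<And>x. x \<ge> 1 \<Longrightarrow> (\<Sum>m\<in>ints x. selb m / m) \<le> (ln x)\<^sup>2 + K * (1 + ln x)"
    using sum_selb_div_le by blast
  obtain K' where K': "K' \<ge> 0" "\<And>x. x \<ge> 1 \<Longrightarrow> (\<Sum>m\<in>ints x. selb m) \<le> K' * x * (1 + ln x)"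
    using sum_selb_le by blast
  \<comment> \<open>\<open>(4 * a + 1) * \<epsilon>\<close> bounds
    \<open>(a + \<epsilon>)\<^sup>2 - (nrm w)\<^sup>2\<close> below; the other half of
    \<open>\<theta>\<close> is kept for the terms of lower order.\<close>
  define \<epsilon> where "\<epsilon> = min 1 (min \<theta> (\<theta> / (2 * (4 * a + 1))))"
  have \<epsilon>: "\<epsilon> > 0" "\<epsilon> \<le> 1" "\<epsilon> \<le> \<theta>" "(4 * a + 1) * \<epsilon> \<le> \<theta> / 2"
  proof -
    have "\<epsilon> \<le> \<theta> / (2 * (4 * a + 1))" by (simp add: \<epsilon>_def)
    then have "\<epsilon> * (2 * (4 * a + 1)) \<le> \<theta>" using a by (simp add: pos_le_divide_eq)
    then show "(4 * a + 1) * \<epsilon> \<le> \<theta> / 2" by (simp add: algebra_simps)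
  qed (use \<theta> a in \<open>auto simp: \<epsilon>_def\<close>)
  obtain Y0 where Y0: "\<And>y. y \<ge> Y0 \<Longrightarrow> nrm (avg F y) \<le> a + \<epsilon>" using up[OF \<epsilon>(1)] by blast
  define Y where "Y = max 1 Y0"
  have Y: "Y \<ge> 1" "\<And>y. y \<ge> Y \<Longrightarrow> nrm (avg F y) \<le> a + \<epsilon>" using Y0 by (auto simp: Y_def)
  \<comment> \<open>Collects the coefficients of all terms that grow only like \<open>L\<close>; the
    lower bound \<open>4 * B / \<theta>\<close> for \<open>L\<close> makes them negligible against
    \<open>L\<^sup>2\<close>.\<close>
  define B where "B = K * (a + 1)\<^sup>2 + f0\<^sup>2 * Y * K' + 4 * f0\<^sup>2 + K * f0\<^sup>2"
  have B: "B \<ge> 0" unfolding B_def using K K' Y by (intro add_nonneg_nonneg mult_nonneg_nonneg) auto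
  obtain x where x: "x \<ge> max X (max (exp 1) (exp (4 * B / \<theta>)))" "nrm (avg F x) \<ge> a - \<epsilon>"
    using lo[OF \<epsilon>(1)] by blast
  have x1: "x \<ge> exp 1" "x \<ge> exp (4 * B / \<theta>)" "x \<ge> X" using x(1) by auto
  then have xpos: "x \<ge> 1" using one_le_exp_iff[of 1] by linarith
  define L where "L = ln x"
  have L: "L \<ge> 1" "L \<ge> 4 * B / \<theta>" using x1 xpos by (auto simp: L_def ln_ge_iff)
  define w where "w = avg F x"
  define u where "u m = U m (avg F (x / m))" for m
  define c where "c m = selb m / m" for m :: nat
  have c0: "c m \<ge> 0" for m using selb_nonneg by (simp add: c_def)
  have wV: "w \<in> V" using F by (simp add: w_def)
  have uV: "u m \<in> V" if "m \<in> ints x" for m using F that by (auto simp: u_def in_ints)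
  have wf0: "nrm w \<le> f0" using nrm_avg_le[OF F, of x] xpos by (simp add: w_def f0_def)
  have cuV: "(\<Sum>m\<in>ints x. c m *\<^sub>R u m) \<in> V" using uV by (intro V_sum) auto
  define D where "D = L\<^sup>2 *\<^sub>R w - (\<Sum>m\<in>ints x. c m *\<^sub>R u m)"
  have DV: "D \<in> V" using cuV wV by (simp add: D_def)
  have cu: "(\<Sum>m\<in>ints x. c m *\<^sub>R u m) = (1 / x) *\<^sub>R (\<Sum>n\<in>ints x. (ln (real n))\<^sup>2 *\<^sub>R U n F)"
  proof -
    have "(\<Sum>m\<in>ints x. c m *\<^sub>R u m) = (\<Sum>m\<in>ints x. (1 / x) *\<^sub>R selb m *\<^sub>R U m (psum F (x / m)))"
      using F xpos by (intro sum.cong) (auto simp: c_def u_def avg_def in_ints U_scale)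
    also have "\<dots> = (1 / x) *\<^sub>R (\<Sum>m\<in>ints x. selb m *\<^sub>R U m (psum F (x / m)))"
      by (rule scaleR_right.sum[symmetric])
    finally show ?thesis by (simp only: sum_selb_psum[OF F])
  qed
  \<comment> \<open>\<open>D\<close> averages the vectors \<open>U n F\<close> with coefficients
    \<open>L\<^sup>2 - (ln n)\<^sup>2 \<le> 2 * L * ln (x / n)\<close>, and
    \<open>ln (x / n)\<close> has mean at most 1.\<close>
  have nD: "nrm D \<le> 2 * L * f0"
  proof -
    have "L\<^sup>2 *\<^sub>R w = (1 / x) *\<^sub>R (\<Sum>n\<in>ints x. L\<^sup>2 *\<^sub>R U n F)"
      by (simp add: w_def avg_def psum_def scaleR_right.sum)
    then have "D = (1 / x) *\<^sub>R (\<Sum>n\<in>ints x. (L\<^sup>2 - (ln (real n))\<^sup>2) *\<^sub>R U n F)"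
      by (simp add: D_def cu scaleR_diff_right[symmetric] sum_subtractf[symmetric] scaleR_diff_left)
    moreover have "(\<Sum>n\<in>ints x. (L\<^sup>2 - (ln (real n))\<^sup>2) *\<^sub>R U n F) \<in> V"
      using F by (intro V_sum) (auto simp: in_ints)
    ultimately have "nrm D = nrm (\<Sum>n\<in>ints x. (L\<^sup>2 - (ln (real n))\<^sup>2) *\<^sub>R U n F) / x"
      using xpos by (simp add: nrm_scale)
    also have "\<dots> \<le> (\<Sum>n\<in>ints x. \<bar>L\<^sup>2 - (ln (real n))\<^sup>2\<bar>) * f0 / x"
      using F xpos by (intro divide_right_mono nrm_sum_scale_le) (auto simp: in_ints f0_def)
    also have "\<dots> \<le> (\<Sum>n\<in>ints x. 2 * L * ln (x / n)) * f0 / x"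
    proof (intro divide_right_mono mult_right_mono sum_mono f0)
      fix n assume "n \<in> ints x"
      then have n: "0 < n" "real n \<le> x" by (auto simp: in_ints)
      then have l: "0 \<le> ln (real n)" "ln (real n) \<le> L" using xpos by (auto simp: L_def)
      then have "\<bar>L\<^sup>2 - (ln (real n))\<^sup>2\<bar> = (L + ln (real n)) * (L - ln (real n))"
        by (simp add: power2_eq_square algebra_simps abs_of_nonneg mult_mono)
      also have "\<dots> \<le> (2 * L) * (L - ln (real n))" using l by (intro mult_right_mono) auto
      also have "L - ln (real n) = ln (x / n)" using n xpos by (simp add: L_def ln_div)
      finally show "\<bar>L\<^sup>2 - (ln (real n))\<^sup>2\<bar> \<le> 2 * L * ln (x / n)" .
    qed (use xpos in auto)
    also have "\<dots> = 2 * L * f0 / x * (\<Sum>n\<in>ints x. ln (x / n))" by (simp add: sum_distrib_left[symmetric])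
    also have "\<dots> \<le> 2 * L * f0 / x * x" using sum_ln_ratio_le[OF xpos] L f0 xpos
      by (intro mult_left_mono) auto
    also have "\<dots> = 2 * L * f0" using xpos by simp
    finally show ?thesis .
  qed
  have csum: "(\<Sum>m\<in>ints x. c m) \<le> L\<^sup>2 + K * (1 + L)" using K(2)[OF xpos] by (simp add: c_def L_def)
  \<comment> \<open>Expanding the squares leaves essentially \<open>L\<^sup>2\<close> times
    \<open>(a + \<epsilon>)\<^sup>2 - 2 * (nrm w)\<^sup>2 + (nrm w)\<^sup>2\<close>, which is small
    as \<open>nrm w\<close> is almost \<open>a\<close>.\<close>
  have "(\<Sum>m\<in>ints x. c m * (nrm (u m - w))\<^sup>2) = (\<Sum>m\<in>ints x. c m * (nrm (u m))\<^sup>2 - 2 * ip (c m *\<^sub>R u m) w + c m * (nrm w)\<^sup>2)"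
    using uV wV by (intro sum.cong refl) (simp add: nrm_square_diff ip_scale_left algebra_simps)
  also have "\<dots> = (\<Sum>m\<in>ints x. c m * (nrm (u m))\<^sup>2) - 2 * ip (\<Sum>m\<in>ints x. c m *\<^sub>R u m) w + (\<Sum>m\<in>ints x. c m) * (nrm w)\<^sup>2"
    using uV wV by (subst ip_sum_left) (auto simp: sum.distrib sum_subtractf sum_distrib_left sum_distrib_right)
  also have "(\<Sum>m\<in>ints x. c m *\<^sub>R u m) = L\<^sup>2 *\<^sub>R w - D" by (simp add: D_def)
  also have "ip (L\<^sup>2 *\<^sub>R w - D) w = L\<^sup>2 * (nrm w)\<^sup>2 - ip D w"
    using wV DV by (simp add: ip_diff_left ip_scale_left nrm_square)
  also have "(\<Sum>m\<in>ints x. c m * (nrm (u m))\<^sup>2) - 2 * (L\<^sup>2 * (nrm w)\<^sup>2 - ip D w) + (\<Sum>m\<in>ints x. c m) * (nrm w)\<^sup>2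
     \<le> ((L\<^sup>2 + K * (1 + L)) * (a + \<epsilon>)\<^sup>2 + f0\<^sup>2 * (Y * K' * (1 + L))) - 2 * (L\<^sup>2 * (nrm w)\<^sup>2 - 2 * L * f0\<^sup>2) + (L\<^sup>2 + K * (1 + L)) * (nrm w)\<^sup>2"
  proof (intro add_mono diff_mono mult_left_mono mult_right_mono csum)
    have "ip D w \<le> nrm D * nrm w" using Cauchy_Schwarz[OF DV wV] by simp
    also have "\<dots> \<le> 2 * L * f0 * f0" using nD wf0 wV L f0 by (intro mult_mono) auto
    finally show "ip D w \<le> 2 * L * f0\<^sup>2" by (simp add: power2_eq_square)
    \<comment> \<open>For \<open>x / m < Y\<close> only the trivial bound \<open>f0\<close> is
      available; there \<open>1 / m \<le> Y / x\<close>, so these \<open>m\<close> have total weight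
      O(L) only.\<close>
    have "(\<Sum>m\<in>ints x. c m * (nrm (u m))\<^sup>2) \<le> (\<Sum>m\<in>ints x. c m * (a + \<epsilon>)\<^sup>2 + f0\<^sup>2 * (Y / x * selb m))"
    proof (rule sum_mono)
      fix m assume m: "m \<in> ints x"
      then have m0: "m > 0" and xm: "x / m > 0" using xpos by (auto simp: in_ints)
      have nu: "nrm (u m) = nrm (avg F (x / m))" using m0 F by (simp add: u_def)
      show "c m * (nrm (u m))\<^sup>2 \<le> c m * (a + \<epsilon>)\<^sup>2 + f0\<^sup>2 * (Y / x * selb m)"
      proof (cases "x / m \<ge> Y")
        case True
        then have "(nrm (u m))\<^sup>2 \<le> (a + \<epsilon>)\<^sup>2" unfolding nu using Y(2) F by (intro power_mono) auto
        moreover have "0 \<le> f0\<^sup>2 * (Y / x * selb m)" using Y xpos selb_nonneg by auto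
        ultimately show ?thesis using mult_left_mono[OF _ c0[of m]] by (smt (verit))
      next
        case False
        have "(nrm (u m))\<^sup>2 \<le> f0\<^sup>2" unfolding nu using nrm_avg_le[OF F xm] F by (auto simp: f0_def intro!: power_mono)
        then have "c m * (nrm (u m))\<^sup>2 \<le> c m * f0\<^sup>2" using c0 by (rule mult_left_mono)
        also have "\<dots> \<le> (Y / x * selb m) * f0\<^sup>2"
        proof (intro mult_right_mono)
          have "1 / m \<le> Y / x" using False xpos m0 by (simp add: field_simps)
          then show "c m \<le> Y / x * selb m" using selb_nonneg[of m] mult_right_mono[of "1 / m" "Y / x" "selb m"]
            by (simp add: c_def)
        qed auto
        finally show ?thesis using c0[of m] by (simp add: mult.commute add_increasing)
      qed
    qed
    also have "\<dots> = (\<Sum>m\<in>ints x. c m) * (a + \<epsilon>)\<^sup>2 + f0\<^sup>2 * (Y / x * (\<Sum>m\<in>ints x. selb m))"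
      by (simp add: sum.distrib sum_distrib_left sum_distrib_right)
    also have "\<dots> \<le> (L\<^sup>2 + K * (1 + L)) * (a + \<epsilon>)\<^sup>2 + f0\<^sup>2 * (Y / x * (K' * x * (1 + L)))"
      using K'(2)[OF xpos] Y xpos csum by (intro add_mono mult_left_mono mult_right_mono) (auto simp: L_def)
    also have "Y / x * (K' * x * (1 + L)) = Y * K' * (1 + L)" using xpos by simp
    finally show "(\<Sum>m\<in>ints x. c m * (nrm (u m))\<^sup>2) \<le> (L\<^sup>2 + K * (1 + L)) * (a + \<epsilon>)\<^sup>2 + f0\<^sup>2 * (Y * K' * (1 + L))" .
  qed auto
  also have "\<dots> = L\<^sup>2 * ((a + \<epsilon>)\<^sup>2 - (nrm w)\<^sup>2) + (K * (1 + L) * (a + \<epsilon>)\<^sup>2 + f0\<^sup>2 * (Y * K' * (1 + L)) + 4 * L * f0\<^sup>2 + K * (1 + L) * (nrm w)\<^sup>2)"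
    by (simp add: algebra_simps)
  also have "\<dots> \<le> L\<^sup>2 * (\<theta> / 2) + (K * (1 + L) * (a + 1)\<^sup>2 + f0\<^sup>2 * (Y * K' * (1 + L)) + 4 * (1 + L) * f0\<^sup>2 + K * (1 + L) * f0\<^sup>2)"
  proof (intro add_mono mult_left_mono)
    have "(nrm w)\<^sup>2 \<ge> a\<^sup>2 - 2 * a * \<epsilon>"
    proof (cases "a \<ge> \<epsilon>")
      case True
      then have "(nrm w)\<^sup>2 \<ge> (a - \<epsilon>)\<^sup>2" using x(2) by (intro power_mono) (auto simp: w_def)
      moreover have "(a - \<epsilon>)\<^sup>2 = a\<^sup>2 - 2 * a * \<epsilon> + \<epsilon>\<^sup>2" by (simp add: power2_eq_square algebra_simps)
      ultimately show ?thesis using zero_le_power2[of \<epsilon>] by linarith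
    next
      case False
      then have "a * (a - 2 * \<epsilon>) \<le> 0" using a \<epsilon> by (intro mult_nonneg_nonpos) auto
      then have "a\<^sup>2 - 2 * a * \<epsilon> \<le> 0" by (simp add: power2_eq_square algebra_simps)
      then show ?thesis using zero_le_power2[of "nrm w"] by linarith
    qed
    moreover have "\<epsilon>\<^sup>2 \<le> \<epsilon>" using \<epsilon> by (simp add: power2_eq_square mult_left_le)
    ultimately have "(a + \<epsilon>)\<^sup>2 - (nrm w)\<^sup>2 \<le> (4 * a + 1) * \<epsilon>" by (simp add: power2_sum algebra_simps)
    then show "(a + \<epsilon>)\<^sup>2 - (nrm w)\<^sup>2 \<le> \<theta> / 2" using \<epsilon>(4) by linarith
  qed (use \<epsilon> a K(1) K'(1) Y(1) L wf0 wV in \<open>auto intro!: power_mono mult_nonneg_nonneg mult_right_mono\<close>)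
  also have "\<dots> = L\<^sup>2 * (\<theta> / 2) + B * (1 + L)" by (simp add: B_def algebra_simps)
  also have "\<dots> \<le> L\<^sup>2 * (\<theta> / 2) + L\<^sup>2 * (\<theta> / 2)"
  proof (intro add_left_mono)
    have "B * (1 + L) \<le> B * (2 * L)" using B L by (intro mult_left_mono) auto
    also have "\<dots> \<le> (L * \<theta> / 4) * (2 * L)" using L \<theta> by (intro mult_right_mono) (auto simp: field_simps)
    finally show "B * (1 + L) \<le> L\<^sup>2 * (\<theta> / 2)" by (simp add: power2_eq_square)
  qed
  finally have "(\<Sum>m\<in>ints x. c m * (nrm (u m - w))\<^sup>2) \<le> \<theta> * (ln x)\<^sup>2" by (simp add: L_def mult.commute)
  moreover have "nrm (avg F x) \<ge> a - \<theta>" using x(2) \<epsilon>(3) by linarith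
  ultimately show ?thesis using x1(3) unfolding c_def u_def w_def by blast
qed

text \<open>A pigeonhole argument over blocks of \<open>J\<close> consecutive cells of logarithmic
  length \<open>\<delta>\<close>. If every block had a cell without a suitable \<open>m\<close>,
  these cells would carry mass at least \<open>u\<^sup>2 / (128 * J)\<close> with
  \<open>u = ln x\<close>. But the unsuitable \<open>m\<close> are either not squarefree, with mass
  O(u), or deviate by more than \<open>\<eta>\<close>, and Chebyshev's inequality with
  \<open>near_extremal_selb\<close> bounds the mass of the latter.\<close>

lemma good_block:
  fixes a \<delta> \<eta> X :: real and J :: nat
  assumes F: "F \<in> V" and a: "a \<ge> 0" and \<delta>: "0 < \<delta>" "\<delta> \<le> 1" and \<eta>: "\<eta> > 0" and J: "J > 0"
    and up: "\<And>\<epsilon>. \<epsilon> > 0 \<Longrightarrow> \<exists>Y. \<forall>y\<ge>Y. nrm (avg F y) \<le> a + \<epsilon>"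
    and lo: "\<And>\<epsilon> Y. \<epsilon> > 0 \<Longrightarrow> \<exists>y\<ge>Y. nrm (avg F y) \<ge> a - \<epsilon>"
  shows "\<exists>x\<ge>X. \<exists>j0::nat. x \<ge> 1 \<and> nrm (avg F x) \<ge> a - \<eta> \<and> exp ((real j0 + J) * \<delta>) \<le> sqrt x \<and>
     (\<forall>i<J. \<exists>m. squarefree m \<and> selb m \<noteq> 0 \<and> exp ((real j0 + i) * \<delta>) < m \<and> m \<le> exp ((real j0 + i + 1) * \<delta>) \<and>
        nrm (U m (avg F (x / m)) - avg F x) \<le> \<eta>)"
proof -
  obtain C1 where C1: "C1 \<ge> 0" "\<And>y \<delta>. y \<ge> 1 \<Longrightarrow> 0 < \<delta> \<Longrightarrow> \<delta> \<le> 1 \<Longrightarrow>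
    (\<Sum>m\<in>ints (exp \<delta> * y) - ints y. selb m / m) \<ge> \<delta> * ln y - C1"
    using selb_cell_ge by blast
  obtain C2 where C2: "C2 \<ge> 0" "\<And>x. x \<ge> 1 \<Longrightarrow> (\<Sum>m\<in>{m\<in>ints x. \<not> squarefree m}. selb m / m) \<le> C2 * ln x"
    using sum_selb_not_squarefree_le by blast
  \<comment> \<open>Chebyshev's inequality then gives deviation mass at most
    \<open>u\<^sup>2 / (512 * J)\<close>, a quarter of the mass of one cell per block.\<close>
  define \<theta> where "\<theta> = min \<eta> (\<eta>\<^sup>2 / (512 * J))"
  have \<theta>: "\<theta> > 0" "\<theta> \<le> \<eta>" "\<theta> \<le> \<eta>\<^sup>2 / (512 * J)" using \<eta> J by (auto simp: \<theta>_def)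
  \<comment> \<open>In this order: all cells start at logarithmic height at least
    \<open>u / 8\<close>; \<open>C1\<close> takes at most half of a cell's mass; rounding takes at
    most half of the number of blocks; \<open>(C2 + 1) * u\<close> is at most
    \<open>u\<^sup>2 / (512 * J)\<close>.\<close>
  define u0 where "u0 = Max {8, 16 * C1 / \<delta>, 16 * \<delta> * J, 512 * J * (C2 + 1)}"
  obtain x where x: "x \<ge> max X (exp u0)" "nrm (avg F x) \<ge> a - \<theta>"
    "(\<Sum>m\<in>ints x. selb m / m * (nrm (U m (avg F (x / m)) - avg F x))\<^sup>2) \<le> \<theta> * (ln x)\<^sup>2"
    using near_extremal_selb[OF F a \<theta>(1) up lo] by blast
  define u where "u = ln x"
  have "u0 \<ge> 8" by (simp add: u0_def)
  then have x1: "x \<ge> 1" using x(1) one_le_exp_iff[of u0] by linarith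
  then have "u \<ge> u0" using x(1) by (simp add: u_def ln_ge_iff)
  then have u: "u \<ge> 8" "u \<ge> 16 * C1 / \<delta>" "u \<ge> 16 * \<delta> * J" "u \<ge> 512 * J * (C2 + 1)"
    by (auto simp: u0_def)
  have xu: "x = exp u" using x1 by (simp add: u_def)
  \<comment> \<open>The cells with index from \<open>n\<close> to \<open>2 * n - 1\<close> fill the
    logarithmic range from about \<open>u / 4\<close> to \<open>u / 2\<close>. So
    \<open>m \<le> sqrt x\<close>, and \<open>x / m\<close> remains large.\<close>
  define n where "n = nat \<lfloor>u / (4 * \<delta>)\<rfloor>"
  have n: "real n \<le> u / (4 * \<delta>)" "real n > u / (4 * \<delta>) - 1"
    using u \<delta> unfolding n_def by (auto simp: of_nat_nat)
  define nb where "nb = n div J"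
  have nb: "nb * J \<le> n" by (simp add: nb_def)
  have nb2: "real nb \<ge> u / (8 * \<delta> * J)"
  proof -
    have "n < (nb + 1) * J" using J by (simp add: nb_def dividend_less_div_times)
    then have "real n + 1 \<le> (real nb + 1) * J"
      by (metis Suc_leI of_nat_1 of_nat_Suc of_nat_add of_nat_le_iff of_nat_mult add.commute)
    then have "u / (4 * \<delta>) \<le> (real nb + 1) * J" using n by linarith
    then have "u / (4 * \<delta>) / J \<le> (real nb + 1) * J / J" by (rule divide_right_mono) simp
    then have "u / (4 * \<delta>) / J \<le> real nb + 1" using J by simp
    moreover have "u / (8 * \<delta> * J) \<ge> 1" using u \<delta> J by (simp add: field_simps)
    moreover have "u / (4 * \<delta>) / J = 2 * (u / (8 * \<delta> * J))" using \<delta> J by (simp add: field_simps)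
    ultimately show ?thesis by linarith
  qed
  define good where "good m \<longleftrightarrow> squarefree m \<and> selb m \<noteq> 0 \<and> nrm (U m (avg F (x / m)) - avg F x) \<le> \<eta>" for m
  define cell where "cell j = ints (exp \<delta> * exp (real j * \<delta>)) - ints (exp (real j * \<delta>))" for j
  have cell: "m \<in> cell j \<longleftrightarrow> exp (real j * \<delta>) < m \<and> m \<le> exp ((real j + 1) * \<delta>)" for m j
  proof -
    have "exp \<delta> * exp (real j * \<delta>) = exp ((real j + 1) * \<delta>)" by (simp add: exp_add[symmetric] algebra_simps)
    moreover have "exp (real j * \<delta>) < m \<Longrightarrow> 0 < m" by (smt (verit) exp_gt_zero of_nat_0_less_iff)
    ultimately show ?thesis by (auto simp: cell_def in_ints)
  qed
  have jn: "(2 * real n) * \<delta> \<le> u / 2" using n(1) \<delta> by (simp add: field_simps)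
  have sq: "exp ((2 * real n) * \<delta>) \<le> sqrt x"
  proof -
    have "exp ((2 * real n) * \<delta>) \<le> exp (u / 2)" using jn by simp
    moreover have "(exp (u / 2))\<^sup>2 = x" by (simp add: xu power2_eq_square flip: exp_add)
    then have "exp (u / 2) = sqrt x" by (metis real_sqrt_unique exp_ge_zero)
    ultimately show ?thesis by simp
  qed
  have sqx: "sqrt x \<le> x" using x1 by (intro real_le_lsqrt) (auto simp: power2_eq_square mult_le_cancel_left1)
  have cell_sub: "cell j \<subseteq> ints x" if "j + 1 \<le> 2 * n" for j
  proof
    fix m assume "m \<in> cell j"
    then have m: "exp (real j * \<delta>) < m" "m \<le> exp ((real j + 1) * \<delta>)" by (auto simp: cell)
    have "(real j + 1) * \<delta> \<le> (2 * real n) * \<delta>" using that \<delta> by (intro mult_right_mono) auto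
    then have "exp ((real j + 1) * \<delta>) \<le> exp ((2 * real n) * \<delta>)" by simp
    then have "m \<le> x" using m sq sqx by linarith
    moreover have "0 < m" using m(1) by (smt (verit) exp_gt_zero of_nat_0_less_iff)
    ultimately show "m \<in> ints x" by (simp add: in_ints)
  qed
  have cell_mass: "(\<Sum>m\<in>cell j. selb m / m) \<ge> \<delta> * u / 16" if "j \<ge> n" for j
  proof -
    have "real j * \<delta> \<ge> real n * \<delta>" using that \<delta> by (intro mult_right_mono) auto
    moreover have "real n * \<delta> \<ge> (u / (4 * \<delta>) - 1) * \<delta>" using n(2) \<delta> by (intro mult_right_mono) auto
    moreover have "(u / (4 * \<delta>) - 1) * \<delta> = u / 4 - \<delta>" using \<delta> by (simp add: field_simps)
    ultimately have "real j * \<delta> \<ge> u / 8" using u(1) \<delta> by linarith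
    then have "\<delta> * (real j * \<delta>) \<ge> \<delta> * (u / 8)" using \<delta> by (intro mult_left_mono) auto
    moreover have "C1 \<le> \<delta> * u / 16" using u(2) \<delta> by (simp add: field_simps)
    moreover have "(\<Sum>m\<in>cell j. selb m / m) \<ge> \<delta> * ln (exp (real j * \<delta>)) - C1"
      unfolding cell_def using \<delta> by (intro C1(2)) auto
    ultimately show ?thesis by simp
  qed
  have "\<exists>b<nb. \<forall>i<J. \<exists>m\<in>cell (n + b * J + i). good m"
  proof (rule ccontr)
    assume "\<not> ?thesis"
    then have "\<forall>b. \<exists>i. b < nb \<longrightarrow> i < J \<and> (\<forall>m\<in>cell (n + b * J + i). \<not> good m)" by blast
    then obtain i where i: "\<And>b. b < nb \<Longrightarrow> i b < J" "\<And>b m. b < nb \<Longrightarrow> m \<in> cell (n + b * J + i b) \<Longrightarrow> \<not> good m"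
      by metis
    define f where "f b = n + b * J + i b" for b
    have fle: "f b + 1 \<le> 2 * n" if "b < nb" for b
    proof -
      have "f b + 1 \<le> n + (b + 1) * J" using i(1)[OF that] by (simp add: f_def)
      also have "\<dots> \<le> n + nb * J" using that by (intro add_left_mono mult_right_mono) auto
      finally show ?thesis using nb by simp
    qed
    have disj: "cell (f b) \<inter> cell (f b') = {}" if "b < b'" "b' < nb" for b b'
    proof -
      have "f b + 1 \<le> n + (b + 1) * J" using i(1)[of b] that by (simp add: f_def)
      also have "\<dots> \<le> n + b' * J" using that by (intro add_left_mono mult_right_mono) auto
      also have "\<dots> \<le> f b'" by (simp add: f_def)
      finally have "(real (f b) + 1) * \<delta> \<le> real (f b') * \<delta>" using \<delta> by (intro mult_right_mono) auto
      then have le: "exp ((real (f b) + 1) * \<delta>) \<le> exp (real (f b') * \<delta>)" by simp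
      show ?thesis
      proof (rule equals0I)
        fix m assume "m \<in> cell (f b) \<inter> cell (f b')"
        then show False using le unfolding Int_iff cell by linarith
      qed
    qed
    define Bad where "Bad = {m\<in>ints x. \<not> good m}"
    have "nb * (\<delta> * u / 16) = (\<Sum>b<nb. \<delta> * u / 16)" by simp
    also have "\<dots> \<le> (\<Sum>b<nb. \<Sum>m\<in>cell (f b). selb m / m)"
      by (intro sum_mono cell_mass) (simp add: f_def)
    also have "\<dots> = (\<Sum>m\<in>(\<Union>b\<in>{..<nb}. cell (f b)). selb m / m)"
    proof (rule sum.UNION_disjoint[symmetric])
      show "\<forall>b\<in>{..<nb}. \<forall>b'\<in>{..<nb}. b \<noteq> b' \<longrightarrow> cell (f b) \<inter> cell (f b') = {}"
        using disj by (metis inf_commute lessThan_iff linorder_neqE_nat)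
    qed (auto simp: cell_def)
    also have "\<dots> \<le> (\<Sum>m\<in>Bad. selb m / m)"
    proof (rule sum_mono2)
      show "(\<Union>b\<in>{..<nb}. cell (f b)) \<subseteq> Bad"
        using cell_sub[OF fle] i(2) by (auto simp: Bad_def f_def)
    qed (auto simp: Bad_def selb_nonneg)
    also have "\<dots> \<le> (\<Sum>m\<in>Bad. (if \<not> squarefree m then selb m / m else 0) + (selb m / m * (nrm (U m (avg F (x / m)) - avg F x))\<^sup>2) / \<eta>\<^sup>2)"
    proof (rule sum_mono)
      fix m assume m: "m \<in> Bad"
      have nn: "0 \<le> selb m / m" using selb_nonneg by simp
      show "selb m / m \<le> (if \<not> squarefree m then selb m / m else 0) + (selb m / m * (nrm (U m (avg F (x / m)) - avg F x))\<^sup>2) / \<eta>\<^sup>2"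
      proof (cases "squarefree m \<and> selb m \<noteq> 0")
        case True
        then have "\<eta> < nrm (U m (avg F (x / m)) - avg F x)" using m by (auto simp: Bad_def good_def)
        then have "\<eta>\<^sup>2 \<le> (nrm (U m (avg F (x / m)) - avg F x))\<^sup>2" using \<eta> by (intro power_mono) auto
        then have "selb m / m * \<eta>\<^sup>2 \<le> selb m / m * (nrm (U m (avg F (x / m)) - avg F x))\<^sup>2"
          using nn by (rule mult_left_mono)
        then have "selb m / m * \<eta>\<^sup>2 / \<eta>\<^sup>2 \<le> (selb m / m * (nrm (U m (avg F (x / m)) - avg F x))\<^sup>2) / \<eta>\<^sup>2"
          by (rule divide_right_mono) simp
        moreover have "selb m / m * \<eta>\<^sup>2 / \<eta>\<^sup>2 = selb m / m" using \<eta> by simp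
        moreover have "0 \<le> (if \<not> squarefree m then selb m / m else 0)" using nn by simp
        ultimately show ?thesis by linarith
      next
        case False
        have "0 \<le> (selb m / m * (nrm (U m (avg F (x / m)) - avg F x))\<^sup>2) / \<eta>\<^sup>2" by (simp add: selb_nonneg)
        then show ?thesis using False by auto
      qed
    qed
    also have "\<dots> \<le> (\<Sum>m\<in>ints x. (if \<not> squarefree m then selb m / m else 0) + (selb m / m * (nrm (U m (avg F (x / m)) - avg F x))\<^sup>2) / \<eta>\<^sup>2)"
      by (rule sum_mono2) (auto simp: Bad_def selb_nonneg)
    also have "\<dots> = (\<Sum>m\<in>{m\<in>ints x. \<not> squarefree m}. selb m / m) + (\<Sum>m\<in>ints x. selb m / m * (nrm (U m (avg F (x / m)) - avg F x))\<^sup>2) / \<eta>\<^sup>2"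
      by (simp add: sum.distrib sum.inter_filter sum_divide_distrib)
    also have "\<dots> \<le> C2 * u + \<theta> * u\<^sup>2 / \<eta>\<^sup>2"
      using C2(2)[OF x1] x(3) by (intro add_mono divide_right_mono) (auto simp: u_def)
    also have "\<theta> * u\<^sup>2 / \<eta>\<^sup>2 \<le> (\<eta>\<^sup>2 / (512 * J)) * u\<^sup>2 / \<eta>\<^sup>2"
      using \<theta>(3) by (intro divide_right_mono mult_right_mono) auto
    also have "\<dots> = u\<^sup>2 / (512 * J)" using \<eta> by simp
    finally have 1: "nb * (\<delta> * u / 16) \<le> C2 * u + u\<^sup>2 / (512 * J)" by simp
    have "u\<^sup>2 / (128 * J) = u / (8 * \<delta> * J) * (\<delta> * u / 16)" using \<delta> J by (simp add: field_simps power2_eq_square)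
    also have "\<dots> \<le> nb * (\<delta> * u / 16)" using nb2 u \<delta> by (intro mult_right_mono) auto
    also note 1
    finally have "u\<^sup>2 / (128 * J) - u\<^sup>2 / (512 * J) \<le> C2 * u" by simp
    moreover have "u\<^sup>2 / (128 * J) = 4 * (u\<^sup>2 / (512 * J))" by simp
    ultimately have "u\<^sup>2 / (512 * J) * 3 \<le> C2 * u" by linarith
    moreover have "u\<^sup>2 / (512 * J) \<ge> (C2 + 1) * u"
    proof -
      have "(512 * J * (C2 + 1)) * u / (512 * J) \<le> u * u / (512 * J)"
        using u J by (intro divide_right_mono mult_right_mono) auto
      then show ?thesis using J by (simp add: power2_eq_square)
    qed
    ultimately have "3 * ((C2 + 1) * u) \<le> C2 * u" by linarith
    then show False using u C2(1) by (simp add: algebra_simps) (smt (verit) mult_nonneg_nonneg)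
  qed
  then obtain b where b: "b < nb" "\<And>i. i < J \<Longrightarrow> \<exists>m\<in>cell (n + b * J + i). good m" by blast
  have "n + b * J + J \<le> 2 * n"
  proof -
    have "b * J + J = (b + 1) * J" by simp
    also have "\<dots> \<le> nb * J" using b by (intro mult_right_mono) auto
    finally show ?thesis using nb by simp
  qed
  then have "real (n + b * J + J) \<le> 2 * real n" by linarith
  then have "(real (n + b * J) + J) * \<delta> \<le> 2 * real n * \<delta>" using \<delta> by (intro mult_right_mono) auto
  then have "exp ((real (n + b * J) + J) * \<delta>) \<le> sqrt x" using sq by (smt (verit) exp_le_cancel_iff)
  moreover have "\<exists>m. squarefree m \<and> selb m \<noteq> 0 \<and> exp ((real (n + b * J) + i) * \<delta>) < m \<and> m \<le> exp ((real (n + b * J) + i + 1) * \<delta>) \<and>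
        nrm (U m (avg F (x / m)) - avg F x) \<le> \<eta>" if "i < J" for i
    using b(2)[OF that] unfolding good_def Bex_def cell of_nat_add by (metis add.assoc)
  moreover have "X \<le> x" "nrm (avg F x) \<ge> a - \<eta>" using x(1,2) \<theta>(2) by auto
  ultimately show ?thesis using x1 by blast
qed

end

section \<open>Averages of coboundaries\<close>

context mult_isometries
begin

text \<open>Quantitative orthogonality of coboundaries and invariant vectors: as \<open>U m\<close>
  is an isometry, \<open>ip (U m w - w) (U m y) = - ip w w\<close>.\<close>

lemma nrm_coboundary_square_le:
  assumes "m > 0" "y \<in> V"
  defines "w \<equiv> U m y - y"
  shows "(nrm w)\<^sup>2 \<le> nrm y * nrm (U m w - w)"
proof -
  have V: "w \<in> V" "U m y \<in> V" "U m w \<in> V" using assms by (auto simp: w_def)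
  have "ip (U m w - w) (U m y) = ip w y - ip w (U m y)"
    using assms(1,2) V by (simp add: ip_diff_left U_ip)
  also have "\<dots> = - ip w w" using assms(2) V unfolding w_def by (simp add: ip_diff_right)
  finally have "(nrm w)\<^sup>2 = \<bar>ip (U m w - w) (U m y)\<bar>" using V by (simp add: nrm_square ip_nonneg)
  also have "\<dots> \<le> nrm (U m w - w) * nrm (U m y)" using V by (intro Cauchy_Schwarz) auto
  finally show ?thesis using assms by (simp add: mult.commute)
qed

text \<open>The operators are restricted to \<open>V\<close> because \<open>U (p * q)\<close> is
  known to be the composition only there.\<close>

lemma finite_almost_prime_ops:
  "finite ((\<lambda>m. restrict (U m) V) ` {m::nat. prime m \<or> (\<exists>p q. prime p \<and> prime q \<and> m = p * q)})"
proof (rule finite_subset)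
  let ?P = "U ` {p. prime p}"
  let ?C = "(\<lambda>T. restrict T V) ` ?P \<union> (\<lambda>(S, T). restrict (S \<circ> T) V) ` (?P \<times> ?P)"
  show "finite ?C" using finite_U by auto
  show "(\<lambda>m. restrict (U m) V) ` {m::nat. prime m \<or> (\<exists>p q. prime p \<and> prime q \<and> m = p * q)} \<subseteq> ?C"
  proof (rule image_subsetI)
    fix m assume "m \<in> {m::nat. prime m \<or> (\<exists>p q. prime p \<and> prime q \<and> m = p * q)}"
    then consider "prime m" | p q where "prime p" "prime q" "m = p * q" by auto
    then show "restrict (U m) V \<in> ?C"
    proof cases
      case 2
      then have "restrict (U m) V = restrict (U p \<circ> U q) V"
        by (intro restrict_ext) (auto simp: U_mult prime_gt_0_nat)
      then show ?thesis using 2 by auto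
    qed auto
  qed
qed

theorem avg_coboundary_tendsto_zero:
  assumes F0: "F0 \<in> V" and q: "prime q"
    and div: "\<not> (\<lambda>p. 1 / real p) summable_on {p. prime p \<and> U p = U q}"
  shows "((\<lambda>x. nrm (avg (U q F0 - F0) x)) \<longlongrightarrow> 0) at_top"
proof -
  have q0: "q > 0" using q by (rule prime_gt_0_nat)
  define F where "F = U q F0 - F0"
  have F: "F \<in> V" using F0 q0 by (auto simp: F_def)
  \<comment> \<open>The set of eventual upper bounds of \<open>nrm (avg F y)\<close>; its infimum
    \<open>a\<close> is the limit superior.\<close>
  define S where "S = {b. \<exists>Y. \<forall>y\<ge>Y. nrm (avg F y) \<le> b}"
  define a where "a = Inf S"
  have S0: "b \<ge> 0" if "b \<in> S" for b
  proof -
    from that obtain Y where "nrm (avg F Y) \<le> b" by (auto simp: S_def)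
    then show ?thesis using nrm_nonneg[OF avg_in[OF F, of Y]] by linarith
  qed
  have "nrm F \<in> S" unfolding S_def using nrm_avg_le[OF F] by (auto intro!: exI[of _ 1])
  then have ne: "S \<noteq> {}" by auto
  have bdd: "bdd_below S" using S0 by (rule bdd_belowI)
  have a0: "a \<ge> 0" unfolding a_def using ne S0 by (rule cInf_greatest)
  have up: "\<exists>Y. \<forall>y\<ge>Y. nrm (avg F y) \<le> a + \<epsilon>" if "\<epsilon> > 0" for \<epsilon>
  proof -
    have "Inf S < a + \<epsilon>" using that by (simp add: a_def)
    then obtain b where "b \<in> S" "b < a + \<epsilon>" using cInf_lessD[OF ne] by blast
    then obtain Y where "\<forall>y\<ge>Y. nrm (avg F y) \<le> b" by (auto simp: S_def)
    with \<open>b < a + \<epsilon>\<close> show ?thesis by (meson less_imp_le order_trans)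
  qed
  have lo: "\<exists>y\<ge>Y. nrm (avg F y) \<ge> a - \<epsilon>" if "\<epsilon> > 0" for \<epsilon> Y
  proof (rule ccontr)
    assume "\<not> ?thesis"
    then have "\<forall>y\<ge>Y. nrm (avg F y) \<le> a - \<epsilon>" by (meson le_cases)
    then have "a - \<epsilon> \<in> S" unfolding S_def by blast
    then have "a \<le> a - \<epsilon>" unfolding a_def using bdd by (rule cInf_lower)
    then show False using that by simp
  qed
  have "a = 0"
  proof (rule ccontr)
    assume "a \<noteq> 0"
    then have a: "a > 0" using a0 by simp
    define f0 where "f0 = nrm F0"
    define fF where "fF = nrm F"
    have f: "f0 \<ge> 0" "fF \<ge> 0" using F F0 by (auto simp: f0_def fF_def)
    \<comment> \<open>The vector \<open>w\<close> found below satisfies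
      \<open>nrm (U q w - w) \<le> 2 * t\<close>. Being a coboundary of a vector of norm at most
      \<open>f0\<close>, it then has \<open>(nrm w)\<^sup>2 \<le> a\<^sup>2 / 8\<close>, while
      near-extremality gives \<open>nrm w \<ge> a / 2\<close>.\<close>
    define t where "t = a\<^sup>2 / (16 * (f0 + 1))"
    have t: "t > 0" using a f by (simp add: t_def)
    \<comment> \<open>Divergence is used here: \<open>L\<close> is made so large that the
      Turan-Kubilius error \<open>sqrt (2 * L) * fF\<close> is at most \<open>L * t\<close>.\<close>
    obtain B where B: "finite B" "B \<subseteq> {p. prime p \<and> U p = U q}" "(\<Sum>p\<in>B. 1 / real p) \<ge> 2 * (fF / t)\<^sup>2 + 1"
    proof -
      have "\<not> bdd_above (sum (\<lambda>p. 1 / real p) ` {B. B \<subseteq> {p. prime p \<and> U p = U q} \<and> finite B})"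
        using div nonneg_bdd_above_summable_on[of "{p. prime p \<and> U p = U q}" "\<lambda>p. 1 / real p"] by auto
      then obtain z where "z \<in> sum (\<lambda>p. 1 / real p) ` {B. B \<subseteq> {p. prime p \<and> U p = U q} \<and> finite B}" "\<not> z \<le> 2 * (fF / t)\<^sup>2 + 1"
        unfolding bdd_above_def by blast
      then obtain B where B: "B \<subseteq> {p. prime p \<and> U p = U q}" "finite B" "z = (\<Sum>p\<in>B. 1 / real p)" by blast
      moreover have "(\<Sum>p\<in>B. 1 / real p) \<ge> 2 * (fF / t)\<^sup>2 + 1"
        using B(3) \<open>\<not> z \<le> _\<close> by linarith
      ultimately show ?thesis using that by blast
    qed
    define L where "L = (\<Sum>p\<in>B. 1 / real p)"
    have L: "L \<ge> 1" "2 * (fF / t)\<^sup>2 \<le> L" using B(3) zero_le_power2[of "fF / t"] unfolding L_def by linarith+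
    have Bp: "prime p" "U p = U q" "p > 0" if "p \<in> B" for p using B(2) that by (auto simp: prime_gt_0_nat)
    define Cs where "Cs = (\<lambda>m. restrict (U m) V) ` {m::nat. prime m \<or> (\<exists>p q. prime p \<and> prime q \<and> m = p * q)}"
    define K where "K = card Cs"
    \<comment> \<open>The path from \<open>w\<close> to \<open>avg F (x' / p)\<close> will have
      length at most \<open>K * (2 * \<eta>) + (K + 1) * s\<close>, and each summand receives
      \<open>t / 2\<close>. The bound \<open>a / 4\<close> keeps \<open>a - 2 * \<eta>\<close>,
      hence \<open>nrm w\<close>, at least \<open>a / 2\<close>.\<close>
    define \<eta> where "\<eta> = min (a / 4) (t / (4 * (real K + 1)))"
    have \<eta>: "\<eta> > 0" "\<eta> \<le> a / 4" "K * (2 * \<eta>) \<le> t / 2"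
    proof -
      have "\<eta> \<le> t / (4 * (real K + 1))" by (simp add: \<eta>_def)
      then have e: "\<eta> * (4 * (real K + 1)) \<le> t" by (simp add: pos_le_divide_eq)
      show \<eta>0: "\<eta> > 0" using a t by (simp add: \<eta>_def)
      show "K * (2 * \<eta>) \<le> t / 2" using e \<eta>0 by (simp add: algebra_simps)
      show "\<eta> \<le> a / 4" unfolding \<eta>_def by (rule min.cobounded1)
    qed
    define \<delta> where "\<delta> = min 1 (t / (16 * (real K + 1) * (fF + 1)))"
    \<comment> \<open>The Lipschitz bound across two cells: 5 is 2 * 2 from the factor
      \<open>exp (2 * \<delta>)\<close> plus 1 from the rounding term, which is at most
      \<open>\<delta>\<close>.\<close>
    define s where "s = 5 * \<delta> * fF"
    have \<delta>: "\<delta> > 0" "\<delta> \<le> 1" and s: "(real K + 1) * s \<le> t / 2" "s \<ge> 0"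
    proof -
      have "\<delta> \<le> t / (16 * (real K + 1) * (fF + 1))" by (simp add: \<delta>_def)
      then have e: "\<delta> * (16 * (real K + 1) * (fF + 1)) \<le> t" using f by (simp add: pos_le_divide_eq)
      show \<delta>0: "\<delta> > 0" using t f by (simp add: \<delta>_def)
      show "s \<ge> 0" using f \<delta>0 by (simp add: s_def)
      have "(real K + 1) * s = 5/16 * (\<delta> * (16 * (real K + 1) * fF))" by (simp add: s_def)
      also have "\<dots> \<le> 5/16 * (\<delta> * (16 * (real K + 1) * (fF + 1)))"
        using \<delta>0 by (intro mult_left_mono) auto
      also have "\<dots> \<le> 5/16 * t" using e by (intro mult_left_mono) auto
      also have "\<dots> \<le> t / 2" using t by simp
      finally show "(real K + 1) * s \<le> t / 2" .
    qed (simp add: \<delta>_def)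
    define P where "P = Max (insert 1 B)"
    have P: "P \<ge> 1" "\<And>p. p \<in> B \<Longrightarrow> p \<le> P" using B(1) by (auto simp: P_def)
    \<comment> \<open>The block is long enough for \<open>m 0 * p\<close> to stay inside it for
      every \<open>p\<close> in \<open>B\<close>.\<close>
    define J where "J = nat \<lceil>ln (real P) / \<delta>\<rceil> + 2"
    have J: "J > 0" "exp \<delta> * P \<le> exp (J * \<delta>)"
    proof -
      have "ln (real P) / \<delta> \<le> real J - 2" unfolding J_def by linarith
      then have "ln (real P) \<le> (real J - 2) * \<delta>" using \<delta> by (simp add: pos_divide_le_eq)
      then have "\<delta> + ln (real P) \<le> J * \<delta>" using \<delta> by (simp add: algebra_simps)
      then have "exp (\<delta> + ln (real P)) \<le> exp (J * \<delta>)" by simp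
      then show "exp \<delta> * P \<le> exp (J * \<delta>)" using P by (simp add: exp_add)
    qed (simp add: J_def)
    \<comment> \<open>\<open>sqrt x \<ge> 1 / \<delta>\<close> controls the rounding in the
      Lipschitz bound, and \<open>sqrt x \<ge> 2 * card B\<close> that in the Turan-Kubilius
      inequality.\<close>
    define X where "X = (max (1 / \<delta>) (2 * card B))\<^sup>2"
    obtain x j0 where x: "x \<ge> X" "x \<ge> 1" "nrm (avg F x) \<ge> a - \<eta>" "exp ((real j0 + J) * \<delta>) \<le> sqrt x"
      and ex: "\<And>i. i < J \<Longrightarrow> \<exists>m. squarefree m \<and> selb m \<noteq> 0 \<and> exp ((real j0 + i) * \<delta>) < m \<and> m \<le> exp ((real j0 + i + 1) * \<delta>) \<and>
        nrm (U m (avg F (x / m)) - avg F x) \<le> \<eta>"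
      using good_block[OF F a0 \<delta> \<eta>(1) J(1) up lo, of X] by blast
    obtain m where m: "\<And>i. i < J \<Longrightarrow> squarefree (m i)" "\<And>i. i < J \<Longrightarrow> selb (m i) \<noteq> 0"
      "\<And>i. i < J \<Longrightarrow> exp ((real j0 + i) * \<delta>) < m i" "\<And>i. i < J \<Longrightarrow> m i \<le> exp ((real j0 + i + 1) * \<delta>)"
      "\<And>i. i < J \<Longrightarrow> nrm (U (m i) (avg F (x / m i)) - avg F x) \<le> \<eta>"
      using ex by metis
    have sqrtx: "sqrt x \<ge> 1 / \<delta>" "sqrt x \<ge> 2 * card B"
    proof -
      have "max (1 / \<delta>) (2 * card B) \<le> sqrt x"
        using x(1) \<delta> by (intro real_le_rsqrt) (simp add: X_def)
      then show "sqrt x \<ge> 1 / \<delta>" "sqrt x \<ge> 2 * card B" by auto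
    qed
    have xdiv: "x / z \<ge> sqrt x" if "0 < z" "z \<le> exp ((real j0 + J) * \<delta>)" for z
    proof -
      have "sqrt x * z \<le> sqrt x * sqrt x" using that x(2,4) by (intro mult_left_mono) auto
      then show ?thesis using that x(2) by (simp add: pos_le_divide_eq)
    qed
    have lip: "nrm (avg F (x / z) - avg F (x / z')) \<le> s"
      if "0 < z" "z \<le> z'" "z' \<le> exp (2 * \<delta>) * z" "z' \<le> exp ((real j0 + J) * \<delta>)" for z z'
    proof -
      have z': "z' > 0" using that by linarith
      have big: "x / z' \<ge> 1 / \<delta>" using xdiv[OF z' that(4)] sqrtx by linarith
      have "nrm (avg F (x / z) - avg F (x / z')) \<le> (2 * (2 * \<delta>) + 1 / (x / z')) * nrm F"
      proof (rule avg_lipschitz[OF F])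
        show "0 < x / z'" using z' x by simp
        show "x / z' \<le> x / z" using that x by (simp add: frac_le)
        show "x / z \<le> exp (2 * \<delta>) * (x / z')"
          using that z' x by (simp add: field_simps)
      qed
      also have "1 / (x / z') \<le> \<delta>" using big \<delta> z' x by (simp add: field_simps)
      then have "(2 * (2 * \<delta>) + 1 / (x / z')) * nrm F \<le> (5 * \<delta>) * nrm F" using F by (intro mult_right_mono) auto
      finally show ?thesis by (simp add: s_def fF_def)
    qed
    have mpos: "m i > 0" if "i < J" for i
      using m(3)[OF that] by (smt (verit) exp_gt_zero of_nat_0_less_iff)
    have expJ: "exp ((real j0 + i + 1) * \<delta>) \<le> exp ((real j0 + J) * \<delta>)" if "i < J" for i :: nat
      using that \<delta> by (simp add: mult_right_mono)
    \<comment> \<open>The colour of \<open>i\<close> is the operator \<open>U (m i)\<close>. For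
      equal colours the same isometry takes both averages to within \<open>\<eta>\<close> of
      \<open>avg F x\<close>, so they are within \<open>2 * \<eta>\<close> of each other.\<close>
    have chain: "nrm (avg F (x / m 0) - avg F (x / m k)) \<le> K * (2 * \<eta> + s)" if k: "k < J" for k
      unfolding K_def
    proof (rule nrm_chain[where col = "\<lambda>i. restrict (U (m i)) V" and a = "\<lambda>i. avg F (x / m i)"])
      show "finite Cs" unfolding Cs_def by (rule finite_almost_prime_ops)
      show "restrict (U (m i)) V \<in> Cs" if "i \<le> k" for i
        unfolding Cs_def using selb_support[of "m i"] m(1,2)[of i] k that by (intro imageI) auto
      show "avg F (x / m i) \<in> V" for i using F by simp
      show "nrm (avg F (x / m i) - avg F (x / m (Suc i))) \<le> s" if "i < k" for i
      proof (rule lip)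
        have i: "i < J" "Suc i < J" using that k by auto
        show "0 < real (m i)" using mpos i by simp
        have "exp ((real j0 + i + 1) * \<delta>) < m (Suc i)" using m(3)[OF i(2)] by (simp add: add_ac)
        then show "real (m i) \<le> m (Suc i)" using m(4)[OF i(1)] by linarith
        have "m (Suc i) \<le> exp ((real j0 + real (Suc i) + 1) * \<delta>)" using m(4)[OF i(2)] by simp
        also have "\<dots> = exp (2 * \<delta>) * exp ((real j0 + i) * \<delta>)" by (simp add: exp_add[symmetric] algebra_simps)
        also have "\<dots> \<le> exp (2 * \<delta>) * m i" using m(3)[OF i(1)] by simp
        finally show "m (Suc i) \<le> exp (2 * \<delta>) * m i" .
        show "m (Suc i) \<le> exp ((real j0 + J) * \<delta>)" using m(4)[OF i(2)] expJ[OF i(2)] by linarith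
      qed
      show "nrm (avg F (x / m i) - avg F (x / m j)) \<le> 2 * \<eta>"
        if ij: "i \<le> k" "j \<le> k" and eq: "restrict (U (m i)) V = restrict (U (m j)) V" for i j
      proof -
        have iJ: "i < J" "j < J" using ij k by auto
        let ?u = "avg F (x / m i)" and ?v = "avg F (x / m j)"
        have "U (m j) ?v = U (m i) ?v" using fun_cong[OF eq, of ?v] F by simp
        then have "nrm (?u - ?v) = nrm (U (m i) ?u - U (m j) ?v)" using mpos[OF iJ(1)] F by (simp add: nrm_U_diff)
        also have "\<dots> \<le> nrm (U (m i) ?u - avg F x) + nrm (avg F x - U (m j) ?v)"
          using F mpos[OF iJ(1)] mpos[OF iJ(2)] by (intro nrm_dist_triangle) auto
        also have "\<dots> \<le> \<eta> + \<eta>"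
        proof (rule add_mono[OF m(5)[OF iJ(1)]])
          have "nrm (avg F x - U (m j) ?v) = nrm (U (m j) ?v - avg F x)"
            using F mpos[OF iJ(2)] by (intro nrm_minus_commute) auto
          then show "nrm (avg F x - U (m j) ?v) \<le> \<eta>" using m(5)[OF iJ(2)] by simp
        qed
        finally show ?thesis by simp
      qed
    qed (use \<eta> s in auto)
    define x' where "x' = x / m 0"
    define w where "w = avg F x'"
    have m0: "m 0 > 0" using mpos J by simp
    have wV: "w \<in> V" using F by (simp add: w_def)
    have x': "x' \<ge> sqrt x" unfolding x'_def using order_trans[OF m(4) expJ, of 0] J(1) m0 by (intro xdiv) auto
    have x'1: "x' \<ge> 1" using x' x(2) real_sqrt_ge_one[of x] by linarith
    have near: "nrm (avg F (x' / p) - w) \<le> t" if p: "p \<in> B" for p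
    proof -
      define z where "z = m 0 * p"
      have z0: "z > 0" using Bp(3)[OF p] m0 by (simp add: z_def)
      have xz: "x' / p = x / z" by (simp add: x'_def z_def)
      have zJ: "real z \<le> exp ((real j0 + J) * \<delta>)"
      proof -
        have "real z \<le> exp ((real j0 + 1) * \<delta>) * P"
          unfolding z_def of_nat_mult using m(4)[of 0] J P(2)[OF p] by (intro mult_mono) auto
        also have "\<dots> = exp (real j0 * \<delta>) * (exp \<delta> * P)" by (simp add: exp_add[symmetric] algebra_simps)
        also have "\<dots> \<le> exp (real j0 * \<delta>) * exp (J * \<delta>)" using J by (intro mult_left_mono) auto
        also have "\<dots> = exp ((real j0 + J) * \<delta>)" by (simp add: exp_add[symmetric] algebra_simps)
        finally show ?thesis .
      qed
      \<comment> \<open>The index of the cell that contains \<open>z\<close>, so that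
        \<open>z\<close> and \<open>m i\<close> differ at most by the factor
        \<open>exp (2 * \<delta>)\<close>.\<close>
      define i where "i = (LEAST i. real z \<le> exp ((real j0 + real i + 1) * \<delta>))"
      have wit: "real z \<le> exp ((real j0 + real (J - 1) + 1) * \<delta>)"
        using zJ J(1) by (simp add: of_nat_diff)
      have i1: "real z \<le> exp ((real j0 + i + 1) * \<delta>)" unfolding i_def by (rule LeastI[of "\<lambda>i. real z \<le> exp ((real j0 + real i + 1) * \<delta>)", OF wit])
      have "i \<le> J - 1" unfolding i_def by (rule Least_le[of "\<lambda>i. real z \<le> exp ((real j0 + real i + 1) * \<delta>)", OF wit])
      then have iJ: "i < J" using J(1) by simp
      have i2: "exp ((real j0 + i) * \<delta>) < real z"
      proof (cases i)
        case 0
        have "exp (real j0 * \<delta>) < real (m 0)" using m(3)[of 0] J by simp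
        also have "real (m 0) \<le> real z" using Bp(3)[OF p] by (simp add: z_def del: of_nat_mult)
        finally show ?thesis using 0 by simp
      next
        case (Suc i')
        then have "\<not> real z \<le> exp ((real j0 + real i' + 1) * \<delta>)"
          unfolding i_def using not_less_Least[of i' "\<lambda>i. real z \<le> exp ((real j0 + real i + 1) * \<delta>)"] by simp
        then show ?thesis using Suc by (simp add: add_ac)
      qed
      have cell: "exp ((real j0 + i + 1) * \<delta>) \<le> exp (2 * \<delta>) * y" if "exp ((real j0 + i) * \<delta>) < y" for y
      proof -
        have "exp ((real j0 + i + 1) * \<delta>) \<le> exp ((2 * \<delta>) + (real j0 + i) * \<delta>)"
          using \<delta> by (simp add: algebra_simps)
        also have "\<dots> = exp (2 * \<delta>) * exp ((real j0 + i) * \<delta>)" by (simp add: exp_add)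
        also have "\<dots> \<le> exp (2 * \<delta>) * y" using that by simp
        finally show ?thesis .
      qed
      have d1: "nrm (avg F (x / z) - avg F (x / m i)) \<le> s"
      proof (cases "z \<le> m i")
        case True
        show ?thesis
        proof (rule lip)
          show "real (m i) \<le> exp (2 * \<delta>) * real z" using cell[OF i2] m(4)[OF iJ] by linarith
          show "real (m i) \<le> exp ((real j0 + real J) * \<delta>)" using m(4)[OF iJ] expJ[OF iJ] by linarith
        qed (use True z0 in auto)
      next
        case False
        have "nrm (avg F (x / m i) - avg F (x / z)) \<le> s"
        proof (rule lip)
          show "real z \<le> exp (2 * \<delta>) * real (m i)" using cell[OF m(3)[OF iJ]] i1 by linarith
        qed (use False mpos[OF iJ] zJ in auto)
        then show ?thesis by (subst nrm_minus_commute) (use F in auto)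
      qed
      have "nrm (avg F (x' / p) - w) \<le> nrm (avg F (x / z) - avg F (x / m i)) + nrm (avg F (x / m i) - w)"
        unfolding xz using F wV by (intro nrm_dist_triangle) auto
      also have "nrm (avg F (x / m i) - w) = nrm (avg F (x / m 0) - avg F (x / m i))"
        unfolding w_def x'_def using F by (intro nrm_minus_commute) auto
      also have "nrm (avg F (x / z) - avg F (x / m i)) + \<dots> \<le> s + K * (2 * \<eta> + s)"
        using d1 chain[OF iJ] by (rule add_mono)
      also have "\<dots> = K * (2 * \<eta>) + (real K + 1) * s" by (simp add: algebra_simps)
      also have "\<dots> \<le> t" using \<eta>(3) s(1) by linarith
      finally show ?thesis .
    qed
    \<comment> \<open>\<open>A\<close> lies close to \<open>L *\<^sub>R w\<close> by Turan-Kubilius,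
      and close to \<open>L *\<^sub>R U q w\<close> because \<open>U p = U q\<close> on
      \<open>B\<close> and all \<open>avg F (x' / p)\<close> are close to \<open>w\<close>. Hence
      \<open>w\<close> is almost fixed by \<open>U q\<close>.\<close>
    define A where "A = (\<Sum>p\<in>B. (1 / real p) *\<^sub>R U p (avg F (x' / p)))"
    have AV: "A \<in> V" unfolding A_def using F Bp by (intro V_sum V_scale U_in) auto
    have tk: "nrm (L *\<^sub>R w - A) \<le> L * t"
    proof -
      have "nrm (L *\<^sub>R w - A) \<le> sqrt (L + 2 * L * card B / x') * nrm F"
        unfolding L_def A_def w_def using turan_kubilius[OF F B(1) Bp(1) x'1] by simp
      also have "\<dots> \<le> sqrt (2 * L) * fF"
      proof -
        have "2 * L * card B \<le> L * x'" using sqrtx(2) x' L by (simp add: mult_left_mono)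
        then have "2 * L * card B / x' \<le> L" using x'1 by (simp add: pos_divide_le_eq)
        then show ?thesis using f by (auto simp: fF_def intro!: mult_right_mono)
      qed
      also have "\<dots> \<le> L * t"
      proof (rule power2_le_imp_le)
        have "2 * fF\<^sup>2 \<le> L * t\<^sup>2" using L(2) t by (simp add: power_divide field_simps)
        then have "L * (2 * fF\<^sup>2) \<le> L * (L * t\<^sup>2)" using L by (intro mult_left_mono) auto
        then show "(sqrt (2 * L) * fF)\<^sup>2 \<le> (L * t)\<^sup>2" using L by (simp add: power_mult_distrib power2_eq_square mult_ac)
      qed (use L t in auto)
      finally show ?thesis .
    qed
    have tk2: "nrm (A - L *\<^sub>R U q w) \<le> L * t"
    proof -
      have "A - L *\<^sub>R U q w = (\<Sum>p\<in>B. (1 / real p) *\<^sub>R (U p (avg F (x' / p)) - U p w))"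
        unfolding A_def L_def scaleR_left.sum sum_subtractf[symmetric]
        by (intro sum.cong refl) (simp add: Bp(2) scaleR_diff_right)
      also have "nrm \<dots> \<le> (\<Sum>p\<in>B. \<bar>1 / real p\<bar>) * t"
        using near F wV Bp(3) by (intro nrm_sum_scale_le) (auto simp: nrm_U_diff U_in)
      finally show ?thesis by (simp add: L_def)
    qed
    have "L * nrm (w - U q w) = nrm (L *\<^sub>R w - L *\<^sub>R U q w)"
      using L wV q0 by (simp add: nrm_scale U_in flip: scaleR_diff_right)
    also have "\<dots> \<le> nrm (L *\<^sub>R w - A) + nrm (A - L *\<^sub>R U q w)"
      using wV AV q0 by (intro nrm_dist_triangle) auto
    also have "\<dots> \<le> L * (2 * t)" using tk tk2 by simp
    finally have "nrm (w - U q w) \<le> 2 * t" using L by simp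
    then have inv: "nrm (U q w - w) \<le> 2 * t" by (subst nrm_minus_commute) (use wV q0 in auto)
    define y where "y = avg F0 x'"
    have yV: "y \<in> V" using F0 by (simp add: y_def)
    have wy: "w = U q y - y" using F0 q0 by (simp add: w_def y_def F_def avg_diff avg_U U_in)
    have ny: "nrm y \<le> f0" using nrm_avg_le[OF F0, of x'] x'1 by (simp add: y_def f0_def)
    have "(nrm w)\<^sup>2 \<le> nrm y * nrm (U q w - w)"
      unfolding wy by (rule nrm_coboundary_square_le[OF q0 yV])
    also have "\<dots> \<le> f0 * (2 * t)" using ny inv f t wV q0 by (intro mult_mono) (auto simp: U_in)
    also have "\<dots> \<le> a\<^sup>2 / 8" using f a by (simp add: t_def field_simps)
    finally have up_w: "(nrm w)\<^sup>2 \<le> a\<^sup>2 / 8" .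
    have "nrm (avg F x) \<le> nrm (U (m 0) w) + nrm (avg F x - U (m 0) w)"
      using F wV m0 by (intro nrm_le_dist) auto
    also have "nrm (avg F x - U (m 0) w) \<le> \<eta>"
      using m(5)[of 0] J(1) F wV m0 by (subst nrm_minus_commute) (auto simp: w_def x'_def)
    also have "nrm (U (m 0) w) = nrm w" using wV m0 by simp
    finally have "a / 2 \<le> nrm w" using x(3) \<eta>(2) by linarith
    then have "(a / 2)\<^sup>2 \<le> (nrm w)\<^sup>2" using a by (intro power_mono) auto
    then have "a\<^sup>2 \<le> 4 * (nrm w)\<^sup>2" by (simp add: power_divide)
    moreover have "a\<^sup>2 > 0" using a by simp
    ultimately show False using up_w by linarith
  qed
  show ?thesis unfolding F_def[symmetric]
  proof (rule tendstoI)
    fix e :: real assume "e > 0"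
    then obtain Y where "\<forall>y\<ge>Y. nrm (avg F y) \<le> a + e / 2" using up[of "e / 2"] by auto
    then have "\<forall>y\<ge>Y. dist (nrm (avg F y)) 0 < e" using \<open>e > 0\<close> \<open>a = 0\<close> F by force
    then show "\<forall>\<^sub>F y in at_top. dist (nrm (avg F y)) 0 < e" unfolding eventually_at_top_linorder by blast
  qed
qed

end

section \<open>Euler products\<close>

text \<open>For primes \<open>ps\<close> and \<open>n > 0\<close> this is the largest divisor of
  \<open>n\<close> composed of these primes. A list is used so that Euler factors can be adjoined
  one at a time.\<close>

definition smooth_part :: "nat list \<Rightarrow> nat \<Rightarrow> nat" where
  "smooth_part ps n = (\<Prod>p\<in>set ps. p ^ multiplicity p n)"

lemma smooth_part_pos:
  assumes "\<And>p. p \<in> set ps \<Longrightarrow> prime p"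
  shows "smooth_part ps n > 0"
  unfolding smooth_part_def using assms by (intro prod_pos) (auto simp: prime_gt_0_nat)

lemma smooth_part_Nil [simp]: "smooth_part [] n = 1"
  by (simp add: smooth_part_def)

lemma smooth_part_prime_mult:
  assumes "\<And>q. q \<in> set ps \<Longrightarrow> prime q" "prime p" "p \<notin> set ps" "n > 0"
  shows "smooth_part ps (p * n) = smooth_part ps n"
  unfolding smooth_part_def
proof (intro prod.cong refl)
  fix q assume q: "q \<in> set ps"
  then have "multiplicity q p = 0" using assms by (intro prime_multiplicity_other) auto
  then show "q ^ multiplicity q (p * n) = q ^ multiplicity q n"
    using assms q by (subst prime_elem_multiplicity_mult_distrib) auto
qed

lemma smooth_part_Cons_mult:
  assumes "\<And>q. q \<in> set ps \<Longrightarrow> prime q" "prime p" "p \<notin> set ps" "n > 0"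
  shows "smooth_part (p # ps) (p * n) = p * smooth_part (p # ps) n"
proof -
  have "multiplicity p (p * n) = Suc (multiplicity p n)"
    using assms(2,4) not_prime_unit[of p] by (intro multiplicity_times_same) auto
  then show ?thesis using smooth_part_prime_mult[OF assms] assms(3) by (simp add: smooth_part_def)
qed

lemma smooth_part_Cons_not_dvd:
  assumes "p \<notin> set ps" "\<not> p dvd n"
  shows "smooth_part (p # ps) n = smooth_part ps n"
  using assms by (simp add: smooth_part_def not_dvd_imp_multiplicity_0)

text \<open>Since \<open>N div p \<le> N / 2\<close>, errors \<open>\<epsilon> / 4 * N\<close> form
  a geometric series: the bound \<open>\<epsilon> / 2 * N + C\<close> reproduces itself under the
  recursion, with \<open>C\<close> covering the initial values.\<close>

lemma halving_recursion_tendsto_zero: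
  fixes e r :: "nat \<Rightarrow> real" and p :: nat
  assumes p: "p \<ge> 2" and e: "\<And>N. e N \<ge> 0" and rec: "\<And>N. N > 0 \<Longrightarrow> e N \<le> r N + e (N div p)"
    and r: "(\<lambda>N. r N / N) \<longlonglongrightarrow> 0"
  shows "(\<lambda>N. e N / N) \<longlonglongrightarrow> 0"
proof (rule tendstoI)
  fix \<epsilon> :: real assume \<epsilon>: "\<epsilon> > 0"
  have "\<forall>\<^sub>F N in sequentially. r N / N < \<epsilon> / 4" using r \<epsilon> by (intro order_tendstoD) auto
  then obtain N0 where N0: "\<And>N. N \<ge> N0 \<Longrightarrow> r N / N < \<epsilon> / 4" by (auto simp: eventually_sequentially)
  define C where "C = Max (e ` {..N0})"
  have CN: "e N \<le> C" if "N \<le> N0" for N using that by (auto simp: C_def)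
  have C0: "C \<ge> 0" using CN[of 0] e[of 0] by linarith
  have b: "e N \<le> \<epsilon> / 2 * N + C" for N
  proof (induction N rule: less_induct)
    case (less N)
    show ?case
    proof (cases "N \<le> N0")
      case True
      then have "e N \<le> C" by (rule CN)
      moreover have "0 \<le> \<epsilon> / 2 * N" using \<epsilon> by simp
      ultimately show ?thesis by linarith
    next
      case False
      then have N: "N > 0" "N \<ge> N0" by auto
      have "r N < \<epsilon> / 4 * N" using N0[OF N(2)] N(1) by (simp add: pos_divide_less_eq)
      moreover have "e (N div p) \<le> \<epsilon> / 2 * (N div p) + C" using N p by (intro less) auto
      moreover have "real (N div p) \<le> N / 2"
      proof -
        have "real (N div p) \<le> real N / real p" by (rule of_nat_div_le_of_nat)
        also have "\<dots> \<le> N / 2" using p by (intro divide_left_mono) auto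
        finally show ?thesis .
      qed
      then have "\<epsilon> / 2 * (N div p) \<le> \<epsilon> / 2 * (N / 2)" using \<epsilon> by (intro mult_left_mono) auto
      ultimately show ?thesis using rec[OF N(1)] by (simp add: field_simps)
    qed
  qed
  have "(\<lambda>N. C / real N) \<longlonglongrightarrow> 0" by (rule lim_const_over_n)
  then have "\<forall>\<^sub>F N in sequentially. C / real N < \<epsilon> / 2" using \<epsilon> by (intro order_tendstoD) auto
  with eventually_gt_at_top[of 0] show "\<forall>\<^sub>F N in sequentially. dist (e N / N) 0 < \<epsilon>"
  proof eventually_elim
    case (elim N)
    have "e N / N \<le> (\<epsilon> / 2 * N + C) / N" using b[of N] by (intro divide_right_mono) auto
    also have "\<dots> = \<epsilon> / 2 + C / N" using elim by (simp add: field_simps)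
    finally have "e N / N < \<epsilon>" using elim(2) by linarith
    then show ?case using e[of N] by simp
  qed
qed

lemma summable_on_tail:
  fixes f :: "nat \<Rightarrow> real"
  assumes "f summable_on A" "\<And>x. x \<in> A \<Longrightarrow> f x \<ge> 0" "\<epsilon> > 0"
  shows "\<exists>y0. \<forall>B. finite B \<longrightarrow> B \<subseteq> A \<inter> {y0<..} \<longrightarrow> sum f B < \<epsilon>"
proof -
  have lim: "(sum f \<longlongrightarrow> infsum f A) (finite_subsets_at_top A)"
    using has_sum_infsum[OF assms(1)] by (simp add: has_sum_def)
  have "\<forall>\<^sub>F C in finite_subsets_at_top A. sum f C > infsum f A - \<epsilon>"
    using lim assms(3) by (intro order_tendstoD) auto
  then obtain C where C: "finite C" "C \<subseteq> A" "sum f C > infsum f A - \<epsilon>"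
    unfolding eventually_finite_subsets_at_top by blast
  define y0 where "y0 = Max (insert 0 C)"
  have "sum f B < \<epsilon>" if B: "finite B" "B \<subseteq> A \<inter> {y0<..}" for B
  proof -
    have "B \<inter> C = {}"
    proof -
      have "x \<le> y0" if "x \<in> C" for x using C(1) that by (simp add: y0_def)
      then show ?thesis using B(2) by fastforce
    qed
    then have "sum f B + sum f C = sum f (B \<union> C)" using B C by (intro sum.union_disjoint[symmetric]) auto
    also have "\<dots> \<le> infsum f A" using B C assms by (intro finite_sum_le_infsum) auto
    finally show ?thesis using C(3) by linarith
  qed
  then show ?thesis by blast
qed

context mult_isometries
begin

text \<open>\<open>euler_rel ps F G\<close>: up to null vectors, \<open>G\<close> arises from \<open>F\<close> by applying the operators
  \<open>(1 - 1/p) (1 - U\<^sub>p/p)\<^sup>-\<^sup>1\<close>, \<open>p\<close> in \<open>ps\<close>, the last one first; inverses are avoided by stating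
  \<open>(1 - U\<^sub>p/p) G = (1 - 1/p) H\<close>.\<close>

fun euler_rel :: "nat list \<Rightarrow> 'a \<Rightarrow> 'a \<Rightarrow> bool" where
  "euler_rel [] F G \<longleftrightarrow> nrm (F - G) = 0"
| "euler_rel (p # ps) F G \<longleftrightarrow>
     (\<exists>H\<in>V. euler_rel ps F H \<and> nrm (G - (1 - 1 / p) *\<^sub>R H - (1 / p) *\<^sub>R U p G) = 0)"

definition part_sum :: "nat list \<Rightarrow> 'a \<Rightarrow> nat \<Rightarrow> 'a" where
  "part_sum ps F N = (\<Sum>n\<in>{1..N}. U (smooth_part ps n) F)"

lemma part_sum_in:
  assumes "F \<in> V" "\<And>p. p \<in> set ps \<Longrightarrow> prime p"
  shows "part_sum ps F N \<in> V"
  unfolding part_sum_def using smooth_part_pos[OF assms(2)] assms(1) by (intro V_sum U_in) auto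

text \<open>The sum is split by divisibility by \<open>p\<close>. Numbers prime to \<open>p\<close>
  do not see the new prime; the multiples \<open>p * k\<close> give \<open>U p\<close> of the same
  sum up to \<open>N div p\<close>.\<close>

lemma part_sum_Cons:
  assumes F: "F \<in> V" and ps: "\<And>q. q \<in> set ps \<Longrightarrow> prime q" "prime p" "p \<notin> set ps"
  shows "part_sum (p # ps) F N = part_sum ps F N - part_sum ps F (N div p) + U p (part_sum (p # ps) F (N div p))"
proof -
  have p0: "p > 0" using ps(2) by (rule prime_gt_0_nat)
  have pos: "smooth_part (p # ps) k > 0" for k
    using smooth_part_pos[of "p # ps" k] ps by auto
  have bij: "(\<Sum>n\<in>{n\<in>{1..N}. p dvd n}. f n) = (\<Sum>k\<in>{1..N div p}. f (p * k))" for f :: "nat \<Rightarrow> 'a"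
    by (rule sum.reindex_bij_witness[of _ "\<lambda>k. p * k" "\<lambda>n. n div p"])
       (use p0 in \<open>auto elim!: dvdE simp: less_eq_div_iff_mult_less_eq mult.commute\<close>)
  have split: "(\<Sum>n\<in>{1..N}. f n) = (\<Sum>n\<in>{n\<in>{1..N}. p dvd n}. f n) + (\<Sum>n\<in>{n\<in>{1..N}. \<not> p dvd n}. f n)" for f :: "nat \<Rightarrow> 'a"
    by (subst sum.union_disjoint[symmetric]) (auto intro: sum.cong)
  have "(\<Sum>n\<in>{n\<in>{1..N}. \<not> p dvd n}. U (smooth_part (p # ps) n) F) = (\<Sum>n\<in>{n\<in>{1..N}. \<not> p dvd n}. U (smooth_part ps n) F)"
    using smooth_part_Cons_not_dvd[OF ps(3)] by (intro sum.cong) auto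
  also have "\<dots> = part_sum ps F N - (\<Sum>k\<in>{1..N div p}. U (smooth_part ps (p * k)) F)"
    unfolding part_sum_def by (subst split) (simp only: bij add_diff_cancel_left')
  also have "(\<Sum>k\<in>{1..N div p}. U (smooth_part ps (p * k)) F) = part_sum ps F (N div p)"
    unfolding part_sum_def using smooth_part_prime_mult[OF ps] by (intro sum.cong) auto
  finally have 1: "(\<Sum>n\<in>{n\<in>{1..N}. \<not> p dvd n}. U (smooth_part (p # ps) n) F) = part_sum ps F N - part_sum ps F (N div p)" .
  have "(\<Sum>k\<in>{1..N div p}. U (smooth_part (p # ps) (p * k)) F) = (\<Sum>k\<in>{1..N div p}. U p (U (smooth_part (p # ps) k) F))"
    using smooth_part_Cons_mult[OF ps] pos p0 F by (intro sum.cong) (auto simp: U_mult)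
  also have "\<dots> = U p (part_sum (p # ps) F (N div p))"
    unfolding part_sum_def using F p0 pos by (intro U_sum[symmetric]) auto
  finally show ?thesis using 1 unfolding part_sum_def[of "p # ps" F N] by (subst split) (simp only: bij add.commute)
qed

text \<open>Divided by \<open>N\<close>, the recursion \<open>part_sum_Cons\<close> becomes
  \<open>G = H - (1 / p) H + (1 / p) U p G\<close> in the limit, which is the equation in
  \<open>euler_rel\<close>. The deviation from the limit satisfies the recursion of
  \<open>halving_recursion_tendsto_zero\<close>.\<close>

lemma part_avg_tendsto:
  assumes F: "F \<in> V" and "distinct ps" "\<And>p. p \<in> set ps \<Longrightarrow> prime p" "G \<in> V" "euler_rel ps F G"
  shows "(\<lambda>N. nrm ((1 / real N) *\<^sub>R part_sum ps F N - G)) \<longlonglongrightarrow> 0"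
  using assms(2-)
proof (induction ps arbitrary: G)
  case Nil
  have "\<forall>\<^sub>F N in sequentially. nrm ((1 / real N) *\<^sub>R part_sum [] F N - G) = 0"
    using eventually_gt_at_top[of 0]
  proof eventually_elim
    case (elim N)
    have "part_sum [] F N = real N *\<^sub>R F" using F U_1 by (simp add: part_sum_def sum_constant_scaleR)
    then show ?case using elim Nil by simp
  qed
  then show ?case by (rule tendsto_eventually)
next
  case (Cons p ps)
  obtain H where H: "H \<in> V" "euler_rel ps F H" "nrm (G - (1 - 1 / p) *\<^sub>R H - (1 / p) *\<^sub>R U p G) = 0"
    using Cons.prems by auto
  have p: "prime p" "p \<notin> set ps" "p > 0" "p \<ge> 2" and ps: "\<And>q. q \<in> set ps \<Longrightarrow> prime q"
    using Cons.prems prime_gt_0_nat prime_ge_2_nat by auto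
  have GV: "G \<in> V" "U p G \<in> V" using Cons.prems p by auto
  define h where "h N = nrm (part_sum ps F N - real N *\<^sub>R H)" for N
  define e where "e N = nrm (part_sum (p # ps) F N - real N *\<^sub>R G)" for N
  have V1: "part_sum ps F N \<in> V" for N using F ps by (rule part_sum_in)
  have V2: "part_sum (p # ps) F N \<in> V" for N using F Cons.prems(2) by (rule part_sum_in)
  have IH: "(\<lambda>N. h N / N) \<longlonglongrightarrow> 0"
  proof -
    have "(\<lambda>N. nrm ((1 / real N) *\<^sub>R part_sum ps F N - H)) \<longlonglongrightarrow> 0" using Cons.prems H by (intro Cons.IH) auto
    moreover have "\<forall>\<^sub>F N in sequentially. nrm ((1 / real N) *\<^sub>R part_sum ps F N - H) = h N / N"
      using eventually_gt_at_top[of 0]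
    proof eventually_elim
      case (elim N)
      then have "(1 / real N) *\<^sub>R part_sum ps F N - H = (1 / real N) *\<^sub>R (part_sum ps F N - real N *\<^sub>R H)"
        by (simp add: scaleR_diff_right)
      then show ?case using V1 H(1) by (simp add: nrm_scale h_def)
    qed
    ultimately show ?thesis by (rule Lim_transform_eventually)
  qed
  have e_tendsto: "(\<lambda>N. e N / N) \<longlonglongrightarrow> 0"
  proof (rule halving_recursion_tendsto_zero[where r = "\<lambda>N. h N + h (N div p) + nrm H + nrm G", OF p(4)])
    show "e N \<ge> 0" for N using V2 GV by (simp add: e_def)
    show "e N \<le> (h N + h (N div p) + nrm H + nrm G) + e (N div p)" for N
    proof -
      define d where "d = N div p"
      define a where "a = part_sum ps F N - real N *\<^sub>R H"
      define b where "b = part_sum ps F d - real d *\<^sub>R H"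
      define c where "c = U p (part_sum (p # ps) F d - real d *\<^sub>R G)"
      \<comment> \<open>Rounding error of \<open>N div p\<close>; it accounts for the summands
        \<open>nrm H + nrm G\<close> of the remainder.\<close>
      define \<gamma> where "\<gamma> = real d - real N / real p"
      define D where "D = G - (1 - 1 / p) *\<^sub>R H - (1 / p) *\<^sub>R U p G"
      have V: "a \<in> V" "b \<in> V" "c \<in> V" "D \<in> V" using V1 V2 H GV p(3) by (auto simp: a_def b_def c_def D_def)
      have \<gamma>: "\<bar>\<gamma>\<bar> \<le> 1"
      proof -
        have "real N / p < real d + 1" unfolding d_def using p(3)
          by (metis floor_divide_of_nat_eq floor_less_iff of_int_of_nat_eq real_of_int_floor_add_one_gt)
        moreover have "real d \<le> real N / p" unfolding d_def by (rule of_nat_div_le_of_nat)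
        ultimately show ?thesis by (simp add: \<gamma>_def)
      qed
      have "U p (part_sum (p # ps) F d) = c + real d *\<^sub>R U p G"
        using V2 GV Cons.prems p by (simp add: c_def U_diff U_scale)
      moreover have "part_sum (p # ps) F N = part_sum ps F N - part_sum ps F d + U p (part_sum (p # ps) F d)"
        unfolding d_def by (rule part_sum_Cons[OF F ps p(1,2)])
      ultimately have "part_sum (p # ps) F N - real N *\<^sub>R G = a - b + c + (\<gamma> *\<^sub>R U p G - \<gamma> *\<^sub>R H) - real N *\<^sub>R D"
        by (simp add: a_def b_def \<gamma>_def D_def algebra_simps)
      then have "e N \<le> nrm (a - b + c + (\<gamma> *\<^sub>R U p G - \<gamma> *\<^sub>R H)) + nrm (real N *\<^sub>R D)"
        unfolding e_def using V H GV by (auto intro!: nrm_triangle_diff)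
      also have "nrm (real N *\<^sub>R D) = 0" using H(3) V by (simp add: nrm_scale D_def)
      also have "nrm (a - b + c + (\<gamma> *\<^sub>R U p G - \<gamma> *\<^sub>R H)) \<le> nrm (a - b + c) + nrm (\<gamma> *\<^sub>R U p G - \<gamma> *\<^sub>R H)"
        using V H GV by (intro nrm_triangle) auto
      also have "nrm (a - b + c) \<le> nrm (a - b) + nrm c" using V by (intro nrm_triangle) auto
      also have "nrm (a - b) \<le> nrm a + nrm b" using V by (intro nrm_triangle_diff) auto
      also have "nrm (\<gamma> *\<^sub>R U p G - \<gamma> *\<^sub>R H) \<le> nrm (\<gamma> *\<^sub>R U p G) + nrm (\<gamma> *\<^sub>R H)"
        using H GV by (intro nrm_triangle_diff) auto
      also have "nrm (\<gamma> *\<^sub>R U p G) \<le> nrm G" using \<gamma> GV p Cons.prems by (simp add: nrm_scale mult_left_le_one_le)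
      also have "nrm (\<gamma> *\<^sub>R H) \<le> nrm H" using \<gamma> H by (simp add: nrm_scale mult_left_le_one_le)
      also have "nrm c = e d" using V2 GV p Cons.prems by (simp add: c_def e_def)
      finally show ?thesis by (simp add: a_def b_def h_def d_def)
    qed
    have "(\<lambda>N. h (N div p) / N) \<longlonglongrightarrow> 0"
    proof (rule tendsto_sandwich[where f = "\<lambda>_. 0" and h = "\<lambda>N. h (N div p) / real (N div p)"])
      have "filterlim (\<lambda>N. N div p) at_top sequentially"
        unfolding filterlim_at_top
      proof
        fix Z show "\<forall>\<^sub>F N in sequentially. Z \<le> N div p"
          using eventually_ge_at_top[of "Z * p"]
          by eventually_elim (use p(3) in \<open>simp add: less_eq_div_iff_mult_less_eq\<close>)
      qed
      then show "(\<lambda>N. h (N div p) / real (N div p)) \<longlonglongrightarrow> 0" by (rule filterlim_compose[OF IH])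
      show "\<forall>\<^sub>F N in sequentially. h (N div p) / N \<le> h (N div p) / real (N div p)"
        using eventually_ge_at_top[of p]
      proof eventually_elim
        case (elim N)
        have "N div p > 0" "N > 0" using elim p(3) by (auto simp: div_greater_zero_iff)
        then show ?case using V1 H(1) by (intro divide_left_mono) (auto simp: h_def intro!: mult_pos_pos)
      qed
      show "\<forall>\<^sub>F N in sequentially. 0 \<le> h (N div p) / N" using V1 H(1) by (simp add: h_def)
    qed auto
    then have "(\<lambda>N. h N / N + h (N div p) / N + (nrm H + nrm G) / N) \<longlonglongrightarrow> 0 + 0 + 0"
      by (intro tendsto_add IH lim_const_over_n)
    then show "(\<lambda>N. (h N + h (N div p) + nrm H + nrm G) / N) \<longlonglongrightarrow> 0"
      by (simp add: add_divide_distrib add.assoc)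
  qed
  moreover have "\<forall>\<^sub>F N in sequentially. e N / N = nrm ((1 / real N) *\<^sub>R part_sum (p # ps) F N - G)"
    using eventually_gt_at_top[of 0]
  proof eventually_elim
    case (elim N)
    then have "(1 / real N) *\<^sub>R part_sum (p # ps) F N - G = (1 / real N) *\<^sub>R (part_sum (p # ps) F N - real N *\<^sub>R G)"
      by (simp add: scaleR_diff_right)
    then show ?case using V2 GV by (simp add: nrm_scale e_def)
  qed
  ultimately show ?case by (rule Lim_transform_eventually)
qed

text \<open>\<open>U p / p\<close> contracts by a factor of at most 1/2, so
  \<open>1 - U p / p\<close> is injective up to null vectors.\<close>

lemma fixpoint_zero:
  assumes "E \<in> V" "prime p" "nrm (E - (1 / p) *\<^sub>R U p E) = 0"
  shows "nrm E = 0"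
proof -
  have p: "p > 0" "p \<ge> 2" using assms(2) prime_gt_0_nat prime_ge_2_nat by auto
  have "U p E \<in> V" using assms(1) p(1) by auto
  then have "nrm E \<le> nrm ((1 / p) *\<^sub>R U p E) + nrm (E - (1 / p) *\<^sub>R U p E)"
    using assms(1) by (intro nrm_le_dist) auto
  also have "\<dots> = nrm E / p" using assms p by (simp add: nrm_scale U_in)
  also have "\<dots> \<le> nrm E / 2" using p assms by (intro divide_left_mono) auto
  finally show ?thesis using nrm_nonneg[OF assms(1)] by linarith
qed

lemma nrm_zero_add:
  assumes "x \<in> V" "y \<in> V" "nrm x = 0" "nrm y = 0"
  shows "nrm (x + y) = 0"
  using nrm_triangle[OF assms(1,2)] nrm_nonneg[OF V_add[OF assms(1,2)]] assms(3,4) by linarith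

lemma nrm_zero_diff:
  assumes "x \<in> V" "y \<in> V" "nrm x = 0" "nrm y = 0"
  shows "nrm (x - y) = 0"
  using nrm_triangle_diff[OF assms(1,2)] nrm_nonneg[OF V_diff[OF assms(1,2)]] assms(3,4) by linarith

text \<open>\<open>U q\<close> commutes with the Euler factors, so \<open>U q G - G\<close> solves
  the homogeneous equation for each of them.\<close>

lemma euler_rel_invariant:
  assumes "F \<in> V" "q > 0" "nrm (U q F - F) = 0" "\<And>p. p \<in> set ps \<Longrightarrow> prime p" "G \<in> V" "euler_rel ps F G"
  shows "nrm (U q G - G) = 0"
  using assms(4-)
proof (induction ps arbitrary: G)
  case Nil
  have "U q G - G = (U q F - F) - (U q (F - G) - (F - G))" using assms Nil by (simp add: U_diff)
  also have "nrm \<dots> = 0"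
    using assms Nil
    by (intro nrm_zero_diff[of "U q F - F"] nrm_zero_diff[of "U q (F - G)"]) (auto simp: U_in)
  finally show ?case .
next
  case (Cons p ps)
  obtain H where H: "H \<in> V" "euler_rel ps F H" "nrm (G - (1 - 1 / p) *\<^sub>R H - (1 / p) *\<^sub>R U p G) = 0"
    using Cons.prems by auto
  have p: "prime p" "p > 0" using Cons.prems prime_gt_0_nat by auto
  have IH: "nrm (U q H - H) = 0" using Cons.prems H by (intro Cons.IH) auto
  define D where "D = G - (1 - 1 / p) *\<^sub>R H - (1 / p) *\<^sub>R U p G"
  have V: "G \<in> V" "H \<in> V" "U p G \<in> V" "U q G \<in> V" "U q H \<in> V" "D \<in> V" "U q D \<in> V" "U p (U q G) \<in> V" "U q (U p G) \<in> V"
    using Cons.prems H p assms(2) by (auto simp: D_def intro!: U_in V_diff V_scale)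
  show ?case
  proof (rule fixpoint_zero[OF _ p(1)])
    have "U q D = U q G - (1 - 1 / p) *\<^sub>R U q H - (1 / p) *\<^sub>R U q (U p G)"
      unfolding D_def using V assms(2) by (simp add: U_diff U_scale)
    then have "(U q G - G) - (1 / p) *\<^sub>R U p (U q G - G) = U q D - D + (1 - 1 / p) *\<^sub>R (U q H - H)"
      using V p assms(2) by (simp add: D_def U_diff U_scale U_commute[of p q] algebra_simps)
    also have "nrm \<dots> = 0"
      using H(3) IH V assms(2) by (intro nrm_zero_add nrm_zero_diff) (auto simp: D_def nrm_scale)
    finally show "nrm (U q G - G - (1 / p) *\<^sub>R U p (U q G - G)) = 0" .
  qed (use V in auto)
qed

text \<open>With \<open>a = 1 / p\<close>, one factor gives
  \<open>(1 - a) * nrm H \<le> (1 + a) * nrm G\<close>, and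
  \<open>(1 + a) / (1 - a) \<le> exp (4 * a)\<close> for \<open>a \<le> 1 / 2\<close>. For
  \<open>p\<close> in \<open>D\<close> the vector \<open>H\<close> is fixed by \<open>U p\<close>,
  so the factor is the identity; thus only the primes outside \<open>D\<close>, with their
  convergent sum, enter the exponent.\<close>

lemma euler_rel_lower_bound:
  assumes F: "F \<in> V" and D: "\<And>p. p \<in> D \<Longrightarrow> prime p \<Longrightarrow> nrm (U p F - F) = 0"
    and "distinct ps" "\<And>p. p \<in> set ps \<Longrightarrow> prime p" "G \<in> V" "euler_rel ps F G"
  shows "nrm F \<le> exp (4 * (\<Sum>p\<in>set ps - D. 1 / real p)) * nrm G"
  using assms(3-)
proof (induction ps arbitrary: G)
  case Nil
  then show ?case using nrm_le_dist[of F G] F by simp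
next
  case (Cons p ps)
  obtain H where H: "H \<in> V" "euler_rel ps F H" "nrm (G - (1 - 1 / p) *\<^sub>R H - (1 / p) *\<^sub>R U p G) = 0"
    using Cons.prems by auto
  have p: "prime p" "p > 0" "p \<ge> 2" "p \<notin> set ps" using Cons.prems prime_gt_0_nat prime_ge_2_nat by auto
  have V: "G \<in> V" "H \<in> V" "U p G \<in> V" "U p H \<in> V" using Cons.prems H p by auto
  define X where "X = G - (1 - 1 / p) *\<^sub>R H - (1 / p) *\<^sub>R U p G"
  have XV: "X \<in> V" using V by (auto simp: X_def)
  have IH: "nrm F \<le> exp (4 * (\<Sum>p\<in>set ps - D. 1 / real p)) * nrm H"
    using Cons.prems H by (intro Cons.IH) auto
  show ?case
  proof (cases "p \<in> D")
    case True
    have inv: "nrm (U p H - H) = 0"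
      using euler_rel_invariant[OF F p(2) D[OF True p(1)] _ H(1,2)] Cons.prems(2) by auto
    have "nrm (G - H) = 0"
    proof (rule fixpoint_zero[OF _ p(1)])
      have "G - H - (1 / p) *\<^sub>R U p (G - H) = X + (1 / p) *\<^sub>R (U p H - H)"
        using V p by (simp add: X_def U_diff algebra_simps)
      also have "nrm \<dots> = 0" using inv H(3) V XV by (intro nrm_zero_add) (auto simp: X_def nrm_scale)
      finally show "nrm (G - H - (1 / real p) *\<^sub>R U p (G - H)) = 0" .
    qed (use V in auto)
    then have "nrm H \<le> nrm G" using nrm_le_dist[of H G] V nrm_minus_commute[of G H] by simp
    then have "exp (4 * (\<Sum>p\<in>set ps - D. 1 / real p)) * nrm H \<le> exp (4 * (\<Sum>p\<in>set ps - D. 1 / real p)) * nrm G"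
      by (intro mult_left_mono) auto
    moreover have eq: "set (p # ps) - D = set ps - D" using True by auto
    ultimately show ?thesis unfolding eq using IH by linarith
  next
    case False
    define a where "a = 1 / real p"
    have a: "0 < a" "a \<le> 1 / 2" using p by (auto simp: a_def)
    have "(1 - a) * nrm H = nrm ((1 - a) *\<^sub>R H)" using V a by (simp add: nrm_scale)
    also have "(1 - a) *\<^sub>R H = (G - a *\<^sub>R U p G) - X" by (simp add: X_def a_def)
    also have "nrm \<dots> \<le> nrm (G - a *\<^sub>R U p G) + nrm X" using V XV by (intro nrm_triangle_diff) auto
    also have "nrm X = 0" using H(3) by (simp add: X_def)
    also have "nrm (G - a *\<^sub>R U p G) \<le> nrm G + nrm (a *\<^sub>R U p G)" using V by (intro nrm_triangle_diff) auto
    also have "\<dots> = (1 + a) * nrm G" using V a p by (simp add: nrm_scale algebra_simps)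
    finally have 1: "(1 - a) * nrm H \<le> (1 + a) * nrm G" by simp
    have "1 + a \<le> exp (4 * a) * (1 - a)"
    proof -
      have "1 + a \<le> (1 + 4 * a) * (1 - a)"
        using mult_left_mono[OF a(2), of a] a(1) by (simp add: algebra_simps)
      also have "\<dots> \<le> exp (4 * a) * (1 - a)" using a exp_ge_add_one_self[of "4 * a"] by (intro mult_right_mono) auto
      finally show ?thesis .
    qed
    then have "(1 + a) * nrm G \<le> exp (4 * a) * (1 - a) * nrm G" using V by (intro mult_right_mono) auto
    then have "(1 - a) * nrm H \<le> (1 - a) * (exp (4 * a) * nrm G)" using 1 by (simp add: mult_ac)
    then have "nrm H \<le> exp (4 * a) * nrm G" using a by simp
    then have "exp (4 * (\<Sum>p\<in>set ps - D. 1 / real p)) * nrm H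
        \<le> exp (4 * (\<Sum>p\<in>set ps - D. 1 / real p)) * (exp (4 * a) * nrm G)" by (intro mult_left_mono) auto
    also have "\<dots> = exp (4 * (\<Sum>p\<in>set (p # ps) - D. 1 / real p)) * nrm G"
    proof -
      have "set (p # ps) - D = insert p (set ps - D)" using False by auto
      then have "(\<Sum>p\<in>set (p # ps) - D. 1 / real p) = a + (\<Sum>p\<in>set ps - D. 1 / real p)"
        using p by (simp add: a_def)
      then show ?thesis by (simp add: exp_add distrib_left mult_ac)
    qed
    finally show ?thesis using IH by linarith
  qed
qed

end

section \<open>Projections and recurrent primes\<close>

lemma smooth_part_decompose:
  assumes "n > 0" "distinct ps" "\<And>p. p \<in> set ps \<Longrightarrow> prime p"
  shows "\<exists>r>0. n = smooth_part ps n * r \<and> (\<forall>p\<in>set ps. \<not> p dvd r)"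
  using assms(2,3)
proof (induction ps)
  case Nil
  then show ?case using assms(1) by auto
next
  case (Cons p ps)
  have p: "prime p" "p \<notin> set ps" and ps: "\<And>q. q \<in> set ps \<Longrightarrow> prime q" using Cons.prems by auto
  obtain r where r: "r > 0" "n = smooth_part ps n * r" "\<And>q. q \<in> set ps \<Longrightarrow> \<not> q dvd r"
    using Cons by auto
  have "\<not> p dvd smooth_part ps n"
  proof
    assume "p dvd smooth_part ps n"
    then obtain q where "q \<in> set ps" "p dvd q ^ multiplicity q n"
      unfolding smooth_part_def using p(1) by (auto simp: prime_dvd_prod_iff)
    then have "p dvd q" using p(1) prime_dvd_power by blast
    then have "p = q" using p(1) ps \<open>q \<in> set ps\<close> by (intro primes_dvd_imp_eq) auto
    then show False using p(2) \<open>q \<in> set ps\<close> by simp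
  qed
  then have "multiplicity p n = multiplicity p r"
    using r(1) p(1) smooth_part_pos[of ps n] ps
    by (subst r(2), subst prime_elem_multiplicity_mult_distrib) (auto simp: not_dvd_imp_multiplicity_0)
  moreover obtain r' where r': "r = p ^ multiplicity p r * r'" "\<not> p dvd r'"
    using multiplicity_decompose'[of r p] r(1) p(1) not_prime_unit[of p] by blast
  ultimately have "n = smooth_part ps n * (p ^ multiplicity p n * r')"
    using r(2) by metis
  then have "n = smooth_part (p # ps) n * r'"
    using p(2) by (simp add: smooth_part_def mult_ac)
  moreover have "r' > 0" using r' r(1) by (auto intro: Nat.gr0I)
  moreover have "\<not> q dvd r'" if "q \<in> set (p # ps)" for q
    using that r(3)[of q] r' by (metis dvd_mult set_ConsD)
  ultimately show ?case by blast
qed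

definition primes_upto :: "nat \<Rightarrow> nat list" where
  "primes_upto y = filter prime [1..<Suc y]"

lemma set_primes_upto: "set (primes_upto y) = {p. prime p \<and> p \<le> y}"
  by (auto simp: primes_upto_def simp del: upt_Suc dest: prime_gt_0_nat)

lemma distinct_primes_upto: "distinct (primes_upto y)"
  by (simp add: primes_upto_def)

text \<open>The first variation at a minimum vanishes: for small \<open>t\<close> the linear term
  would outweigh the quadratic one.\<close>

lemma zero_if_quadratic_nonneg:
  fixes b c :: real
  assumes "\<And>t. 2 * t * b \<le> t\<^sup>2 * c"
  shows "b = 0"
proof (rule ccontr)
  assume b: "b \<noteq> 0"
  define d where "d = \<bar>c\<bar> + 1"
  have d: "d > 0" "c \<le> d" by (auto simp: d_def)
  have "2 * (b / d) * b \<le> (b / d)\<^sup>2 * c" by (rule assms)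
  also have "\<dots> \<le> (b / d)\<^sup>2 * d" using d by (intro mult_left_mono) auto
  also have "\<dots> = (b / d) * b" using d by (simp add: power2_eq_square)
  finally have "b * b / d \<le> 0" by simp
  then have "b * b \<le> 0" using d by (simp add: divide_le_0_iff)
  then show False using b not_real_square_gt_zero[of b] by linarith
qed

locale complete_mult_isometries = mult_isometries +
  assumes complete: "(\<And>n. X n \<in> V) \<Longrightarrow>
    (\<And>e. e > 0 \<Longrightarrow> \<exists>N. \<forall>m\<ge>N. \<forall>n\<ge>N. nrm (X m - X n) < e) \<Longrightarrow>
    \<exists>l\<in>V. (\<lambda>n. nrm (X n - l)) \<longlonglongrightarrow> 0"
begin

text \<open>\<open>W\<close> need not be closed, so the nearest point is represented by a sequence
  \<open>w n\<close> in \<open>W\<close>. A minimising sequence is Cauchy by the parallelogram law,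
  because midpoints stay in \<open>W\<close>; orthogonality of the remainder \<open>G\<close>
  follows by varying along a line.\<close>

lemma projection:
  assumes W: "subspace W" "W \<subseteq> V" and F: "F \<in> V"
  obtains G w where "G \<in> V" "\<And>n. w n \<in> W" "(\<lambda>n. nrm (F - G - w n)) \<longlonglongrightarrow> 0"
    "\<And>u. u \<in> W \<Longrightarrow> ip G u = 0"
proof -
  define d where "d = Inf ((\<lambda>w. nrm (F - w)) ` W)"
  have ne: "(\<lambda>w. nrm (F - w)) ` W \<noteq> {}" using subspace_0[OF W(1)] by auto
  have FW: "F - w \<in> V" if "w \<in> W" for w using that F W by auto
  have bdd: "bdd_below ((\<lambda>w. nrm (F - w)) ` W)" using FW by (intro bdd_belowI[of _ 0]) auto
  have d0: "d \<ge> 0" unfolding d_def using ne FW by (intro cInf_greatest) auto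
  have dle: "d \<le> nrm (F - w)" if "w \<in> W" for w unfolding d_def using that bdd by (intro cInf_lower) auto
  have "\<exists>w\<in>W. nrm (F - w) < d + 1 / real (Suc n)" for n
    using cInf_lessD[OF ne, of "d + 1 / real (Suc n)"] by (auto simp: d_def)
  then obtain w where w: "\<And>n. w n \<in> W" "\<And>n. nrm (F - w n) < d + 1 / real (Suc n)" by metis
  have wV: "w n \<in> V" for n using w(1) W(2) by auto
  have par: "(nrm (w m - w n))\<^sup>2 \<le> 2 * (nrm (F - w m))\<^sup>2 + 2 * (nrm (F - w n))\<^sup>2 - 4 * d\<^sup>2" for m n
  proof -
    define a where "a = F - w m"
    define b where "b = F - w n"
    have V: "a \<in> V" "b \<in> V" using F wV by (auto simp: a_def b_def)
    have "(1/2) *\<^sub>R (w m + w n) \<in> W" using w(1) W(1) by (intro subspace_scale subspace_add)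
    then have "d \<le> nrm (F - (1/2) *\<^sub>R (w m + w n))" by (rule dle)
    also have "F - (1/2) *\<^sub>R (w m + w n) = (1/2) *\<^sub>R (a + b)"
      by (simp add: a_def b_def algebra_simps flip: scaleR_left.add)
    finally have "2 * d \<le> nrm (a + b)" using V by (simp add: nrm_scale)
    then have "(2 * d)\<^sup>2 \<le> (nrm (a + b))\<^sup>2" using d0 by (intro power_mono) auto
    moreover have "(nrm (a + b))\<^sup>2 + (nrm (b - a))\<^sup>2 = 2 * (nrm a)\<^sup>2 + 2 * (nrm b)\<^sup>2"
      using V ip_commute[of a b] by (simp add: nrm_square_add nrm_square_diff)
    moreover have "b - a = w m - w n" by (simp add: a_def b_def)
    ultimately show ?thesis by (simp add: a_def b_def power_mult_distrib)
  qed
  define r where "r n = (d + 1 / real (Suc n))\<^sup>2 - d\<^sup>2" for n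
  have r0: "r \<longlonglongrightarrow> 0"
  proof -
    have "(\<lambda>n. (d + 1 / real (Suc n))\<^sup>2 - d\<^sup>2) \<longlonglongrightarrow> (d + 0)\<^sup>2 - d\<^sup>2"
      by (intro tendsto_intros LIMSEQ_Suc[OF lim_1_over_n])
    then show ?thesis by (simp add: r_def[abs_def])
  qed
  have rb: "(nrm (F - w n))\<^sup>2 \<le> d\<^sup>2 + r n" for n
    unfolding r_def using w(2)[of n] FW[OF w(1)[of n]] power_mono[of "nrm (F - w n)" "d + 1 / real (Suc n)" 2] by simp
  have "\<exists>N. \<forall>m\<ge>N. \<forall>n\<ge>N. nrm (w m - w n) < e" if "e > 0" for e
  proof -
    have "\<forall>\<^sub>F n in sequentially. r n < e\<^sup>2 / 4" using r0 that by (intro order_tendstoD) auto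
    then obtain N where N: "\<And>n. n \<ge> N \<Longrightarrow> r n < e\<^sup>2 / 4" by (auto simp: eventually_sequentially)
    have "nrm (w m - w n) < e" if "m \<ge> N" "n \<ge> N" for m n
    proof -
      have "(nrm (w m - w n))\<^sup>2 < e\<^sup>2" using par[of m n] rb[of m] rb[of n] N[OF that(1)] N[OF that(2)] by linarith
      then show ?thesis using \<open>e > 0\<close> by (simp add: power2_less_imp_less)
    qed
    then show ?thesis by blast
  qed
  then obtain l where l: "l \<in> V" "(\<lambda>n. nrm (w n - l)) \<longlonglongrightarrow> 0" using complete[of w] wV by blast
  define G where "G = F - l"
  have GV: "G \<in> V" using F l by (simp add: G_def)
  have lim: "(\<lambda>n. nrm (F - G - w n)) \<longlonglongrightarrow> 0"
  proof -
    have "nrm (F - G - w n) = nrm (w n - l)" for n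
      unfolding G_def using nrm_minus_commute[OF wV l(1), of n] by simp
    then show ?thesis using l(2) by simp
  qed
  have Gd: "nrm G \<le> d"
  proof (rule LIMSEQ_le)
    show "(\<lambda>n. d + 1 / real (Suc n) + nrm (F - G - w n)) \<longlonglongrightarrow> d"
      using tendsto_add[OF tendsto_add[OF tendsto_const LIMSEQ_Suc[OF lim_1_over_n]] lim, of d] by simp
    show "(\<lambda>n. nrm G) \<longlonglongrightarrow> nrm G" by (rule tendsto_const)
    have "nrm G \<le> d + 1 / real (Suc n) + nrm (F - G - w n)" for n
    proof -
      have "nrm G \<le> nrm (F - w n) + nrm (G - (F - w n))" using GV FW[OF w(1)] by (intro nrm_le_dist) auto
      also have "nrm (G - (F - w n)) = nrm (F - w n - G)" using GV FW[OF w(1)] by (intro nrm_minus_commute) auto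
      finally show ?thesis using w(2)[of n] by (simp add: algebra_simps)
    qed
    then show "\<exists>N. \<forall>n\<ge>N. nrm G \<le> d + 1 / real (Suc n) + nrm (F - G - w n)" by blast
  qed
  have dG: "d \<le> nrm (G - u)" if "u \<in> W" for u
  proof (rule LIMSEQ_le)
    have uV: "u \<in> V" using that W by auto
    show "(\<lambda>n. nrm (G - u) + nrm (F - G - w n)) \<longlonglongrightarrow> nrm (G - u)"
      using tendsto_add[OF tendsto_const lim, of "nrm (G - u)"] by simp
    show "(\<lambda>n. d) \<longlonglongrightarrow> d" by (rule tendsto_const)
    have "d \<le> nrm (G - u) + nrm (F - G - w n)" for n
    proof -
      have "d \<le> nrm (F - (w n + u))" using w(1) that W(1) by (intro dle subspace_add)
      also have "F - (w n + u) = (G - u) + (F - G - w n)" by (simp add: algebra_simps)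
      also have "nrm \<dots> \<le> nrm (G - u) + nrm (F - G - w n)" using GV uV F wV by (intro nrm_triangle) auto
      finally show ?thesis .
    qed
    then show "\<exists>N. \<forall>n\<ge>N. d \<le> nrm (G - u) + nrm (F - G - w n)" by blast
  qed
  have "ip G u = 0" if "u \<in> W" for u
  proof (rule zero_if_quadratic_nonneg)
    fix t :: real
    have uV: "u \<in> V" using that W by auto
    have "nrm G \<le> nrm (G - t *\<^sub>R u)" using Gd dG[of "t *\<^sub>R u"] that W(1) by (simp add: subspace_scale)
    then have "(nrm G)\<^sup>2 \<le> (nrm (G - t *\<^sub>R u))\<^sup>2" using GV by (intro power_mono) auto
    then show "2 * t * ip G u \<le> t\<^sup>2 * (nrm u)\<^sup>2"
      using GV uV by (simp add: nrm_square_diff ip_scale_right nrm_scale power_mult_distrib)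
  qed
  then show ?thesis using that[of G w] GV w(1) lim by blast
qed

lemma U_invariant_if_prime_divisors_invariant:
  assumes "F \<in> V" "k > 0" "\<And>p. prime p \<Longrightarrow> p dvd k \<Longrightarrow> nrm (U p F - F) = 0"
  shows "nrm (U k F - F) = 0"
  using assms(2,3)
proof (induction k rule: less_induct)
  case (less k)
  show ?case
  proof (cases "k = 1")
    case True
    then show ?thesis using U_1[OF assms(1)] by simp
  next
    case False
    then obtain p where p: "prime p" "p dvd k" using prime_factor_nat by blast
    then obtain j where j: "k = p * j" by auto
    have j0: "j > 0" "j < k" "p > 0" using less.prems(1) p(1) j prime_gt_1_nat[of p] by auto
    have inv: "nrm (U j F - F) = 0" "nrm (U p F - F) = 0" using less j j0 p by auto
    have eq: "U k F - F = U p (U j F - F) + (U p F - F)"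
      using j j0 assms(1) by (simp add: U_mult U_diff U_in)
    show ?thesis unfolding eq
      by (rule nrm_zero_add) (use inv j0 assms(1) in \<open>auto simp: U_in\<close>)
  qed
qed

text \<open>\<open>U n F\<close> and \<open>U (smooth_part n) F\<close> differ by a null vector
  unless some prime \<open>p > y\<close> outside \<open>D\<close> divides \<open>n\<close>, and at
  most \<open>N / p\<close> of the numbers up to \<open>N\<close> are multiples of
  \<open>p\<close>.\<close>

lemma avg_smooth_part_dist:
  assumes F: "F \<in> V" and inv: "\<And>p. p \<in> D \<Longrightarrow> prime p \<Longrightarrow> nrm (U p F - F) = 0"
    and tail: "\<And>B. finite B \<Longrightarrow> B \<subseteq> {p. prime p \<and> p \<notin> D} \<inter> {y0<..} \<Longrightarrow> (\<Sum>p\<in>B. 1 / real p) < \<epsilon>"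
    and y: "y0 \<le> y" and N: "N > 0"
  shows "nrm (avg F N - (1 / real N) *\<^sub>R part_sum (primes_upto y) F N) \<le> 2 * \<epsilon> * nrm F"
proof -
  let ?ps = "primes_upto y"
  have ps: "\<And>p. p \<in> set ?ps \<Longrightarrow> prime p" by (simp add: set_primes_upto)
  define B where "B = {p. prime p \<and> p \<notin> D \<and> y < p \<and> p \<le> N}"
  have finB: "finite B" unfolding B_def by (rule finite_subset[of _ "{..N}"]) auto
  have sp: "smooth_part ?ps n > 0" for n using ps by (rule smooth_part_pos)
  have diff_le: "nrm (U n F - U (smooth_part ?ps n) F) \<le> (\<Sum>p\<in>B. if p dvd n then 2 * nrm F else 0)"
    if n: "n \<in> {1..N}" for n
  proof (cases "\<exists>p\<in>B. p dvd n")
    case True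
    then obtain p where p: "p \<in> B" "p dvd n" by auto
    have "nrm (U n F - U (smooth_part ?ps n) F) \<le> nrm (U n F) + nrm (U (smooth_part ?ps n) F)"
      using F n sp by (intro nrm_triangle_diff) auto
    also have "\<dots> = (if p dvd n then 2 * nrm F else 0)" using F n sp p by simp
    also have "\<dots> \<le> (\<Sum>p\<in>B. if p dvd n then 2 * nrm F else 0)"
      using finB p(1) F by (intro member_le_sum) auto
    finally show ?thesis .
  next
    case False
    obtain r where r: "r > 0" "n = smooth_part ?ps n * r" "\<And>p. p \<in> set ?ps \<Longrightarrow> \<not> p dvd r"
      using smooth_part_decompose[OF _ distinct_primes_upto, of n y] ps n by auto
    have "nrm (U r F - F) = 0"
    proof (rule U_invariant_if_prime_divisors_invariant[OF F r(1)])
      fix p assume p: "prime p" "p dvd r"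
      have "p dvd n" using p(2) r(2) by (metis dvd_mult)
      then have "p \<le> n" using n by (intro dvd_imp_le) auto
      then have "p \<le> N" "p \<notin> B" using False n \<open>p dvd n\<close> by auto
      moreover have "y < p" using r(3)[of p] p by (auto simp: set_primes_upto not_le[symmetric])
      ultimately have "p \<in> D" using p by (auto simp: B_def)
      then show "nrm (U p F - F) = 0" using inv p by simp
    qed
    moreover have "U n F - U (smooth_part ?ps n) F = U (smooth_part ?ps n) (U r F - F)"
      using r(1) sp F by (subst (1) r(2)) (simp add: U_mult U_diff U_in)
    ultimately have "nrm (U n F - U (smooth_part ?ps n) F) = 0" using r(1) sp F by (simp add: U_in)
    moreover have "0 \<le> (\<Sum>p\<in>B. if p dvd n then 2 * nrm F else 0)" using F by (intro sum_nonneg) auto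
    ultimately show ?thesis by linarith
  qed
  have "avg F N - (1 / real N) *\<^sub>R part_sum ?ps F N = (1 / real N) *\<^sub>R (\<Sum>n\<in>{1..N}. U n F - U (smooth_part ?ps n) F)"
    by (simp add: avg_def psum_def part_sum_def sum_subtractf scaleR_diff_right)
  moreover have V: "(\<Sum>n\<in>{1..N}. U n F - U (smooth_part ?ps n) F) \<in> V"
    using F sp by (intro V_sum V_diff U_in) auto
  ultimately have "nrm (avg F N - (1 / real N) *\<^sub>R part_sum ?ps F N) = nrm (\<Sum>n\<in>{1..N}. U n F - U (smooth_part ?ps n) F) / N"
    by (simp add: nrm_scale)
  also have "\<dots> \<le> (\<Sum>n\<in>{1..N}. nrm (U n F - U (smooth_part ?ps n) F)) / N"
    using F sp by (intro divide_right_mono nrm_sum_le V_diff U_in) auto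
  also have "\<dots> \<le> (\<Sum>n\<in>{1..N}. \<Sum>p\<in>B. if p dvd n then 2 * nrm F else 0) / N"
    by (intro divide_right_mono sum_mono diff_le) auto
  also have "(\<Sum>n\<in>{1..N}. \<Sum>p\<in>B. if p dvd n then 2 * nrm F else 0) = (\<Sum>p\<in>B. \<Sum>n\<in>{1..N}. if p dvd n then 2 * nrm F else 0)"
    by (rule sum.swap)
  also have "\<dots> \<le> (\<Sum>p\<in>B. real N / p * (2 * nrm F))"
  proof (rule sum_mono)
    fix p assume p: "p \<in> B"
    then have p0: "p > 0" by (auto simp: B_def prime_gt_0_nat)
    have "(\<Sum>n\<in>{1..N}. if p dvd n then 2 * nrm F else 0) = card {n\<in>{1..N}. p dvd n} * (2 * nrm F)"
      by (simp add: sum.inter_filter[symmetric])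
    also have "card {n\<in>{1..N}. p dvd n} = card {1..N div p}"
      by (rule bij_betw_same_card[of "\<lambda>n. n div p"], rule bij_betw_byWitness[where f' = "\<lambda>k. p * k"])
         (use p0 in \<open>auto elim!: dvdE simp: less_eq_div_iff_mult_less_eq mult.commute\<close>)
    also have "real (card {1..N div p}) * (2 * nrm F) \<le> real N / p * (2 * nrm F)"
      using F of_nat_div_le_of_nat[of N p, where ?'a = real] by (intro mult_right_mono) auto
    finally show "(\<Sum>n\<in>{1..N}. if p dvd n then 2 * nrm F else 0) \<le> real N / p * (2 * nrm F)" .
  qed
  also have "\<dots> = real N * (2 * nrm F * (\<Sum>p\<in>B. 1 / real p))" by (simp add: sum_distrib_left mult_ac)
  finally have "nrm (avg F N - (1 / real N) *\<^sub>R part_sum ?ps F N) \<le> 2 * nrm F * (\<Sum>p\<in>B. 1 / real p)"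
    using N by (simp add: divide_right_mono)
  also have "\<dots> \<le> 2 * nrm F * \<epsilon>"
  proof (rule mult_left_mono)
    have "B \<subseteq> {p. prime p \<and> p \<notin> D} \<inter> {y0<..}" using y by (auto simp: B_def)
    from tail[OF finB this] show "(\<Sum>p\<in>B. 1 / real p) \<le> \<epsilon>" by simp
  qed (use F in simp)
  finally show ?thesis by (simp add: mult_ac)
qed

text \<open>The truncation error is uniform in \<open>N\<close>, so the limits in \<open>N\<close>
  and in \<open>y\<close> may be exchanged. Convergence of the Euler product is a result of this:
  for a common large \<open>N\<close>, the truncated averages at levels \<open>m\<close> and
  \<open>n\<close> are both close to \<open>avg F N\<close>, so \<open>E m\<close> and
  \<open>E n\<close> are close.\<close>

lemma avg_euler_tendsto:
  assumes F: "F \<in> V" and inv: "\<And>p. p \<in> D \<Longrightarrow> prime p \<Longrightarrow> nrm (U p F - F) = 0"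
    and summ: "(\<lambda>p. 1 / real p) summable_on {p. prime p \<and> p \<notin> D}"
    and E: "\<And>y. E y \<in> V" "\<And>y. euler_rel (primes_upto y) F (E y)"
  shows "\<exists>G\<in>V. (\<lambda>y. nrm (E y - G)) \<longlonglongrightarrow> 0 \<and> (\<lambda>N. nrm (avg F (real N) - G)) \<longlonglongrightarrow> 0"
proof -
  have ps: "\<And>p y. p \<in> set (primes_upto y) \<Longrightarrow> prime p" by (simp add: set_primes_upto)
  define A where "A y N = (1 / real N) *\<^sub>R part_sum (primes_upto y) F N" for y N
  have AV: "A y N \<in> V" for y N unfolding A_def using F ps by (intro V_scale part_sum_in) auto
  have Alim: "(\<lambda>N. nrm (A y N - E y)) \<longlonglongrightarrow> 0" for y
    unfolding A_def using part_avg_tendsto[OF F distinct_primes_upto _ E] ps by blast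
  have near: "\<exists>y0. \<forall>y\<ge>y0. \<forall>N>0. nrm (avg F (real N) - A y N) \<le> e" if "e > 0" for e
  proof -
    define \<epsilon> where "\<epsilon> = e / (2 * (nrm F + 1))"
    have \<epsilon>: "\<epsilon> > 0" "2 * \<epsilon> * nrm F \<le> e" using that nrm_nonneg[OF F] by (auto simp: \<epsilon>_def field_simps)
    obtain y0 where "\<forall>B. finite B \<longrightarrow> B \<subseteq> {p. prime p \<and> p \<notin> D} \<inter> {y0<..} \<longrightarrow> (\<Sum>p\<in>B. 1 / real p) < \<epsilon>"
      using summable_on_tail[OF summ _ \<epsilon>(1)] by auto
    then have "nrm (avg F (real N) - A y N) \<le> 2 * \<epsilon> * nrm F" if "y \<ge> y0" "N > 0" for y N
      unfolding A_def using that by (intro avg_smooth_part_dist[OF F inv]) auto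
    then show ?thesis using \<epsilon>(2) by (meson order_trans)
  qed
  have "\<exists>N. \<forall>m\<ge>N. \<forall>n\<ge>N. nrm (E m - E n) < e" if e: "e > 0" for e
  proof -
    obtain y0 where y0: "\<And>y N. y \<ge> y0 \<Longrightarrow> N > 0 \<Longrightarrow> nrm (avg F (real N) - A y N) \<le> e / 8"
      using near[of "e / 8"] e by auto
    have "nrm (E m - E n) < e" if mn: "m \<ge> y0" "n \<ge> y0" for m n
    proof -
      have "\<forall>\<^sub>F N in sequentially. nrm (A m N - E m) < e / 8" "\<forall>\<^sub>F N in sequentially. nrm (A n N - E n) < e / 8"
        using order_tendstoD(2)[OF Alim, of "e / 8"] e by simp_all
      then have "\<forall>\<^sub>F N in sequentially. nrm (A m N - E m) < e / 8 \<and> nrm (A n N - E n) < e / 8 \<and> N > 0"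
        using eventually_gt_at_top[of 0] by eventually_elim auto
      then obtain N where N: "nrm (A m N - E m) < e / 8" "nrm (A n N - E n) < e / 8" "N > 0"
        using eventually_happens'[OF sequentially_bot] by blast
      have "nrm (E m - E n) \<le> nrm (E m - A m N) + nrm (A m N - E n)" using E AV by (intro nrm_dist_triangle)
      moreover have "nrm (A m N - E n) \<le> nrm (A m N - avg F N) + nrm (avg F N - E n)" using E AV F by (intro nrm_dist_triangle) auto
      moreover have "nrm (avg F N - E n) \<le> nrm (avg F N - A n N) + nrm (A n N - E n)" using E AV F by (intro nrm_dist_triangle) auto
      moreover have "nrm (E m - A m N) = nrm (A m N - E m)" using E AV by (intro nrm_minus_commute)
      moreover have "nrm (A m N - avg F N) = nrm (avg F N - A m N)" using AV F by (intro nrm_minus_commute) auto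
      moreover note y0[OF mn(1) N(3)] y0[OF mn(2) N(3)] N(1,2) e
      ultimately show ?thesis by linarith
    qed
    then show ?thesis by blast
  qed
  then obtain G where G: "G \<in> V" "(\<lambda>y. nrm (E y - G)) \<longlonglongrightarrow> 0" using complete[of E] E by blast
  have "(\<lambda>N. nrm (avg F (real N) - G)) \<longlonglongrightarrow> 0"
  proof (rule tendstoI)
    fix e :: real assume e: "e > 0"
    obtain y0 where y0: "\<And>y N. y \<ge> y0 \<Longrightarrow> N > 0 \<Longrightarrow> nrm (avg F (real N) - A y N) \<le> e / 4"
      using near[of "e / 4"] e by auto
    have "\<forall>\<^sub>F y in sequentially. nrm (E y - G) < e / 4" using G e by (intro order_tendstoD) auto
    then have "\<forall>\<^sub>F y in sequentially. nrm (E y - G) < e / 4 \<and> y \<ge> y0"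
      using eventually_ge_at_top[of y0] by eventually_elim auto
    then obtain y where y: "nrm (E y - G) < e / 4" "y \<ge> y0"
      using eventually_happens'[OF sequentially_bot] by blast
    have "\<forall>\<^sub>F N in sequentially. nrm (A y N - E y) < e / 4" using Alim e by (intro order_tendstoD) auto
    then show "\<forall>\<^sub>F N in sequentially. dist (nrm (avg F (real N) - G)) 0 < e"
      using eventually_gt_at_top[of 0]
    proof eventually_elim
      case (elim N)
      have "nrm (avg F N - G) \<le> nrm (avg F N - A y N) + nrm (A y N - G)" using G AV F by (intro nrm_dist_triangle) auto
      moreover have "nrm (A y N - G) \<le> nrm (A y N - E y) + nrm (E y - G)" using G AV E by (intro nrm_dist_triangle) auto
      moreover note y0[OF y(2) elim(2)] elim(1) y(1)
      ultimately have "nrm (avg F N - G) < e" using e by linarith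
      moreover have "nrm (avg F N - G) \<ge> 0" using F G by auto
      ultimately show ?case by (simp add: dist_real_def)
    qed
  qed
  then show ?thesis using G by blast
qed

text \<open>The infinite Euler product is injective on vectors fixed by the \<open>U p\<close> with
  \<open>p\<close> in \<open>D\<close>, since the lower bound for the partial products is uniform in
  \<open>y\<close>.\<close>

lemma zero_if_avg_tendsto_zero:
  assumes F: "F \<in> V" and inv: "\<And>p. p \<in> D \<Longrightarrow> prime p \<Longrightarrow> nrm (U p F - F) = 0"
    and summ: "(\<lambda>p. 1 / real p) summable_on {p. prime p \<and> p \<notin> D}"
    and E: "\<And>y. E y \<in> V" "\<And>y. euler_rel (primes_upto y) F (E y)"
    and lim: "(\<lambda>N. nrm (avg F (real N))) \<longlonglongrightarrow> 0"
  shows "nrm F = 0"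
proof -
  obtain G where G: "G \<in> V" "(\<lambda>y. nrm (E y - G)) \<longlonglongrightarrow> 0" "(\<lambda>N. nrm (avg F (real N) - G)) \<longlonglongrightarrow> 0"
    using avg_euler_tendsto[OF F inv summ E] by blast
  have "nrm G \<le> 0"
  proof (rule LIMSEQ_le)
    show "(\<lambda>N. nrm (avg F (real N)) + nrm (avg F (real N) - G)) \<longlonglongrightarrow> 0"
      using tendsto_add[OF lim G(3)] by simp
    show "(\<lambda>N. nrm G) \<longlonglongrightarrow> nrm G" by (rule tendsto_const)
    have "nrm G \<le> nrm (avg F (real N)) + nrm (avg F (real N) - G)" for N
      using nrm_le_dist[of G "avg F (real N)"] nrm_minus_commute[of G "avg F (real N)"] F G(1) by simp
    then show "\<exists>N0. \<forall>N\<ge>N0. nrm G \<le> nrm (avg F (real N)) + nrm (avg F (real N) - G)" by blast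
  qed
  define c where "c = exp (4 * infsum (\<lambda>p. 1 / real p) {p. prime p \<and> p \<notin> D})"
  have "nrm F \<le> c * (nrm G + nrm (E y - G))" for y
  proof -
    have "nrm F \<le> exp (4 * (\<Sum>p\<in>set (primes_upto y) - D. 1 / real p)) * nrm (E y)"
      using inv by (intro euler_rel_lower_bound[OF F _ distinct_primes_upto _ E]) (auto simp: set_primes_upto)
    also have "\<dots> \<le> c * (nrm G + nrm (E y - G))"
    proof (intro mult_mono)
      have "(\<Sum>p\<in>set (primes_upto y) - D. 1 / real p) \<le> infsum (\<lambda>p. 1 / real p) {p. prime p \<and> p \<notin> D}"
        using summ by (intro finite_sum_le_infsum) (auto simp: set_primes_upto)
      then show "exp (4 * (\<Sum>p\<in>set (primes_upto y) - D. 1 / real p)) \<le> c" by (simp add: c_def)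
      show "nrm (E y) \<le> nrm G + nrm (E y - G)" using E G by (intro nrm_le_dist)
    qed (use E in \<open>auto simp: c_def\<close>)
    finally show ?thesis .
  qed
  moreover have "(\<lambda>y. c * (nrm G + nrm (E y - G))) \<longlonglongrightarrow> c * (nrm G + 0)"
    by (intro tendsto_intros G)
  ultimately have "nrm F \<le> c * (nrm G + 0)" by (intro LIMSEQ_le[OF tendsto_const]) auto
  also have "\<dots> \<le> 0" using \<open>nrm G \<le> 0\<close> by (simp add: c_def mult_le_0_iff)
  finally show ?thesis using nrm_nonneg[OF F] by linarith
qed

section \<open>Splitting off the coboundaries of the recurrent primes\<close>

definition recurrent_primes :: "nat set" where
  "recurrent_primes = {p. prime p \<and> \<not> (\<lambda>q. 1 / real q) summable_on {q. prime q \<and> U q = U p}}"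

lemma summable_non_recurrent: "(\<lambda>p. 1 / real p) summable_on {p. prime p \<and> p \<notin> recurrent_primes}"
proof -
  let ?Q = "{p. prime p \<and> p \<notin> recurrent_primes}"
  have "(\<lambda>p. 1 / real p) summable_on (\<Union>T\<in>\<T>. {q. prime q \<and> U q = T})"
    if "finite \<T>" "\<T> \<subseteq> U ` ?Q" for \<T>
    using that
  proof (induction \<T>)
    case (insert T \<T>)
    then obtain p where "p \<in> ?Q" "T = U p" by auto
    then have "(\<lambda>p. 1 / real p) summable_on {q. prime q \<and> U q = T}" by (auto simp: recurrent_primes_def)
    moreover have "(\<lambda>p. 1 / real p) summable_on (\<Union>T\<in>\<T>. {q. prime q \<and> U q = T})" using insert by simp
    ultimately have "(\<lambda>p. 1 / real p) summable_on ({q. prime q \<and> U q = T} \<union> (\<Union>T\<in>\<T>. {q. prime q \<and> U q = T}))"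
      by (rule summable_on_union)
    then show ?case by simp
  qed simp
  moreover have "finite (U ` ?Q)" using finite_U by (rule rev_finite_subset) auto
  ultimately have "(\<lambda>p. 1 / real p) summable_on (\<Union>T\<in>U ` ?Q. {q. prime q \<and> U q = T})" by blast
  then show ?thesis by (rule summable_on_subset_banach) auto
qed

definition coboundaries :: "'a set" where
  "coboundaries = span {U p G - G | p G. p \<in> recurrent_primes \<and> G \<in> V}"

lemma coboundaries_subset: "coboundaries \<subseteq> V"
  unfolding coboundaries_def
proof (rule span_minimal[OF _ subspace_V], safe)
  fix p G assume "p \<in> recurrent_primes" and G: "G \<in> V"
  then have "p > 0" by (auto simp: recurrent_primes_def prime_gt_0_nat)
  then show "U p G - G \<in> V" using G by (intro V_diff U_in)
qed

lemma avg_tendsto_zero_coboundaries: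
  assumes "w \<in> coboundaries"
  shows "(\<lambda>N. nrm (avg w (real N))) \<longlonglongrightarrow> 0"
proof -
  let ?Z = "{F \<in> V. (\<lambda>N. nrm (avg F (real N))) \<longlonglongrightarrow> 0}"
  have "subspace ?Z"
  proof (rule subspaceI, goal_cases)
    case 1
    have "avg 0 x = 0" for x using avg_diff[of 0 0 x] by simp
    then show ?case by simp
  next
    case (2 F G)
    have "(\<lambda>N. nrm (avg F (real N)) + nrm (avg G (real N))) \<longlonglongrightarrow> 0"
      using 2 tendsto_add[of "\<lambda>N. nrm (avg F (real N))" 0 sequentially "\<lambda>N. nrm (avg G (real N))" 0] by simp
    then have "(\<lambda>N. nrm (avg (F + G) (real N))) \<longlonglongrightarrow> 0"
      by (rule tendsto_sandwich[OF _ _ tendsto_const, rotated 2])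
         (use 2 in \<open>auto simp: avg_add nrm_triangle\<close>)
    then show ?case using 2 by simp
  next
    case (3 c F)
    have "avg (c *\<^sub>R F) x = c *\<^sub>R avg F x" for x
    proof -
      have "psum (c *\<^sub>R F) x = c *\<^sub>R psum F x"
        unfolding psum_def scaleR_right.sum using 3 by (intro sum.cong) (auto simp: U_scale in_ints)
      then show ?thesis by (simp add: avg_def)
    qed
    then show ?case using 3 tendsto_mult_right_zero[of "\<lambda>N. nrm (avg F (real N))" sequentially "\<bar>c\<bar>"]
      by (auto simp: nrm_scale)
  qed
  moreover have "{U p G - G | p G. p \<in> recurrent_primes \<and> G \<in> V} \<subseteq> ?Z"
  proof safe
    fix p G assume p: "p \<in> recurrent_primes" and G: "G \<in> V"
    then have pp: "prime p" "\<not> (\<lambda>q. 1 / real q) summable_on {q. prime q \<and> U q = U p}" by (auto simp: recurrent_primes_def)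
    show "U p G - G \<in> V" using G prime_gt_0_nat[OF pp(1)] by (intro V_diff U_in)
    show "(\<lambda>N. nrm (avg (U p G - G) (real N))) \<longlonglongrightarrow> 0"
      by (rule filterlim_compose[OF avg_coboundary_tendsto_zero[OF G pp] filterlim_real_sequentially])
  qed
  ultimately have "coboundaries \<subseteq> ?Z" unfolding coboundaries_def by (rule span_minimal[rotated])
  then show ?thesis using assms by auto
qed

lemma ip_coboundary_zero:
  assumes H: "H \<in> V" "\<And>p. p \<in> recurrent_primes \<Longrightarrow> nrm (U p H - H) = 0" and w: "w \<in> coboundaries"
  shows "ip H w = 0"
proof -
  have "subspace {w \<in> V. ip H w = 0}"
    by (rule subspaceI) (use H(1) in \<open>auto simp: ip_add_right ip_scale_right ip_commute[of H 0]\<close>)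
  moreover have "{U p G - G | p G. p \<in> recurrent_primes \<and> G \<in> V} \<subseteq> {w \<in> V. ip H w = 0}"
  proof safe
    fix p G assume p: "p \<in> recurrent_primes" and G: "G \<in> V"
    then have p0: "p > 0" by (auto simp: recurrent_primes_def prime_gt_0_nat)
    then show "U p G - G \<in> V" using G by auto
    have "ip H (U p G - G) = ip H (U p G) - ip (U p H) (U p G)" using H(1) G p0 by (simp add: ip_diff_right U_ip U_in)
    also have "\<dots> = - ip (U p H - H) (U p G)" using H(1) G p0 by (simp add: ip_diff_left U_in)
    also have "\<bar>\<dots>\<bar> \<le> nrm (U p H - H) * nrm (U p G)" using H(1) G p0 Cauchy_Schwarz[of "U p H - H" "U p G"] by (auto simp: U_in)
    finally show "ip H (U p G - G) = 0" using H(2)[OF p] by simp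
  qed
  ultimately have "coboundaries \<subseteq> {w \<in> V. ip H w = 0}" unfolding coboundaries_def by (rule span_minimal[rotated])
  then show ?thesis using w by auto
qed

text \<open>Von Neumann's splitting. The remainder \<open>G\<close> is orthogonal to its own
  coboundary \<open>U p G - G\<close>, so \<open>ip G (U p G) = ip G G\<close>, and for an isometry
  this forces \<open>U p G = G\<close> up to a null vector. The averages of the other part vanish on
  coboundaries and are bounded by the norm, hence vanish on limits of coboundaries.\<close>

theorem invariant_projection:
  assumes F: "F \<in> V"
  obtains G where "G \<in> V" "\<And>p. p \<in> recurrent_primes \<Longrightarrow> nrm (U p G - G) = 0"
    "\<And>H. H \<in> V \<Longrightarrow> (\<And>p. p \<in> recurrent_primes \<Longrightarrow> nrm (U p H - H) = 0) \<Longrightarrow> ip H F = ip H G"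
    "(\<lambda>N. nrm (avg (F - G) (real N))) \<longlonglongrightarrow> 0"
proof -
  have "subspace coboundaries" unfolding coboundaries_def by (rule subspace_span)
  then obtain G w where G: "G \<in> V" and w: "\<And>n. w n \<in> coboundaries" "(\<lambda>n. nrm (F - G - w n)) \<longlonglongrightarrow> 0"
    and orth: "\<And>u. u \<in> coboundaries \<Longrightarrow> ip G u = 0"
    by (rule projection[OF _ coboundaries_subset F]) blast
  have wV: "w n \<in> V" for n using w(1) coboundaries_subset by auto
  have inv: "nrm (U p G - G) = 0" if p: "p \<in> recurrent_primes" for p
  proof -
    have p0: "p > 0" using p by (auto simp: recurrent_primes_def prime_gt_0_nat)
    have "U p G - G \<in> coboundaries" unfolding coboundaries_def using p G by (intro span_base) blast
    then have "ip G (U p G) = ip G G" using orth[of "U p G - G"] G p0 by (simp add: ip_diff_right U_in)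
    moreover have "ip (U p G) G = ip G (U p G)" using G p0 by (intro ip_commute) auto
    moreover have "(nrm (U p G - G))\<^sup>2 = (nrm G)\<^sup>2 - 2 * ip (U p G) G + (nrm G)\<^sup>2"
      using nrm_square_diff[of "U p G" G] G p0 by (simp add: U_in)
    ultimately have "(nrm (U p G - G))\<^sup>2 = 0" using nrm_square[OF G] by linarith
    then show ?thesis by simp
  qed
  have ipF: "ip H F = ip H G" if H: "H \<in> V" "\<And>p. p \<in> recurrent_primes \<Longrightarrow> nrm (U p H - H) = 0" for H
  proof -
    have "\<bar>ip H (F - G)\<bar> \<le> nrm H * nrm (F - G - w n)" for n
    proof -
      have "ip H (F - G) = ip H (F - G - w n)" using ip_coboundary_zero[OF H w(1)] H F G wV by (simp add: ip_diff_right)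
      then show ?thesis using Cauchy_Schwarz[of H "F - G - w n"] H F G wV by simp
    qed
    moreover have "(\<lambda>n. nrm H * nrm (F - G - w n)) \<longlonglongrightarrow> 0" using w(2) by (rule tendsto_mult_right_zero)
    ultimately have "\<bar>ip H (F - G)\<bar> \<le> 0" by (intro LIMSEQ_le[OF tendsto_const]) auto
    then show ?thesis using H F G by (simp add: ip_diff_right)
  qed
  have "(\<lambda>N. nrm (avg (F - G) (real N))) \<longlonglongrightarrow> 0"
  proof (rule tendstoI)
    fix e :: real assume e: "e > 0"
    have "\<forall>\<^sub>F n in sequentially. nrm (F - G - w n) < e / 2" using w(2) e by (intro order_tendstoD) auto
    then obtain n where n: "nrm (F - G - w n) < e / 2" using eventually_happens'[OF sequentially_bot] by blast
    have "\<forall>\<^sub>F N in sequentially. nrm (avg (w n) (real N)) < e / 2"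
      using avg_tendsto_zero_coboundaries[OF w(1)] e by (intro order_tendstoD) auto
    then show "\<forall>\<^sub>F N in sequentially. dist (nrm (avg (F - G) (real N))) 0 < e"
      using eventually_gt_at_top[of 0]
    proof eventually_elim
      case (elim N)
      have "nrm (avg (F - G) N) \<le> nrm (avg (w n) N) + nrm (avg (F - G) N - avg (w n) N)"
        using F G wV by (intro nrm_le_dist) auto
      also have "avg (F - G) N - avg (w n) N = avg (F - G - w n) N" using F G wV by (simp add: avg_diff)
      also have "nrm (avg (F - G - w n) N) \<le> nrm (F - G - w n)" using F G wV elim by (intro nrm_avg_le) auto
      finally have "nrm (avg (F - G) N) < e" using n elim(1) by linarith
      moreover have "nrm (avg (F - G) N) \<ge> 0" using F G by auto
      ultimately show ?case by (simp add: dist_real_def)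
    qed
  qed
  then show ?thesis using that[of G] G inv ipF by blast
qed

end

section \<open>The Koopman representation\<close>

instantiation "fun" :: (type, real_vector) real_vector
begin

definition scaleR_fun :: "real \<Rightarrow> ('a \<Rightarrow> 'b) \<Rightarrow> 'a \<Rightarrow> 'b" where
  "scaleR_fun c f = (\<lambda>x. c *\<^sub>R f x)"

instance
  by standard (auto simp: scaleR_fun_def fun_eq_iff scaleR_add_right scaleR_add_left)

end

lemma scaleR_fun_apply [simp]: "(c *\<^sub>R f) x = c *\<^sub>R f x"
  by (simp add: scaleR_fun_def)

lemma sum_fun_apply: "(\<Sum>i\<in>A. f i) x = (\<Sum>i\<in>A. f i x)"
  by (induction A rule: infinite_finite_induct) auto

section \<open>The space of square integrable functions and its completeness\<close>

lemma L2_space_measurable: "F \<in> L2_space M \<Longrightarrow> F \<in> borel_measurable M"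
  by (simp add: L2_space_def)

lemma L2_space_integrable: "F \<in> L2_space M \<Longrightarrow> integrable M (\<lambda>x. (cmod (F x))\<^sup>2)"
  by (simp add: L2_space_def)

lemma L2_space_bound:
  assumes "G \<in> borel_measurable M" "integrable M h" "\<And>x. x \<in> space M \<Longrightarrow> (cmod (G x))\<^sup>2 \<le> h x"
  shows "G \<in> L2_space M"
  unfolding L2_space_def
proof (safe intro!: assms(1))
  show "integrable M (\<lambda>x. (cmod (G x))\<^sup>2)"
    by (rule Bochner_Integration.integrable_bound[OF assms(2)])
       (use assms in \<open>auto intro!: AE_I2 order_trans[OF assms(3)]\<close>)
qed

lemma L2_space_add:
  assumes "F \<in> L2_space M" "G \<in> L2_space M"
  shows "(\<lambda>x. F x + G x) \<in> L2_space M"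
proof (rule L2_space_bound)
  note [measurable] = assms[THEN L2_space_measurable]
  show "(\<lambda>x. F x + G x) \<in> borel_measurable M" by measurable
  show "integrable M (\<lambda>x. 2 * (cmod (F x))\<^sup>2 + 2 * (cmod (G x))\<^sup>2)"
    using assms by (intro Bochner_Integration.integrable_add integrable_mult_right L2_space_integrable)
  show "(cmod (F x + G x))\<^sup>2 \<le> 2 * (cmod (F x))\<^sup>2 + 2 * (cmod (G x))\<^sup>2" for x
  proof -
    have "(cmod (F x + G x))\<^sup>2 \<le> (cmod (F x) + cmod (G x))\<^sup>2" by (intro power_mono norm_triangle_ineq) auto
    also have "\<dots> \<le> 2 * (cmod (F x))\<^sup>2 + 2 * (cmod (G x))\<^sup>2"
      using zero_le_power2[of "cmod (F x) - cmod (G x)"] by (simp add: power2_sum power2_diff)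
    finally show ?thesis .
  qed
qed

lemma L2_space_cmult:
  assumes "F \<in> L2_space M"
  shows "(\<lambda>x. c * F x) \<in> L2_space M"
  using assms by (auto simp: L2_space_def norm_mult power_mult_distrib)

lemma L2_space_scaleR:
  assumes "F \<in> L2_space M"
  shows "(\<lambda>x. c *\<^sub>R F x) \<in> L2_space M"
  using L2_space_cmult[OF assms, of "of_real c"] by (simp add: scaleR_conv_of_real)

lemma L2_space_diff:
  assumes "F \<in> L2_space M" "G \<in> L2_space M"
  shows "(\<lambda>x. F x - G x) \<in> L2_space M"
  using L2_space_add[OF assms(1) L2_space_cmult[OF assms(2), of "-1"]] by simp

lemma L2_space_cong_AE:
  assumes "F \<in> L2_space M" "G \<in> borel_measurable M" "AE x in M. F x = G x"
  shows "G \<in> L2_space M"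
proof -
  have "integrable M (\<lambda>x. (cmod (F x))\<^sup>2) \<longleftrightarrow> integrable M (\<lambda>x. (cmod (G x))\<^sup>2)"
    using assms by (intro integrable_cong_AE) (auto dest: L2_space_measurable)
  then show ?thesis using assms by (auto simp: L2_space_def)
qed

lemma L2_inner_integrable:
  assumes "F \<in> L2_space M" "G \<in> L2_space M"
  shows "integrable M (\<lambda>x. F x \<bullet> G x)"
proof (rule Bochner_Integration.integrable_bound)
  show "integrable M (\<lambda>x. (cmod (F x))\<^sup>2 + (cmod (G x))\<^sup>2)"
    using assms by (auto dest: L2_space_integrable)
  note [measurable] = assms[THEN L2_space_measurable]
  show "(\<lambda>x. F x \<bullet> G x) \<in> borel_measurable M" by measurable
  have "norm (F x \<bullet> G x) \<le> norm ((cmod (F x))\<^sup>2 + (cmod (G x))\<^sup>2)" for x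
  proof -
    have "norm (F x \<bullet> G x) \<le> cmod (F x) * cmod (G x)" by (simp add: Cauchy_Schwarz_ineq2)
    also have "\<dots> \<le> (cmod (F x))\<^sup>2 + (cmod (G x))\<^sup>2"
    proof -
      have "2 * (cmod (F x) * cmod (G x)) \<le> (cmod (F x))\<^sup>2 + (cmod (G x))\<^sup>2"
        using sum_squares_bound[of "cmod (F x)" "cmod (G x)"] by (simp add: mult.assoc)
      moreover have "0 \<le> cmod (F x) * cmod (G x)" by simp
      ultimately show ?thesis by linarith
    qed
    finally show ?thesis by simp
  qed
  then show "AE x in M. norm (F x \<bullet> G x) \<le> norm ((cmod (F x))\<^sup>2 + (cmod (G x))\<^sup>2)" by simp
qed

lemma L2_norm_eq_inner: "L2_norm M F = sqrt (LINT x|M. F x \<bullet> F x)"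
  by (simp add: L2_norm_def power2_norm_eq_inner)

lemma L2_norm_nonneg: "L2_norm M F \<ge> 0"
  by (simp add: L2_norm_def)

lemma L2_norm_square: "(L2_norm M F)\<^sup>2 = (LINT x|M. (cmod (F x))\<^sup>2)"
  by (simp add: L2_norm_def)

lemma L2_norm_eq_0_iff:
  assumes "F \<in> L2_space M"
  shows "L2_norm M F = 0 \<longleftrightarrow> (AE x in M. F x = 0)"
proof -
  have "L2_norm M F = 0 \<longleftrightarrow> (LINT x|M. (cmod (F x))\<^sup>2) = 0" by (simp add: L2_norm_def)
  also have "\<dots> \<longleftrightarrow> (AE x in M. (cmod (F x))\<^sup>2 = 0)"
    by (rule integral_nonneg_eq_0_iff_AE[OF L2_space_integrable[OF assms]]) auto
  finally show ?thesis by simp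
qed

context prob_space
begin

lemma L2_imp_integrable:
  assumes "F \<in> L2_space M"
  shows "integrable M F"
proof (rule Bochner_Integration.integrable_bound)
  show "integrable M (\<lambda>x. 1 + (cmod (F x))\<^sup>2)" using assms by (auto dest: L2_space_integrable)
  show "F \<in> borel_measurable M" using assms by (rule L2_space_measurable)
  have "cmod z \<le> 1 + (cmod z)\<^sup>2" for z
  proof -
    have "2 * cmod z \<le> (cmod z)\<^sup>2 + 1" using zero_le_power2[of "cmod z - 1"] by (simp add: power2_diff)
    then show ?thesis using norm_ge_zero[of z] by linarith
  qed
  then show "AE x in M. norm (F x) \<le> norm (1 + (cmod (F x))\<^sup>2)" by (auto simp: abs_of_nonneg)
qed

lemma L1_le_L2:
  assumes "F \<in> L2_space M"
  shows "(LINT x|M. cmod (F x)) \<le> L2_norm M F"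
proof -
  have "(LINT x|M. cmod (F x))\<^sup>2 \<le> (LINT x|M. (cmod (F x))\<^sup>2)"
  proof -
    define a where "a = (LINT x|M. cmod (F x))"
    have i1: "integrable M (\<lambda>x. cmod (F x))" using L2_imp_integrable[OF assms] by simp
    have i2: "integrable M (\<lambda>x. (cmod (F x))\<^sup>2)" using assms by (rule L2_space_integrable)
    have "0 \<le> (LINT x|M. (cmod (F x) - a)\<^sup>2)" by simp
    also have "\<dots> = (LINT x|M. (cmod (F x))\<^sup>2 - 2 * a * cmod (F x) + a\<^sup>2)"
      by (intro Bochner_Integration.integral_cong) (auto simp: power2_diff)
    also have "\<dots> = (LINT x|M. (cmod (F x))\<^sup>2) - 2 * a * a + a\<^sup>2"
      using i1 i2 by (simp add: a_def prob_space)
    finally show ?thesis by (simp add: a_def power2_eq_square)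
  qed
  then show ?thesis by (simp add: L2_norm_def real_le_rsqrt)
qed

text \<open>Riesz-Fischer: on a probability space an L^2 Cauchy sequence is Cauchy in L^1 and has a
  subsequence converging almost everywhere; Fatou's lemma carries the L^2 bounds over to the
  limit.\<close>

lemma L2_complete:
  assumes X: "\<And>n. X n \<in> L2_space M"
    and cauchy: "\<And>e. e > 0 \<Longrightarrow> \<exists>N. \<forall>m\<ge>N. \<forall>n\<ge>N. L2_norm M (\<lambda>x. X m x - X n x) < e"
  shows "\<exists>f\<in>L2_space M. (\<lambda>n. L2_norm M (\<lambda>x. X n x - f x)) \<longlonglongrightarrow> 0"
proof -
  have meas [measurable]: "X n \<in> borel_measurable M" for n using X by (rule L2_space_measurable)
  have "\<exists>N. \<forall>i\<ge>N. \<forall>j\<ge>N. LINT x|M. norm (X i x - X j x) < e" if "e > 0" for e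
    using cauchy[OF that] L1_le_L2[OF L2_space_diff[OF X X]] by (meson order_le_less_trans)
  then obtain r where r: "strict_mono r" "AE x in M. Cauchy (\<lambda>i. X (r i) x)"
    using cauchy_L1_AE_cauchy_subseq[of M X] L2_imp_integrable[OF X] by blast
  \<comment> \<open>Where the subsequence diverges, on a null set, \<open>lim\<close> has an
    unspecified value; \<open>f\<close> is measurable nevertheless.\<close>
  define f where "f x = lim (\<lambda>i. X (r i) x)" for x
  have f_meas [measurable]: "f \<in> borel_measurable M" unfolding f_def by measurable
  have lim: "AE x in M. (\<lambda>i. X (r i) x) \<longlonglongrightarrow> f x"
    using r(2) by eventually_elim (simp add: f_def Cauchy_convergent_iff convergent_LIMSEQ_iff)
  have key: "(\<integral>\<^sup>+x. ennreal ((cmod (X m x - f x))\<^sup>2) \<partial>M) \<le> ennreal (e\<^sup>2)"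
    if e: "e > 0" and N: "\<And>n. n \<ge> N \<Longrightarrow> L2_norm M (\<lambda>x. X m x - X n x) < e" for m e N
  proof -
    have "(\<integral>\<^sup>+x. ennreal ((cmod (X m x - f x))\<^sup>2) \<partial>M)
        = (\<integral>\<^sup>+x. liminf (\<lambda>i. ennreal ((cmod (X m x - X (r i) x))\<^sup>2)) \<partial>M)"
    proof (rule nn_integral_cong_AE)
      show "AE x in M. ennreal ((cmod (X m x - f x))\<^sup>2) = liminf (\<lambda>i. ennreal ((cmod (X m x - X (r i) x))\<^sup>2))"
        using lim
      proof eventually_elim
        case (elim x)
        have "(\<lambda>i. ennreal ((cmod (X m x - X (r i) x))\<^sup>2)) \<longlonglongrightarrow> ennreal ((cmod (X m x - f x))\<^sup>2)"
          by (intro tendsto_ennrealI tendsto_intros elim)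
        then show ?case by (rule lim_imp_Liminf[OF sequentially_bot, symmetric])
      qed
    qed
    also have "\<dots> \<le> liminf (\<lambda>i. \<integral>\<^sup>+x. ennreal ((cmod (X m x - X (r i) x))\<^sup>2) \<partial>M)"
      by (rule nn_integral_liminf) measurable
    also have "\<dots> \<le> ennreal (e\<^sup>2)"
    proof (rule Liminf_le)
      show "\<forall>\<^sub>F i in sequentially. (\<integral>\<^sup>+x. ennreal ((cmod (X m x - X (r i) x))\<^sup>2) \<partial>M) \<le> ennreal (e\<^sup>2)"
        using eventually_ge_at_top[of N]
      proof eventually_elim
        case (elim i)
        have "r i \<ge> N" using elim seq_suble[OF r(1), of i] by linarith
        then have "(L2_norm M (\<lambda>x. X m x - X (r i) x))\<^sup>2 \<le> e\<^sup>2"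
          using N[of "r i"] L2_norm_nonneg by (intro power_mono) (auto simp: less_imp_le)
        then show ?case
          using L2_space_integrable[OF L2_space_diff[OF X X]] by (subst nn_integral_eq_integral) (auto simp: L2_norm_square ennreal_leI)
      qed
    qed simp
    finally show ?thesis .
  qed
  have key2: "(\<lambda>x. X m x - f x) \<in> L2_space M \<and> L2_norm M (\<lambda>x. X m x - f x) \<le> e"
    if e: "e > 0" and N: "\<And>n. n \<ge> N \<Longrightarrow> L2_norm M (\<lambda>x. X m x - X n x) < e" for m e N
  proof -
    note le = key[OF e N]
    have int: "integrable M (\<lambda>x. (cmod (X m x - f x))\<^sup>2)"
      using order_le_less_trans[OF le ennreal_less_top] by (intro integrableI_bounded) auto
    then have "ennreal (LINT x|M. (cmod (X m x - f x))\<^sup>2) \<le> ennreal (e\<^sup>2)"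
      using le by (subst nn_integral_eq_integral[symmetric]) auto
    then have "(LINT x|M. (cmod (X m x - f x))\<^sup>2) \<le> e\<^sup>2" by simp
    then have "L2_norm M (\<lambda>x. X m x - f x) \<le> e"
      using e by (simp add: L2_norm_def real_le_lsqrt)
    then show ?thesis using int by (auto simp: L2_space_def)
  qed
  obtain N where N: "\<forall>m\<ge>N. \<forall>n\<ge>N. L2_norm M (\<lambda>x. X m x - X n x) < 1" using cauchy[of 1] by auto
  have "(\<lambda>x. X N x - f x) \<in> L2_space M" using key2[of 1 N N] N by auto
  from L2_space_diff[OF X[of N] this] have fL2: "f \<in> L2_space M" by simp
  have "(\<lambda>n. L2_norm M (\<lambda>x. X n x - f x)) \<longlonglongrightarrow> 0"
  proof (rule tendstoI)
    fix e :: real assume e: "e > 0"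
    obtain N where N: "\<forall>m\<ge>N. \<forall>n\<ge>N. L2_norm M (\<lambda>x. X m x - X n x) < e / 2" using cauchy[of "e / 2"] e by auto
    have "dist (L2_norm M (\<lambda>x. X n x - f x)) 0 < e" if "n \<ge> N" for n
      using key2[of "e / 2" N n] N that e L2_norm_nonneg[of M "\<lambda>x. X n x - f x"] by (auto simp: dist_real_def)
    then show "\<forall>\<^sub>F n in sequentially. dist (L2_norm M (\<lambda>x. X n x - f x)) 0 < e"
      unfolding eventually_sequentially by blast
  qed
  then show ?thesis using fL2 by blast
qed

end

text \<open>The real part of the Hermitian product, since \<open>\<bullet>\<close> on complex
  numbers is the inner product of the real plane.\<close>

definition L2_inner :: "'a measure \<Rightarrow> ('a \<Rightarrow> complex) \<Rightarrow> ('a \<Rightarrow> complex) \<Rightarrow> real" where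
  "L2_inner M F G = (LINT x|M. F x \<bullet> G x)"

text \<open>Functions that vanish off \<open>space M\<close>: on these the relations between the maps \<open>S n\<close>, which are
  assumed on \<open>space M\<close> only, become equalities of functions.\<close>

definition L2_on :: "'a measure \<Rightarrow> ('a \<Rightarrow> complex) set" where
  "L2_on M = {F \<in> L2_space M. \<forall>x. x \<notin> space M \<longrightarrow> F x = 0}"

definition zero_ext :: "'a measure \<Rightarrow> ('a \<Rightarrow> complex) \<Rightarrow> 'a \<Rightarrow> complex" where
  "zero_ext M F = (\<lambda>x. if x \<in> space M then F x else 0)"

definition koopman :: "'a measure \<Rightarrow> (nat \<Rightarrow> 'a \<Rightarrow> 'a) \<Rightarrow> nat \<Rightarrow> ('a \<Rightarrow> complex) \<Rightarrow> 'a \<Rightarrow> complex" where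
  "koopman M S n F = (\<lambda>x. if x \<in> space M then F (S n x) else 0)"

lemma zero_ext_measurable_iff: "zero_ext M F \<in> borel_measurable M \<longleftrightarrow> F \<in> borel_measurable M"
  unfolding zero_ext_def by (rule measurable_cong) auto

lemma zero_ext_in_iff: "zero_ext M F \<in> L2_on M \<longleftrightarrow> F \<in> L2_space M"
proof -
  have "integrable M (\<lambda>x. (cmod (zero_ext M F x))\<^sup>2) \<longleftrightarrow> integrable M (\<lambda>x. (cmod (F x))\<^sup>2)"
    by (rule Bochner_Integration.integrable_cong) (auto simp: zero_ext_def)
  moreover have "\<forall>x. x \<notin> space M \<longrightarrow> zero_ext M F x = 0" by (simp add: zero_ext_def)
  ultimately show ?thesis by (simp add: L2_on_def L2_space_def zero_ext_measurable_iff)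
qed

lemma zero_ext_eq: "F \<in> L2_on M \<Longrightarrow> zero_ext M F = F"
  by (auto simp: L2_on_def zero_ext_def)

lemma L2_norm_cong: "(\<And>x. x \<in> space M \<Longrightarrow> F x = G x) \<Longrightarrow> L2_norm M F = L2_norm M G"
  unfolding L2_norm_def by (intro arg_cong[where f = sqrt] Bochner_Integration.integral_cong) auto

lemma L2_norm_zero_ext: "L2_norm M (zero_ext M F) = L2_norm M F"
  by (rule L2_norm_cong) (simp add: zero_ext_def)

section \<open>Koopman operators of a finitely generated system\<close>

locale fin_gen_system = multiplicative_system +
  assumes fin_gen: "finitely_generated M S"
begin

lemma S_measurable [measurable]: "n > 0 \<Longrightarrow> S n \<in> measurable M M"
  using mpt[of n] by (simp add: invertible_mpt_def)

lemma S_space: "n > 0 \<Longrightarrow> x \<in> space M \<Longrightarrow> S n x \<in> space M"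
  using measurable_space[OF S_measurable] by auto

lemma S_distr: "n > 0 \<Longrightarrow> distr M M (S n) = M"
  using mpt[of n] by (simp add: invertible_mpt_def)

text \<open>\<open>S 1\<close> is idempotent by multiplicativity and injective by
  invertibility.\<close>

lemma S_1: "x \<in> space M \<Longrightarrow> S 1 x = x"
proof -
  assume x: "x \<in> space M"
  have "S (1 * 1) x = S 1 (S 1 x)" using mult[of 1 1 x] x by simp
  moreover have "inj_on (S 1) (space M)" using mpt[of 1] by (auto simp: invertible_mpt_def bij_betw_def)
  ultimately show ?thesis using x S_space[of 1 x] by (simp add: inj_on_def)
qed

lemma koopman_in_L2: "n > 0 \<Longrightarrow> F \<in> L2_space M \<Longrightarrow> koopman M S n F \<in> L2_on M"
proof -
  assume n: "n > 0" and F: "F \<in> L2_space M"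
  note [measurable] = S_measurable[OF n] L2_space_measurable[OF F]
  have "integrable (distr M M (S n)) (\<lambda>x. (cmod (F x))\<^sup>2)" using F S_distr[OF n] by (simp add: L2_space_def)
  then have "integrable M (\<lambda>x. (cmod (F (S n x)))\<^sup>2)" by (rule integrable_distr[rotated]) measurable
  then have "(\<lambda>x. F (S n x)) \<in> L2_space M" by (simp add: L2_space_def)
  then have "zero_ext M (\<lambda>x. F (S n x)) \<in> L2_on M" by (simp add: zero_ext_in_iff)
  then show ?thesis by (simp add: zero_ext_def koopman_def)
qed

lemma L2_on_space: "F \<in> L2_on M \<Longrightarrow> F \<in> L2_space M"
  by (simp add: L2_on_def)

sublocale mult_isometries "L2_on M" "L2_inner M" "koopman M S"
proof
  show "subspace (L2_on M)"
  proof (rule subspaceI)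
    show "0 \<in> L2_on M" by (auto simp: L2_on_def L2_space_def zero_fun_def)
  qed (auto simp: L2_on_def plus_fun_def scaleR_fun_def intro: L2_space_add L2_space_scaleR)
  show "L2_inner M x y = L2_inner M y x" for x y by (simp add: L2_inner_def inner_commute)
  show "L2_inner M (x + y) z = L2_inner M x z + L2_inner M y z"
    if "x \<in> L2_on M" "y \<in> L2_on M" "z \<in> L2_on M" for x y z
    using that by (simp add: L2_inner_def inner_add_left L2_inner_integrable L2_on_space)
  show "L2_inner M (c *\<^sub>R x) y = c * L2_inner M x y" for c x y
    by (simp add: L2_inner_def)
  show "0 \<le> L2_inner M x x" for x by (simp add: L2_inner_def)
  show "koopman M S n v \<in> L2_on M" if "n > 0" "v \<in> L2_on M" for n v
    using that by (intro koopman_in_L2 L2_on_space)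
  show "koopman M S n (u + v) = koopman M S n u + koopman M S n v" for n u v
    by (auto simp: koopman_def fun_eq_iff)
  show "koopman M S n (c *\<^sub>R v) = c *\<^sub>R koopman M S n v" for n c v
    by (auto simp: koopman_def fun_eq_iff)
  show "L2_inner M (koopman M S n u) (koopman M S n v) = L2_inner M u v"
    if n: "n > 0" and uv: "u \<in> L2_on M" "v \<in> L2_on M" for n u v
  proof -
    note [measurable] = S_measurable[OF n] L2_space_measurable[OF L2_on_space[OF uv(1)]] L2_space_measurable[OF L2_on_space[OF uv(2)]]
    have "L2_inner M (koopman M S n u) (koopman M S n v) = (LINT x|M. u (S n x) \<bullet> v (S n x))"
      unfolding L2_inner_def by (intro Bochner_Integration.integral_cong) (auto simp: koopman_def)
    also have "\<dots> = (LINT x|distr M M (S n). u x \<bullet> v x)" by (rule integral_distr[symmetric]) measurable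
    finally show ?thesis by (simp add: S_distr[OF n] L2_inner_def)
  qed
  show "koopman M S (m * n) v = koopman M S m (koopman M S n v)" if "m > 0" "n > 0" for m n v
    using that mult[of n m] S_space[of m] by (auto simp: koopman_def fun_eq_iff mult.commute)
  show "koopman M S 1 v = v" if "v \<in> L2_on M" for v
    using that S_1 by (auto simp: koopman_def fun_eq_iff L2_on_def)
  \<comment> \<open>The operator \<open>koopman M S p\<close> depends on \<open>S p\<close> only
    through its restriction to \<open>space M\<close>, which is what finite generation
    counts.\<close>
  show "finite (koopman M S ` {p. prime p})"
  proof (rule finite_surj)
    show "finite {restrict (S p) (space M) | p. prime p}" using fin_gen by (simp add: finitely_generated_def)
    show "koopman M S ` {p. prime p} \<subseteq> (\<lambda>T F x. if x \<in> space M then F (T x) else 0) ` {restrict (S p) (space M) | p. prime p}"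
    proof safe
      fix p :: nat assume p: "prime p"
      have "koopman M S p = (\<lambda>F x. if x \<in> space M then F (restrict (S p) (space M) x) else 0)"
        by (auto simp: koopman_def fun_eq_iff)
      then show "koopman M S p \<in> (\<lambda>T F x. if x \<in> space M then F (T x) else 0) ` {restrict (S p) (space M) | p. prime p}"
        using p by blast
    qed
  qed
qed

lemma nrm_eq: "nrm F = L2_norm M F"
  unfolding nrm_def L2_inner_def L2_norm_eq_inner ..

sublocale complete_mult_isometries "L2_on M" "L2_inner M" "koopman M S"
proof
  fix X :: "nat \<Rightarrow> 'a \<Rightarrow> complex"
  assume X: "\<And>n. X n \<in> L2_on M"
    and cauchy: "\<And>e. e > 0 \<Longrightarrow> \<exists>N. \<forall>m\<ge>N. \<forall>n\<ge>N. nrm (X m - X n) < e"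
  have "\<exists>N. \<forall>m\<ge>N. \<forall>n\<ge>N. L2_norm M (\<lambda>x. X m x - X n x) < e" if "e > 0" for e
    using cauchy[OF that] unfolding nrm_eq fun_diff_def .
  from L2_complete[OF L2_on_space[OF X] this]
  obtain f where f: "f \<in> L2_space M" "(\<lambda>n. L2_norm M (\<lambda>x. X n x - f x)) \<longlonglongrightarrow> 0"
    by blast
  have "nrm (X n - zero_ext M f) = L2_norm M (\<lambda>x. X n x - f x)" for n
    unfolding nrm_eq by (rule L2_norm_cong) (simp add: zero_ext_def)
  then have "(\<lambda>n. nrm (X n - zero_ext M f)) \<longlonglongrightarrow> 0" using f(2) by presburger
  moreover have "zero_ext M f \<in> L2_on M" using f(1) by (simp add: zero_ext_in_iff)
  ultimately show "\<exists>l\<in>L2_on M. (\<lambda>n. nrm (X n - l)) \<longlonglongrightarrow> 0" by blast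
qed

end

section \<open>The mean ergodic theorem\<close>

context fin_gen_system
begin

lemma zero_ext_diff: "zero_ext M F - zero_ext M G = zero_ext M (\<lambda>x. F x - G x)"
  by (auto simp: zero_ext_def fun_eq_iff)

lemma L2_tendstoI:
  assumes "\<And>n. f n \<in> L2_space M" "G \<in> L2_on M" "(\<lambda>n. nrm (zero_ext M (f n) - G)) \<longlonglongrightarrow> 0"
  shows "L2_tendsto M f G"
proof -
  have "L2_norm M (\<lambda>x. f n x - G x) = nrm (zero_ext M (f n) - G)" for n
    unfolding nrm_eq by (rule L2_norm_cong) (simp add: zero_ext_def)
  then show ?thesis using assms by (simp add: L2_tendsto_def L2_on_space)
qed

lemma nrm_eq_0_iff: "F \<in> L2_on M \<Longrightarrow> nrm F = 0 \<longleftrightarrow> (AE x in M. F x = 0)"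
  unfolding nrm_eq by (intro L2_norm_eq_0_iff L2_on_space)

lemma koopman_invariant_iff:
  assumes "n > 0" "F \<in> L2_on M"
  shows "nrm (koopman M S n F - F) = 0 \<longleftrightarrow> (AE x in M. F (S n x) = F x)"
proof -
  have "koopman M S n F - F \<in> L2_on M" using assms by (intro V_diff U_in)
  then have "nrm (koopman M S n F - F) = 0 \<longleftrightarrow> (AE x in M. (koopman M S n F - F) x = 0)"
    by (rule nrm_eq_0_iff)
  also have "\<dots> \<longleftrightarrow> (AE x in M. F (S n x) = F x)"
    by (rule AE_cong) (simp add: koopman_def)
  finally show ?thesis .
qed

subsection \<open>The Neumann series and the Euler product\<close>

text \<open>The resolvent is a chosen L^2 limit, so existence of a limit must come first: the
  partial sums \<open>P K\<close> are Cauchy by comparison with a geometric series of ratio 1/2. The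
  equation is the limit of \<open>P (Suc K) = H + (1 / p) U p (P K)\<close> and holds for whichever
  representative was chosen.\<close>

lemma koopman_resolvent:
  assumes p: "prime p" and F: "F \<in> L2_space M"
  shows "koopman_resolvent M S p F \<in> L2_space M"
    and "nrm (zero_ext M (koopman_resolvent M S p F) - zero_ext M F
          - (1 / p) *\<^sub>R koopman M S p (zero_ext M (koopman_resolvent M S p F))) = 0"
proof -
  have p0: "p > 0" "p \<ge> 2" using p prime_gt_0_nat prime_ge_2_nat by auto
  define H where "H = zero_ext M F"
  have H: "H \<in> L2_on M" using F by (simp add: H_def zero_ext_in_iff)
  define P where "P K = (\<Sum>k<K. (1 / real p ^ k) *\<^sub>R koopman M S (p ^ k) H)" for K
  have PV: "P K \<in> L2_on M" for K unfolding P_def using H p0 by (intro V_sum V_scale U_in) auto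
  define f where "f K x = (\<Sum>k<K. F (S (p ^ k) x) / of_nat (p ^ k))" for K x
  have zero_ext_f: "zero_ext M (f K) = P K" for K
    using S_space[of "p ^ _"] p0
    by (auto simp: fun_eq_iff zero_ext_def f_def P_def sum_fun_apply koopman_def H_def scaleR_conv_of_real
        divide_inverse mult.commute intro!: sum.cong)
  have fL2: "f K \<in> L2_space M" for K using PV[of K] by (simp add: zero_ext_in_iff flip: zero_ext_f)
  have "\<exists>N. \<forall>m\<ge>N. \<forall>n\<ge>N. nrm (P m - P n) < e" if e: "e > 0" for e
  proof -
    have "summable (\<lambda>k. nrm H * (1 / 2) ^ k)" by (intro summable_mult summable_geometric) simp
    then obtain N where N: "\<And>m n. m \<ge> N \<Longrightarrow> norm (\<Sum>k\<in>{m..<n}. nrm H * (1 / 2) ^ k) < e"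
      using e unfolding summable_Cauchy by blast
    have *: "nrm (P n - P m) < e" if "N \<le> m" "m \<le> n" for m n
    proof -
      have eq: "P n - P m = (\<Sum>k\<in>{m..<n}. (1 / real p ^ k) *\<^sub>R koopman M S (p ^ k) H)"
        unfolding P_def using that by (simp add: sum_diff_nat_ivl[of 0 m n, symmetric] atLeast0LessThan)
      have "nrm (P n - P m) \<le> (\<Sum>k\<in>{m..<n}. nrm ((1 / real p ^ k) *\<^sub>R koopman M S (p ^ k) H))"
        unfolding eq using H p0 by (intro nrm_sum_le V_scale U_in) auto
      also have "\<dots> \<le> (\<Sum>k\<in>{m..<n}. nrm H * (1 / 2) ^ k)"
      proof (rule sum_mono)
        fix k
        have "1 / real p ^ k \<le> 1 / 2 ^ k" using p0 by (intro divide_left_mono power_mono) auto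
        then show "nrm ((1 / real p ^ k) *\<^sub>R koopman M S (p ^ k) H) \<le> nrm H * (1 / 2) ^ k"
          using H p0 mult_left_mono[of "1 / real p ^ k" "1 / 2 ^ k" "nrm H"]
          by (simp add: nrm_scale U_in power_divide mult.commute)
      qed
      also have "\<dots> < e" using N[OF that(1), of n] unfolding real_norm_def by (rule order_le_less_trans[OF abs_ge_self])
      finally show ?thesis .
    qed
    have "nrm (P m - P n) < e" if "m \<ge> N" "n \<ge> N" for m n
      using *[of m n] *[of n m] that nrm_minus_commute[OF PV PV, of m n] by (cases "m \<le> n") auto
    then show ?thesis by blast
  qed
  from complete[of P, OF PV this]
  obtain l where l: "l \<in> L2_on M" "(\<lambda>n. nrm (P n - l)) \<longlonglongrightarrow> 0" by blast
  then have "L2_tendsto M f l" by (intro L2_tendstoI fL2) (simp_all add: zero_ext_f)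
  then have "L2_tendsto M f (SOME g. L2_tendsto M f g)" using someI[of "L2_tendsto M f" l] by simp
  moreover have "koopman_resolvent M S p F = (SOME g. L2_tendsto M f g)"
    by (simp add: koopman_resolvent_def L2_lim_def f_def[abs_def])
  ultimately have "L2_tendsto M f (koopman_resolvent M S p F)" by simp
  then have R: "koopman_resolvent M S p F \<in> L2_space M"
    and lim: "(\<lambda>n. L2_norm M (\<lambda>x. f n x - koopman_resolvent M S p F x)) \<longlonglongrightarrow> 0"
    by (auto simp: L2_tendsto_def)
  show "koopman_resolvent M S p F \<in> L2_space M" by (rule R)
  define G where "G = zero_ext M (koopman_resolvent M S p F)"
  have GV: "G \<in> L2_on M" using R by (simp add: G_def zero_ext_in_iff)
  have lim: "(\<lambda>n. nrm (P n - G)) \<longlonglongrightarrow> 0"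
  proof -
    have "nrm (P n - G) = L2_norm M (\<lambda>x. f n x - koopman_resolvent M S p F x)" for n
      by (simp only: zero_ext_f[symmetric] G_def zero_ext_diff nrm_eq L2_norm_zero_ext)
    then show ?thesis using lim by presburger
  qed
  have rec: "P (Suc K) = H + (1 / p) *\<^sub>R koopman M S p (P K)" for K
  proof -
    have "koopman M S p (P K) = (\<Sum>k<K. (1 / real p ^ k) *\<^sub>R koopman M S (p ^ Suc k) H)"
      unfolding P_def using H p0 by (subst U_sum) (auto simp: U_scale U_mult U_in intro!: sum.cong)
    then have "(1 / p) *\<^sub>R koopman M S p (P K) = (\<Sum>k<K. (1 / real p ^ Suc k) *\<^sub>R koopman M S (p ^ Suc k) H)"
      by (simp add: scaleR_right.sum)
    moreover have "P (Suc K) = (1 / real p ^ 0) *\<^sub>R koopman M S (p ^ 0) H + (\<Sum>k<K. (1 / real p ^ Suc k) *\<^sub>R koopman M S (p ^ Suc k) H)"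
      unfolding P_def by (rule sum.lessThan_Suc_shift)
    ultimately show ?thesis using U_1[OF H] by simp
  qed
  define D where "D = G - H - (1 / p) *\<^sub>R koopman M S p G"
  have DV: "D \<in> L2_on M" unfolding D_def using GV H p0 by (intro V_diff V_scale U_in)
  have "nrm D \<le> nrm (P (Suc K) - G) + nrm (P K - G)" for K
  proof -
    have eq: "D = (1 / p) *\<^sub>R koopman M S p (P K - G) - (P (Suc K) - G)"
      unfolding rec D_def using PV GV p0 by (simp add: U_diff algebra_simps)
    have "nrm D \<le> nrm ((1 / p) *\<^sub>R koopman M S p (P K - G)) + nrm (P (Suc K) - G)"
      unfolding eq using PV GV p0 by (intro nrm_triangle_diff V_diff V_scale U_in)
    also have "nrm ((1 / p) *\<^sub>R koopman M S p (P K - G)) = (1 / p) * nrm (P K - G)"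
      using PV GV p0 by (simp add: nrm_scale U_in)
    also have "\<dots> \<le> 1 * nrm (P K - G)" using PV GV p0 by (intro mult_right_mono) auto
    finally show ?thesis by linarith
  qed
  moreover have "(\<lambda>K. nrm (P (Suc K) - G) + nrm (P K - G)) \<longlonglongrightarrow> 0"
    using tendsto_add[OF LIMSEQ_Suc[OF lim] lim] by simp
  ultimately have "nrm D \<le> 0" by (intro LIMSEQ_le[OF tendsto_const]) auto
  then have "nrm D = 0" using nrm_nonneg[OF DV] by linarith
  then show "nrm (zero_ext M (koopman_resolvent M S p F) - zero_ext M F
      - (1 / p) *\<^sub>R koopman M S p (zero_ext M (koopman_resolvent M S p F))) = 0"
    by (simp add: D_def G_def H_def)
qed

lemma foldr_euler_factor:
  assumes "\<And>p. p \<in> set ps \<Longrightarrow> prime p" "F \<in> L2_space M"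
  shows "foldr (euler_factor M S) ps F \<in> L2_space M
    \<and> euler_rel ps (zero_ext M F) (zero_ext M (foldr (euler_factor M S) ps F))"
  using assms(1)
proof (induction ps)
  case Nil
  then show ?case using assms(2) by simp
next
  case (Cons p ps)
  define G where "G = foldr (euler_factor M S) ps F"
  have G: "G \<in> L2_space M" "euler_rel ps (zero_ext M F) (zero_ext M G)" using Cons by (auto simp: G_def)
  have p: "prime p" "p > 0" using Cons.prems prime_gt_0_nat by auto
  note R = koopman_resolvent[OF p(1) G(1)]
  define K where "K = zero_ext M (koopman_resolvent M S p G)"
  have KV: "K \<in> L2_on M" using R(1) by (simp add: K_def zero_ext_in_iff)
  have HV: "zero_ext M G \<in> L2_on M" using G(1) by (simp add: zero_ext_in_iff)
  have E: "euler_factor M S p G \<in> L2_space M"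
    unfolding euler_factor_def by (rule L2_space_cmult[OF R(1)])
  have cE: "zero_ext M (euler_factor M S p G) = (1 - 1 / p) *\<^sub>R K"
    by (auto simp: fun_eq_iff zero_ext_def euler_factor_def K_def scaleR_conv_of_real)
  have eq: "(1 - 1 / p) *\<^sub>R K - (1 - 1 / p) *\<^sub>R zero_ext M G - (1 / p) *\<^sub>R koopman M S p ((1 - 1 / p) *\<^sub>R K)
      = (1 - 1 / p) *\<^sub>R (K - zero_ext M G - (1 / p) *\<^sub>R koopman M S p K)"
    using KV p by (simp add: U_scale scaleR_diff_right)
  have "nrm ((1 - 1 / p) *\<^sub>R K - (1 - 1 / p) *\<^sub>R zero_ext M G - (1 / p) *\<^sub>R koopman M S p ((1 - 1 / p) *\<^sub>R K)) = \<bar>1 - 1 / p\<bar> * nrm (K - zero_ext M G - (1 / p) *\<^sub>R koopman M S p K)"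
    unfolding eq using KV HV p by (intro nrm_scale V_diff V_scale U_in)
  also have "\<dots> = 0" using R(2) by (simp add: K_def)
  finally have rel: "nrm ((1 - 1 / p) *\<^sub>R K - (1 - 1 / p) *\<^sub>R zero_ext M G - (1 / p) *\<^sub>R koopman M S p ((1 - 1 / p) *\<^sub>R K)) = 0" .
  have step: "foldr (euler_factor M S) (p # ps) F = euler_factor M S p G" by (simp add: G_def)
  show ?case unfolding step euler_rel.simps cE
    by (intro conjI E bexI[of _ "zero_ext M G"] HV G(2) rel)
qed

lemma euler_product_eq: "euler_product M S N F = foldr (euler_factor M S) (primes_upto N) F"
  by (simp add: euler_product_def primes_upto_def)

lemma euler_product:
  assumes "F \<in> L2_space M"
  shows "euler_product M S N F \<in> L2_space M"
    and "euler_rel (primes_upto N) (zero_ext M F) (zero_ext M (euler_product M S N F))"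
  using foldr_euler_factor[of "primes_upto N" F] assms by (auto simp: euler_product_eq set_primes_upto)

lemma zero_ext_ergodic_average: "zero_ext M (ergodic_average S F N) = avg (zero_ext M F) (real N)"
  using S_space
  by (auto simp: fun_eq_iff zero_ext_def ergodic_average_def avg_def psum_def sum_fun_apply koopman_def
      scaleR_conv_of_real divide_inverse mult.commute intro!: sum.cong)

lemma ergodic_average_in: "F \<in> L2_space M \<Longrightarrow> ergodic_average S F N \<in> L2_space M"
  by (simp add: zero_ext_ergodic_average zero_ext_in_iff flip: zero_ext_in_iff[of M "ergodic_average S F N"])

subsection \<open>The sets that pretend to be invariant\<close>

definition inv_sets :: "'a set set" where
  "inv_sets = {A \<in> sets M. \<forall>p\<in>recurrent_primes. AE x in M. S p x \<in> A \<longleftrightarrow> x \<in> A}"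

lemma recurrent_prime_pos: "p \<in> recurrent_primes \<Longrightarrow> p > 0"
  by (auto simp: recurrent_primes_def prime_gt_0_nat)

lemma indicator_in:
  assumes "A \<in> sets M"
  shows "(\<lambda>x. c * indicator A x) \<in> L2_on M"
proof -
  have "(\<lambda>x. c * indicator A x) \<in> L2_space M"
  proof (rule L2_space_bound)
    show "(\<lambda>x. c * indicator A x) \<in> borel_measurable M" using assms by measurable
    show "(cmod (c * indicator A x))\<^sup>2 \<le> (cmod c)\<^sup>2" for x by (simp add: indicator_def)
  qed simp
  moreover have "c * indicator A x = 0" if "x \<notin> space M" for x
    using sets.sets_into_space[OF assms] that by (auto simp: indicator_def)
  ultimately show ?thesis by (auto simp: L2_on_def)
qed

lemma indicator_invariant:
  assumes "A \<in> inv_sets" "p \<in> recurrent_primes"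
  shows "nrm (koopman M S p (\<lambda>x. c * indicator A x) - (\<lambda>x. c * indicator A x)) = 0"
proof -
  have "AE x in M. S p x \<in> A \<longleftrightarrow> x \<in> A" using assms by (auto simp: inv_sets_def)
  then have "AE x in M. c * indicator A (S p x) = c * indicator A x"
    by eventually_elim (simp add: indicator_def)
  then show ?thesis using koopman_invariant_iff[OF recurrent_prime_pos[OF assms(2)] indicator_in[of A c]] assms
    by (auto simp: inv_sets_def)
qed

text \<open>Over the primes \<open>q\<close> with the same operator as \<open>p\<close> the series
  is a fixed multiple of the sum of \<open>1 / q\<close>, so if that sum diverges the multiple must
  vanish. The non-recurrent primes contribute at most a constant times a convergent sum.\<close>

lemma pretends_invariant_iff: "pretends_invariant M S A \<longleftrightarrow> A \<in> inv_sets"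
proof (cases "A \<in> sets M")
  case False
  then show ?thesis by (simp add: pretends_invariant_def inv_sets_def)
next
  case True
  define I where "I = (\<lambda>x. indicator A x :: complex)"
  have I: "I \<in> L2_on M" using indicator_in[OF True, of 1] by (simp add: I_def)
  define a where "a p = nrm (koopman M S p I - I)" for p
  have a_eq: "L2_norm M (\<lambda>x. indicator A (S p x) - indicator A x) = a p" for p
    unfolding a_def nrm_eq by (rule L2_norm_cong) (simp add: koopman_def I_def)
  have a0: "0 \<le> a p" if "prime p" for p
    unfolding a_def using I prime_gt_0_nat[OF that] by (intro nrm_nonneg V_diff U_in)
  have ale: "a p \<le> 2 * nrm I" if "prime p" for p
    unfolding a_def using I prime_gt_0_nat[OF that] nrm_triangle_diff[of "koopman M S p I" I] by (auto simp: U_in)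
  have inv_iff: "A \<in> inv_sets \<longleftrightarrow> (\<forall>p\<in>recurrent_primes. a p = 0)"
  proof -
    have "a p = 0 \<longleftrightarrow> (AE x in M. S p x \<in> A \<longleftrightarrow> x \<in> A)" if "p \<in> recurrent_primes" for p
      unfolding a_def koopman_invariant_iff[OF recurrent_prime_pos[OF that] I]
      by (rule AE_cong) (simp add: I_def indicator_def)
    then show ?thesis using True by (auto simp: inv_sets_def)
  qed
  have "pretends_invariant M S A \<longleftrightarrow> (\<lambda>p. 1 / 2 * ((a p)\<^sup>2 / real p)) summable_on {p. prime p}"
    using True by (simp add: pretends_invariant_def a_eq)
  also have "\<dots> \<longleftrightarrow> (\<forall>p\<in>recurrent_primes. a p = 0)"
  proof
    assume s: "(\<lambda>p. 1 / 2 * ((a p)\<^sup>2 / real p)) summable_on {p. prime p}"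
    show "\<forall>p\<in>recurrent_primes. a p = 0"
    proof (rule ballI, rule ccontr)
      fix p assume p: "p \<in> recurrent_primes" and ap: "a p \<noteq> 0"
      let ?C = "{q. prime q \<and> koopman M S q = koopman M S p}"
      have "(\<lambda>q. 1 / 2 * ((a q)\<^sup>2 / real q)) summable_on ?C"
        using s by (rule summable_on_subset_banach) auto
      moreover have "1 / 2 * ((a q)\<^sup>2 / real q) = ((a p)\<^sup>2 / 2) * (1 / real q)" if "q \<in> ?C" for q
        using that by (simp add: a_def)
      ultimately have "(\<lambda>q. ((a p)\<^sup>2 / 2) * (1 / real q)) summable_on ?C"
        by (subst summable_on_cong[symmetric]) auto
      then have "(\<lambda>q. 1 / real q) summable_on ?C"
        using ap by (subst (asm) summable_on_cmult_right') auto
      then show False using p by (auto simp: recurrent_primes_def)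
    qed
  next
    assume z: "\<forall>p\<in>recurrent_primes. a p = 0"
    let ?Q = "{p. prime p \<and> p \<notin> recurrent_primes}"
    have "(\<lambda>p. (1 / 2 * (2 * nrm I)\<^sup>2) * (1 / real p)) summable_on ?Q"
      by (intro summable_on_cmult_right summable_non_recurrent)
    then have "(\<lambda>p. 1 / 2 * ((a p)\<^sup>2 / real p)) summable_on ?Q"
    proof (rule summable_on_comparison_test)
      fix p assume p: "p \<in> ?Q"
      have "(a p)\<^sup>2 \<le> (2 * nrm I)\<^sup>2" using ale[of p] a0[of p] p by (intro power_mono) auto
      then have "(a p)\<^sup>2 / real p \<le> (2 * nrm I)\<^sup>2 / real p" by (intro divide_right_mono) auto
      then show "1 / 2 * ((a p)\<^sup>2 / real p) \<le> (1 / 2 * (2 * nrm I)\<^sup>2) * (1 / real p)" by simp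
    qed auto
    moreover have "(\<lambda>p. 1 / 2 * ((a p)\<^sup>2 / real p)) summable_on ?Q \<longleftrightarrow>
        (\<lambda>p. 1 / 2 * ((a p)\<^sup>2 / real p)) summable_on {p. prime p}"
      by (rule summable_on_cong_neutral) (use z in auto)
    ultimately show "(\<lambda>p. 1 / 2 * ((a p)\<^sup>2 / real p)) summable_on {p. prime p}" by simp
  qed
  finally show ?thesis using inv_iff by simp
qed

text \<open>Invariance almost everywhere under countably many conditions survives countable unions,
  so the sigma-algebra generated by the sets that pretend to be invariant adds no new set.\<close>

lemma sigma_algebra_inv_sets: "sigma_algebra (space M) inv_sets"
  unfolding sigma_algebra_iff2
proof (intro conjI ballI allI impI)
  show "inv_sets \<subseteq> Pow (space M)" using sets.sets_into_space by (auto simp: inv_sets_def)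
  show "{} \<in> inv_sets" by (simp add: inv_sets_def)
  fix A assume A: "A \<in> inv_sets"
  have "AE x in M. S p x \<in> space M - A \<longleftrightarrow> x \<in> space M - A" if "p \<in> recurrent_primes" for p
  proof -
    have "AE x in M. S p x \<in> A \<longleftrightarrow> x \<in> A" using A that by (auto simp: inv_sets_def)
    then show ?thesis using AE_space by eventually_elim (use S_space recurrent_prime_pos[OF that] in auto)
  qed
  then show "space M - A \<in> inv_sets" using A by (auto simp: inv_sets_def)
next
  fix A :: "nat \<Rightarrow> 'a set" assume A: "range A \<subseteq> inv_sets"
  have "AE x in M. S p x \<in> (\<Union>i. A i) \<longleftrightarrow> x \<in> (\<Union>i. A i)" if "p \<in> recurrent_primes" for p
  proof -
    have "AE x in M. \<forall>i. S p x \<in> A i \<longleftrightarrow> x \<in> A i" using A that unfolding AE_all_countable by (auto simp: inv_sets_def)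
    then show ?thesis by eventually_elim auto
  qed
  moreover have "(\<Union>i. A i) \<in> sets M" using A by (auto simp: inv_sets_def)
  ultimately show "(\<Union>i. A i) \<in> inv_sets" by (simp add: inv_sets_def)
qed

lemma space_sigma_pr: "space (sigma_pr M S) = space M"
  by (simp add: sigma_pr_def space_measure_of_conv)

lemma sets_sigma_pr: "sets (sigma_pr M S) = inv_sets"
  unfolding sigma_pr_def pretends_invariant_iff
  using sigma_algebra.sets_measure_of_eq[OF sigma_algebra_inv_sets] by simp

lemma subalgebra_sigma_pr: "subalgebra M (sigma_pr M S)"
  by (auto simp: subalgebra_def space_sigma_pr sets_sigma_pr inv_sets_def)

sublocale pr: sigma_finite_subalgebra M "sigma_pr M S"
  by (intro finite_measure_subalgebra_is_sigma_finite finite_measure_subalgebra.intro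
      finite_measure_subalgebra_axioms.intro subalgebra_sigma_pr finite_measure_axioms)

text \<open>Membership in \<open>inv_sets\<close> asks for invariance almost everywhere only, so
  \<open>G\<close> itself is measurable, without a change of representative.\<close>

lemma invariant_measurable_sigma_pr:
  assumes G: "G \<in> L2_on M" "\<And>p. p \<in> recurrent_primes \<Longrightarrow> nrm (koopman M S p G - G) = 0"
  shows "G \<in> borel_measurable (sigma_pr M S)"
proof (rule measurableI)
  fix B :: "complex set" assume B: "B \<in> sets borel"
  have "G -` B \<inter> space M \<in> sets M"
    using measurable_sets[OF L2_space_measurable[OF L2_on_space[OF G(1)]] B] .
  moreover have "AE x in M. S p x \<in> G -` B \<inter> space M \<longleftrightarrow> x \<in> G -` B \<inter> space M" if p: "p \<in> recurrent_primes" for p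
  proof -
    have "AE x in M. G (S p x) = G x"
      using G(2)[OF p] koopman_invariant_iff[OF recurrent_prime_pos[OF p] G(1)] by simp
    then show ?thesis using AE_space
      by eventually_elim (use S_space recurrent_prime_pos[OF p] in auto)
  qed
  ultimately show "G -` B \<inter> space (sigma_pr M S) \<in> sets (sigma_pr M S)"
    by (simp add: sets_sigma_pr space_sigma_pr inv_sets_def)
qed simp

lemma complex_cond_exp_AE:
  assumes F: "F \<in> L2_space M" and G: "G \<in> L2_space M" "G \<in> borel_measurable (sigma_pr M S)"
    and eq: "\<And>A. A \<in> inv_sets \<Longrightarrow> (LINT x|M. indicator A x *\<^sub>R F x) = (LINT x|M. indicator A x *\<^sub>R G x)"
  shows "AE x in M. complex_cond_exp M (sigma_pr M S) F x = G x"
proof -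
  note [measurable] = G(2)
  have int: "integrable M (\<lambda>x. indicator A x *\<^sub>R f x)" if "A \<in> sets M" "f \<in> L2_space M" for A and f :: "'a \<Rightarrow> complex"
    using L2_imp_integrable[OF that(2)] that(1) by (rule integrable_mult_indicator[rotated])
  have "AE x in M. real_cond_exp M (sigma_pr M S) (\<lambda>y. Re (F y)) x = Re (G x)"
  proof (rule pr.real_cond_exp_charact)
    fix A assume "A \<in> sets (sigma_pr M S)"
    then have A: "A \<in> inv_sets" "A \<in> sets M" by (auto simp: sets_sigma_pr inv_sets_def)
    have "(\<integral>x\<in>A. Re (f x) \<partial>M) = Re (LINT x|M. indicator A x *\<^sub>R f x)" if "f \<in> L2_space M" for f
      using integral_Re[OF int[OF A(2) that]] by (simp add: set_lebesgue_integral_def)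
    then show "(\<integral>x\<in>A. Re (F x) \<partial>M) = (\<integral>x\<in>A. Re (G x) \<partial>M)" using F G(1) eq[OF A(1)] by simp
  qed (use L2_imp_integrable[OF F] L2_imp_integrable[OF G(1)] in auto)
  moreover have "AE x in M. real_cond_exp M (sigma_pr M S) (\<lambda>y. Im (F y)) x = Im (G x)"
  proof (rule pr.real_cond_exp_charact)
    fix A assume "A \<in> sets (sigma_pr M S)"
    then have A: "A \<in> inv_sets" "A \<in> sets M" by (auto simp: sets_sigma_pr inv_sets_def)
    have "(\<integral>x\<in>A. Im (f x) \<partial>M) = Im (LINT x|M. indicator A x *\<^sub>R f x)" if "f \<in> L2_space M" for f
      using integral_Im[OF int[OF A(2) that]] by (simp add: set_lebesgue_integral_def)
    then show "(\<integral>x\<in>A. Im (F x) \<partial>M) = (\<integral>x\<in>A. Im (G x) \<partial>M)" using F G(1) eq[OF A(1)] by simp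
  qed (use L2_imp_integrable[OF F] L2_imp_integrable[OF G(1)] in auto)
  ultimately show ?thesis by eventually_elim (simp add: complex_cond_exp_def complex_eq_iff)
qed

lemma complex_cond_exp_measurable [measurable]: "complex_cond_exp M (sigma_pr M S) F \<in> borel_measurable M"
  unfolding complex_cond_exp_def Complex_eq by measurable

lemma complex_cond_exp_in_L2:
  assumes "G \<in> L2_space M" "AE x in M. complex_cond_exp M (sigma_pr M S) F x = G x"
  shows "complex_cond_exp M (sigma_pr M S) F \<in> L2_space M"
  by (rule L2_space_cong_AE[OF assms(1)]) (use assms(2) in auto)

text \<open>The scalar \<open>c\<close> recovers a complex integral from the real form: equality for
  all complex \<open>c\<close> determines it.\<close>

lemma inner_indicator:
  assumes "A \<in> sets M" "f \<in> L2_space M"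
  shows "L2_inner M (\<lambda>x. c * indicator A x) (zero_ext M f) = c \<bullet> (LINT x|M. indicator A x *\<^sub>R f x)"
proof -
  have "integrable M (\<lambda>x. indicator A x *\<^sub>R f x)"
    using L2_imp_integrable[OF assms(2)] assms(1) by (rule integrable_mult_indicator[rotated])
  then have "c \<bullet> (LINT x|M. indicator A x *\<^sub>R f x) = (LINT x|M. c \<bullet> (indicator A x *\<^sub>R f x))"
    by (intro integral_inner_right[symmetric])
  also have "\<dots> = L2_inner M (\<lambda>x. c * indicator A x) (zero_ext M f)"
    unfolding L2_inner_def by (intro Bochner_Integration.integral_cong) (auto simp: zero_ext_def indicator_def)
  finally show ?thesis by simp
qed

text \<open>The functions \<open>c * indicator A\<close> with \<open>A\<close> in
  \<open>inv_sets\<close> are invariant. Testing the projection against them gives the integral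
  equations that characterise the conditional expectation.\<close>

theorem projection_is_cond_exp:
  assumes F: "F \<in> L2_space M"
  obtains G where "G \<in> L2_on M" "\<And>p. p \<in> recurrent_primes \<Longrightarrow> nrm (koopman M S p G - G) = 0"
    "AE x in M. complex_cond_exp M (sigma_pr M S) F x = G x"
    "(\<lambda>N. nrm (avg (zero_ext M F - G) (real N))) \<longlonglongrightarrow> 0"
proof -
  have cF: "zero_ext M F \<in> L2_on M" using F by (simp add: zero_ext_in_iff)
  obtain G where G: "G \<in> L2_on M" "\<And>p. p \<in> recurrent_primes \<Longrightarrow> nrm (koopman M S p G - G) = 0"
    "\<And>H. H \<in> L2_on M \<Longrightarrow> (\<And>p. p \<in> recurrent_primes \<Longrightarrow> nrm (koopman M S p H - H) = 0) \<Longrightarrow>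
       L2_inner M H (zero_ext M F) = L2_inner M H G"
    "(\<lambda>N. nrm (avg (zero_ext M F - G) (real N))) \<longlonglongrightarrow> 0"
    by (rule invariant_projection[OF cF]) blast
  have "AE x in M. complex_cond_exp M (sigma_pr M S) F x = G x"
  proof (rule complex_cond_exp_AE[OF F L2_on_space[OF G(1)] invariant_measurable_sigma_pr[OF G(1,2)]])
    fix A assume A: "A \<in> inv_sets"
    then have As: "A \<in> sets M" by (simp add: inv_sets_def)
    have "c \<bullet> (LINT x|M. indicator A x *\<^sub>R F x) = c \<bullet> (LINT x|M. indicator A x *\<^sub>R G x)" for c
      using G(3)[OF indicator_in[OF As, of c] indicator_invariant[OF A]]
        inner_indicator[OF As F, of c] inner_indicator[OF As L2_on_space[OF G(1)], of c] zero_ext_eq[OF G(1)] by simp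
    then have "\<forall>c. c \<bullet> (LINT x|M. indicator A x *\<^sub>R F x) = c \<bullet> (LINT x|M. indicator A x *\<^sub>R G x)" ..
    then show "(LINT x|M. indicator A x *\<^sub>R F x) = (LINT x|M. indicator A x *\<^sub>R G x)"
      unfolding vector_eq_ldot .
  qed
  then show ?thesis using that G by blast
qed

theorem mean_ergodic_theorem:
  assumes F: "F \<in> L2_space M"
  shows "\<exists>G. L2_tendsto M (\<lambda>N. euler_product M S N (complex_cond_exp M (sigma_pr M S) F)) G \<and>
    L2_tendsto M (\<lambda>N. ergodic_average S F N) G"
proof -
  define C where "C = complex_cond_exp M (sigma_pr M S) F"
  obtain G where G: "G \<in> L2_on M" "\<And>p. p \<in> recurrent_primes \<Longrightarrow> nrm (koopman M S p G - G) = 0"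
    "AE x in M. C x = G x" "(\<lambda>N. nrm (avg (zero_ext M F - G) (real N))) \<longlonglongrightarrow> 0"
    unfolding C_def by (rule projection_is_cond_exp[OF F]) blast
  have CL2: "C \<in> L2_space M" unfolding C_def
    using G(3) by (intro complex_cond_exp_in_L2[OF L2_on_space[OF G(1)]]) (simp add: C_def)
  \<comment> \<open>The Euler product is formed from the chosen representative \<open>C\<close>,
    which equals the invariant \<open>G\<close> only almost everywhere; invariance has to be carried
    over to \<open>H\<close>.\<close>
  define H where "H = zero_ext M C"
  have H: "H \<in> L2_on M" using CL2 by (simp add: H_def zero_ext_in_iff)
  have HG: "AE x in M. H x = G x" using G(3) AE_space by eventually_elim (simp add: H_def zero_ext_def)
  then have nHG: "nrm (G - H) = 0" using G(1) H by (subst nrm_eq_0_iff) auto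
  have Hinv: "nrm (koopman M S p H - H) = 0" if p: "p \<in> recurrent_primes" for p
  proof -
    note p0 = recurrent_prime_pos[OF p]
    have eq: "koopman M S p H - H = (koopman M S p G - G) - (koopman M S p (G - H) - (G - H))"
      using p0 G(1) H by (simp add: U_diff)
    show ?thesis
      unfolding eq using p0 G(1) H G(2)[OF p] nHG
      by (intro nrm_zero_diff[of "koopman M S p G - G"] nrm_zero_diff[of "koopman M S p (G - H)"]) (auto simp: U_in)
  qed
  have E: "zero_ext M (euler_product M S N C) \<in> L2_on M" "euler_rel (primes_upto N) H (zero_ext M (euler_product M S N C))" for N
    using euler_product[OF CL2] by (auto simp: H_def zero_ext_in_iff)
  obtain L where L: "L \<in> L2_on M" "(\<lambda>N. nrm (zero_ext M (euler_product M S N C) - L)) \<longlonglongrightarrow> 0"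
    "(\<lambda>N. nrm (avg H (real N) - L)) \<longlonglongrightarrow> 0"
    using avg_euler_tendsto[OF H Hinv summable_non_recurrent E] by blast
  have "(\<lambda>N. nrm (zero_ext M (ergodic_average S F N) - L)) \<longlonglongrightarrow> 0"
  proof (rule tendsto_sandwich[where f = "\<lambda>_. 0"
        and h = "\<lambda>N. nrm (avg (zero_ext M F - G) (real N)) + nrm (avg H (real N) - L)"])
    have cF: "zero_ext M F \<in> L2_on M" using F by (simp add: zero_ext_in_iff)
    show "\<forall>\<^sub>F N in sequentially. nrm (zero_ext M (ergodic_average S F N) - L)
        \<le> nrm (avg (zero_ext M F - G) (real N)) + nrm (avg H (real N) - L)"
      using eventually_gt_at_top[of 0]
    proof eventually_elim
      case (elim N)
      have eq: "zero_ext M (ergodic_average S F N) - L = avg (zero_ext M F - G) N + avg (G - H) N + (avg H N - L)"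
        unfolding zero_ext_ergodic_average using cF G(1) H by (simp add: avg_diff)
      have "nrm (zero_ext M (ergodic_average S F N) - L) \<le> nrm (avg (zero_ext M F - G) N + avg (G - H) N) + nrm (avg H N - L)"
        unfolding eq using cF G(1) H L(1) by (intro nrm_triangle V_add V_diff avg_in)
      also have "nrm (avg (zero_ext M F - G) N + avg (G - H) N) \<le> nrm (avg (zero_ext M F - G) N) + nrm (avg (G - H) N)"
        using cF G(1) H by (intro nrm_triangle V_diff avg_in)
      also have "nrm (avg (G - H) N) \<le> nrm (G - H)" using G(1) H elim by (intro nrm_avg_le) auto
      finally show ?case using nHG by linarith
    qed
    show "(\<lambda>N. nrm (avg (zero_ext M F - G) (real N)) + nrm (avg H (real N) - L)) \<longlonglongrightarrow> 0"
      using tendsto_add[OF G(4) L(3)] by simp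
    show "\<forall>\<^sub>F N in sequentially. 0 \<le> nrm (zero_ext M (ergodic_average S F N) - L)"
      by (simp add: nrm_eq L2_norm_nonneg)
  qed simp
  then have "L2_tendsto M (ergodic_average S F) L"
    using ergodic_average_in[OF F] L(1) by (intro L2_tendstoI)
  moreover have "L2_tendsto M (\<lambda>N. euler_product M S N C) L"
    using euler_product(1)[OF CL2] L by (intro L2_tendstoI)
  ultimately show ?thesis unfolding C_def by blast
qed

section \<open>Equivalence of pretentious ergodicity and convergence to the integral\<close>

lemma avg_const:
  assumes "N > 0"
  shows "avg (\<lambda>x. if x \<in> space M then c else 0) (real N) = (\<lambda>x. if x \<in> space M then c else 0)"
proof -
  define K where "K = (\<lambda>x. if x \<in> space M then c else 0)"
  have "koopman M S n K = K" if "n > 0" for n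
    using S_space[OF that] by (auto simp: koopman_def K_def fun_eq_iff)
  then have "psum K (real N) = (\<Sum>n\<in>{1..N}. K)"
    unfolding psum_def ints_of_nat by (intro sum.cong) simp_all
  also have "\<dots> = real N *\<^sub>R K" by (simp add: sum_constant_scaleR del: sum_constant)
  finally show ?thesis using assms by (simp add: avg_def flip: K_def)
qed

lemma const_in: "(\<lambda>x. if x \<in> space M then c else 0) \<in> L2_on M"
proof -
  have "(\<lambda>x. c) \<in> L2_space M" by (simp add: L2_space_def)
  then have "zero_ext M (\<lambda>x. c) \<in> L2_on M" by (simp add: zero_ext_in_iff)
  then show ?thesis by (simp add: zero_ext_def)
qed

text \<open>All sets in \<open>inv_sets\<close> have measure 0 or 1, so the conditional expectation
  is the constant \<open>c\<close>; the averages of a constant are that constant, which bypasses the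
  Euler product.\<close>

lemma ergodic_imp_avg_tendsto:
  assumes erg: "pretentiously_ergodic M S" and F: "F \<in> L2_space M"
  shows "L2_tendsto M (\<lambda>N. ergodic_average S F N) (\<lambda>x. LINT y|M. F y)"
proof -
  define c where "c = (LINT y|M. F y)"
  define K where "K = (\<lambda>x. if x \<in> space M then c else 0)"
  have K: "K \<in> L2_on M" unfolding K_def by (rule const_in)
  have constL2: "(\<lambda>x. c) \<in> L2_space M" by (simp add: L2_space_def)
  obtain G where G: "G \<in> L2_on M" "\<And>p. p \<in> recurrent_primes \<Longrightarrow> nrm (koopman M S p G - G) = 0"
    "AE x in M. complex_cond_exp M (sigma_pr M S) F x = G x" "(\<lambda>N. nrm (avg (zero_ext M F - G) (real N))) \<longlonglongrightarrow> 0"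
    by (rule projection_is_cond_exp[OF F]) blast
  have "AE x in M. complex_cond_exp M (sigma_pr M S) F x = c"
  proof (rule complex_cond_exp_AE[OF F constL2])
    fix A assume "A \<in> inv_sets"
    then have A: "A \<in> sets M" "measure M A \<in> {0, 1}"
      using erg by (auto simp: pretentiously_ergodic_def pretends_invariant_iff inv_sets_def)
    consider "AE x in M. x \<notin> A" | "AE x in M. x \<in> A"
      using A prob_eq_0[OF A(1)] prob_eq_1[OF A(1)] by auto
    then show "(LINT x|M. indicator A x *\<^sub>R F x) = (LINT x|M. indicator A x *\<^sub>R c)"
    proof cases
      case 1
      have "(LINT x|M. indicator A x *\<^sub>R f x) = 0" for f :: "'a \<Rightarrow> complex"
        using 1 by (intro integral_eq_zero_AE) (elim eventually_mono, simp)
      then show ?thesis by simp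
    next
      case 2
      have "(LINT x|M. indicator A x *\<^sub>R f x) = (LINT x|M. f x)" if "f \<in> L2_space M" for f
      proof (rule integral_cong_AE)
        show "AE x in M. indicator A x *\<^sub>R f x = f x" using 2 by eventually_elim simp
      qed (use A(1) L2_space_measurable[OF that] in measurable)
      from this[OF F] this[OF constL2] show ?thesis by (simp add: c_def prob_space)
    qed
  qed simp
  with G(3) AE_space have "AE x in M. (G - K) x = 0" by eventually_elim (simp add: K_def)
  then have nGK: "nrm (G - K) = 0" using G(1) K by (subst nrm_eq_0_iff) auto
  have cF: "zero_ext M F \<in> L2_on M" using F by (simp add: zero_ext_in_iff)
  have "(\<lambda>N. nrm (zero_ext M (ergodic_average S F N) - K)) \<longlonglongrightarrow> 0"
  proof (rule tendsto_sandwich[where f = "\<lambda>_. 0" and h = "\<lambda>N. nrm (avg (zero_ext M F - G) (real N))"])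
    show "\<forall>\<^sub>F N in sequentially. nrm (zero_ext M (ergodic_average S F N) - K) \<le> nrm (avg (zero_ext M F - G) (real N))"
      using eventually_gt_at_top[of 0]
    proof eventually_elim
      case (elim N)
      have eq: "zero_ext M (ergodic_average S F N) - K = avg (zero_ext M F - G) N + avg (G - K) N"
        unfolding zero_ext_ergodic_average using cF G(1) K avg_const[OF elim, of c] by (simp add: avg_diff K_def[symmetric])
      have "nrm (zero_ext M (ergodic_average S F N) - K) \<le> nrm (avg (zero_ext M F - G) N) + nrm (avg (G - K) N)"
        unfolding eq using cF G(1) K by (intro nrm_triangle V_diff avg_in)
      also have "nrm (avg (G - K) N) \<le> nrm (G - K)" using G(1) K elim by (intro nrm_avg_le) auto
      finally show ?case using nGK by linarith
    qed
    show "\<forall>\<^sub>F N in sequentially. 0 \<le> nrm (zero_ext M (ergodic_average S F N) - K)"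
      by (simp add: nrm_eq L2_norm_nonneg)
  qed (use G(4) in auto)
  then have "L2_tendsto M (ergodic_average S F) K"
    using ergodic_average_in[OF F] K by (intro L2_tendstoI)
  moreover have "L2_norm M (\<lambda>x. ergodic_average S F N x - K x) = L2_norm M (\<lambda>x. ergodic_average S F N x - c)" for N
    by (rule L2_norm_cong) (simp add: K_def)
  ultimately show ?thesis using constL2 by (simp add: L2_tendsto_def c_def)
qed

text \<open>The hypothesis is applied to the indicator of a set in \<open>inv_sets\<close>. Centred
  by its mean it is an invariant vector with averages tending to 0, hence null by
  \<open>zero_if_avg_tendsto_zero\<close>; an indicator that is almost everywhere constant has
  measure 0 or 1.\<close>

lemma avg_tendsto_imp_ergodic:
  assumes conv: "\<And>F. F \<in> L2_space M \<Longrightarrow> L2_tendsto M (\<lambda>N. ergodic_average S F N) (\<lambda>x. LINT y|M. F y)"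
  shows "pretentiously_ergodic M S"
  unfolding pretentiously_ergodic_def pretends_invariant_iff
proof (intro allI impI)
  fix A assume A: "A \<in> inv_sets"
  then have As: "A \<in> sets M" by (simp add: inv_sets_def)
  \<comment> \<open>The factor 1 matches the form \<open>c * indicator A\<close> in
    \<open>indicator_in\<close> and \<open>indicator_invariant\<close>.\<close>
  define I where "I = (\<lambda>x. 1 * indicator A x :: complex)"
  define c :: complex where "c = of_real (measure M A)"
  define K where "K = (\<lambda>x. if x \<in> space M then c else 0)"
  have I: "I \<in> L2_on M" unfolding I_def by (rule indicator_in[OF As])
  have K: "K \<in> L2_on M" unfolding K_def by (rule const_in)
  have "(LINT y|M. I y) = (LINT y|M. complex_of_real (indicator A y))"
    by (intro Bochner_Integration.integral_cong) (auto simp: I_def indicator_def)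
  also have "\<dots> = complex_of_real (LINT y|M. indicator A y)" by (rule integral_complex_of_real)
  also have "\<dots> = c" using sets.sets_into_space[OF As] by (simp add: c_def Int_absorb2)
  finally have int: "(LINT y|M. I y) = c" .
  have FV: "I - K \<in> L2_on M" using I K by (rule V_diff)
  have inv: "nrm (koopman M S p (I - K) - (I - K)) = 0" if p: "p \<in> recurrent_primes" for p
  proof -
    note p0 = recurrent_prime_pos[OF p]
    have "koopman M S p K = K" using S_space[OF p0] by (auto simp: koopman_def K_def fun_eq_iff)
    then have eq: "koopman M S p (I - K) - (I - K) = koopman M S p I - I" using I K p0 by (simp add: U_diff)
    show ?thesis unfolding eq unfolding I_def by (rule indicator_invariant[OF A p])
  qed
  have lim: "(\<lambda>N. nrm (avg (I - K) (real N))) \<longlonglongrightarrow> 0"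
  proof (rule Lim_transform_eventually)
    show "(\<lambda>N. L2_norm M (\<lambda>x. ergodic_average S I N x - c)) \<longlonglongrightarrow> 0"
      using conv[OF L2_on_space[OF I]] by (simp add: L2_tendsto_def int)
    show "\<forall>\<^sub>F N in sequentially. L2_norm M (\<lambda>x. ergodic_average S I N x - c) = nrm (avg (I - K) (real N))"
      using eventually_gt_at_top[of 0]
    proof eventually_elim
      case (elim N)
      have "avg (I - K) N = zero_ext M (ergodic_average S I N) - K"
        using I K avg_const[OF elim, of c] zero_ext_ergodic_average[of I N] zero_ext_eq[OF I]
        by (simp add: avg_diff K_def[symmetric])
      then show ?case unfolding nrm_eq
        by (simp only:) (rule L2_norm_cong, simp add: zero_ext_def K_def)
    qed
  qed
  have E: "zero_ext M (euler_product M S N (I - K)) \<in> L2_on M"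
    "euler_rel (primes_upto N) (I - K) (zero_ext M (euler_product M S N (I - K)))" for N
    using euler_product[OF L2_on_space[OF FV], of N] zero_ext_eq[OF FV] by (simp_all add: zero_ext_in_iff)
  have "nrm (I - K) = 0"
    by (rule zero_if_avg_tendsto_zero[OF FV inv summable_non_recurrent E lim])
  then have "AE x in M. (I - K) x = 0" using nrm_eq_0_iff[OF FV] by simp
  then have ae: "AE x in M. measure M A \<in> {0, 1}" using AE_space
  proof eventually_elim
    case (elim x)
    then have "indicator A x = c" by (simp add: I_def K_def)
    then have "Re (indicator A x) = measure M A" by (simp add: c_def)
    then show ?case by (cases "x \<in> A") auto
  qed
  show "measure M A \<in> {0, 1}"
  proof (rule ccontr)
    assume "measure M A \<notin> {0, 1}"
    with ae have "AE x in M. False" by simp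
    then show False by (simp add: AE_False)
  qed
qed

end

theorem theoremA:
  fixes M :: "'a::metric_space measure" and S :: "nat \<Rightarrow> 'a \<Rightarrow> 'a"
  assumes "multiplicative_system M S" and "finitely_generated M S"
  shows "(\<forall>F \<in> L2_space M. \<exists>G.
            L2_tendsto M (\<lambda>N. euler_product M S N (complex_cond_exp M (sigma_pr M S) F)) G \<and>
            L2_tendsto M (\<lambda>N. ergodic_average S F N) G) \<and>
         (pretentiously_ergodic M S \<longleftrightarrow>
            (\<forall>F \<in> L2_space M.
               L2_tendsto M (\<lambda>N. ergodic_average S F N) (\<lambda>x. LINT y|M. F y)))"
proof -
  interpret multiplicative_system M S by (rule assms(1))
  interpret fin_gen_system M S by standard (rule assms(2))
  show ?thesis
    using mean_ergodic_theorem ergodic_imp_avg_tendsto avg_tendsto_imp_ergodic by blast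
qed

end
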